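(* Let $\mathbb{T}=\mathbb{R}/\mathbb{Z}$ be the unit circle, let $G$ be the $3$-dimensional Heisenberg group of real upper unitriangular $3\times 3$ matrices, $\Gamma\subset G$ the subgroup of such matrices with integer entries, and $\Gamma\backslash G$ the Heisenberg nilmanifold. Let $\alpha\in\mathbb{Q}\cap[0,1)$ and let $\varphi_1,\varphi_2,\psi:\mathbb{R}\to\mathbb{R}$ be $C^\infty$-smooth periodic functions with period $1$. Define the skew product $S:\mathbb{T}\times\Gamma\backslash G\to\mathbb{T}\times\Gamma\backslash G$ by \[ S(t,\Gamma g)=\left(t+\alpha,\ \Gamma g\begin{pmatrix}1&\varphi_2(t)&\psi(t)\\0&1&\varphi_1(t)\\0&0&1\end{pmatrix}\right). \] Then the Möbius function $\mu$ is linearly disjoint from $(\mathbb{T}\times\Gamma\backslash G,S)$, i.e. \[ \lim_{N\to\infty}\frac1N\sum_{n\le N}\mu(n)f(S^n x)=0 \] for every $f\in C(\mathbb{T}\times\Gamma\backslash G)$ and every $x\in\mathbb{T}\times\Gamma\backslash G$.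
   Context: $\mu$ is the Möbius function: $\mu(n)=0$ if $n$ is not squarefree and $\mu(n)=(-1)^q$ if $n$ is a product of $q$ distinct primes. $C(X)$ denotes the continuous complex-valued functions on $X$. $\Gamma\backslash G$ carries the quotient topology and is compact. *)

theory Defs
  imports
    "HOL-Analysis.Analysis"
    "HOL-Algebra.Coset"
    "HOL-Computational_Algebra.Squarefree"
begin

subsection \<open>The Moebius function and linear disjointness\<close>

definition moebius :: "nat \<Rightarrow> int" where
  "moebius n = (if squarefree n then (-1) ^ card (prime_factors n) else 0)"

definition linearly_disjoint :: "(nat \<Rightarrow> complex) \<Rightarrow> 'a topology \<Rightarrow> ('a \<Rightarrow> 'a) \<Rightarrow> bool" where
  "linearly_disjoint \<xi> X T \<longleftrightarrow>
     (\<forall>f :: 'a \<Rightarrow> complex. continuous_map X euclidean f \<longrightarrow>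
        (\<forall>x \<in> topspace X.
           (\<lambda>N. 1 / of_nat N * (\<Sum>n = 1..N. \<xi> n * f ((T ^^ n) x))) \<longlonglongrightarrow> 0))"

subsection \<open>Quotient spaces\<close>

definition quotient_topology :: "'a topology \<Rightarrow> ('a \<Rightarrow> 'b) \<Rightarrow> 'b topology" where
  "quotient_topology X q =
     topology (\<lambda>U. U \<subseteq> q ` topspace X \<and> openin X {x \<in> topspace X. q x \<in> U})"

lemma openin_quotient_topology:
  "openin (quotient_topology X q) U \<longleftrightarrow>
     U \<subseteq> q ` topspace X \<and> openin X {x \<in> topspace X. q x \<in> U}"
proof -
  have Int: "{x \<in> topspace X. q x \<in> S \<inter> T} =
      {x \<in> topspace X. q x \<in> S} \<inter> {x \<in> topspace X. q x \<in> T}" for S T by blast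
  have Union: "{x \<in> topspace X. q x \<in> \<Union>K} = (\<Union>S\<in>K. {x \<in> topspace X. q x \<in> S})" for K by blast
  have "istopology (\<lambda>U. U \<subseteq> q ` topspace X \<and> openin X {x \<in> topspace X. q x \<in> U})"
    unfolding istopology_def Int Union by (intro conjI allI impI openin_Int openin_Union) auto
  then show ?thesis
    unfolding quotient_topology_def by (simp add: topology_inverse')
qed

lemma topspace_quotient_topology [simp]:
  "topspace (quotient_topology X q) = q ` topspace X"
proof
  show "topspace (quotient_topology X q) \<subseteq> q ` topspace X"
    using openin_topspace[of "quotient_topology X q"] unfolding openin_quotient_topology ..
  have "{x \<in> topspace X. q x \<in> q ` topspace X} = topspace X" by auto
  then have "openin (quotient_topology X q) (q ` topspace X)"
    by (simp add: openin_quotient_topology)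
  then show "q ` topspace X \<subseteq> topspace (quotient_topology X q)"
    by (rule openin_subset)
qed

lemma quotient_map_quotient_topology: "quotient_map X (quotient_topology X q) q"
  by (auto simp: quotient_map_def openin_quotient_topology)

subsection \<open>The circle\<close>

definition real_add_group :: "real monoid" where
  "real_add_group = \<lparr>carrier = UNIV, mult = (+), one = 0\<rparr>"

definition circle :: "real set topology" where
  "circle = quotient_topology euclidean (\<lambda>t. \<int> #>\<^bsub>real_add_group\<^esub> t)"

lemma group_real_add_group: "group real_add_group"
proof (rule groupI)
  fix x assume "x \<in> carrier real_add_group"
  show "\<exists>y\<in>carrier real_add_group. y \<otimes>\<^bsub>real_add_group\<^esub> x = \<one>\<^bsub>real_add_group\<^esub>"
    by (rule bexI[of _ "- x"]) (simp_all add: real_add_group_def)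
qed (simp_all add: real_add_group_def)

lemma topspace_circle: "topspace circle = rcosets\<^bsub>real_add_group\<^esub> \<int>"
  by (auto simp: circle_def RCOSETS_def real_add_group_def)

subsection \<open>The Heisenberg nilmanifold\<close>

text \<open>The arguments are the entries above the diagonal, read row by row.\<close>

definition heis :: "real \<Rightarrow> real \<Rightarrow> real \<Rightarrow> real^3^3" where
  "heis x z y = vector [vector [1, x, z],
                        vector [0, 1, y],
                        vector [0, 0, 1]]"

definition heisenberg_group :: "(real^3^3) monoid" where
  "heisenberg_group = \<lparr>carrier = {heis x z y | x z y. True}, mult = (**), one = mat 1\<rparr>"

definition heisenberg_lattice :: "(real^3^3) set" where
  "heisenberg_lattice = {A \<in> carrier heisenberg_group. \<forall>i j. A $ i $ j \<in> \<int>}"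

definition heisenberg_nilmanifold :: "(real^3^3) set topology" where
  "heisenberg_nilmanifold =
     quotient_topology (top_of_set (carrier heisenberg_group))
       (\<lambda>g. heisenberg_lattice #>\<^bsub>heisenberg_group\<^esub> g)"

lemma heis_entries [simp]:
  "heis x z y $ 1 $ 1 = 1" "heis x z y $ 1 $ 2 = x" "heis x z y $ 1 $ 3 = z"
  "heis x z y $ 2 $ 1 = 0" "heis x z y $ 2 $ 2 = 1" "heis x z y $ 2 $ 3 = y"
  "heis x z y $ 3 $ 1 = 0" "heis x z y $ 3 $ 2 = 0" "heis x z y $ 3 $ 3 = 1"
  by (simp_all add: heis_def)

lemma heis_mult: "heis x z y ** heis x' z' y' = heis (x + x') (z + z' + x * y') (y + y')"
  by (simp add: matrix_matrix_mult_def vec_eq_iff forall_3 sum_3)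

lemma heis_0: "heis 0 0 0 = mat 1"
  by (simp add: mat_def vec_eq_iff forall_3)

lemma heis_in_carrier: "heis x z y \<in> carrier heisenberg_group"
  by (auto simp: heisenberg_group_def)

lemma heis_in_lattice_iff:
  "heis x z y \<in> heisenberg_lattice \<longleftrightarrow> x \<in> \<int> \<and> z \<in> \<int> \<and> y \<in> \<int>"
  by (auto simp: heisenberg_lattice_def heis_in_carrier forall_3)

lemma group_heisenberg: "group heisenberg_group"
proof (rule groupI)
  show "\<one>\<^bsub>heisenberg_group\<^esub> \<in> carrier heisenberg_group"
    using heis_in_carrier[of 0 0 0] by (simp add: heis_0 heisenberg_group_def)
next
  fix A assume "A \<in> carrier heisenberg_group"
  then obtain x z y where "A = heis x z y"
    by (auto simp: heisenberg_group_def)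
  then have "heis (-x) (x * y - z) (-y) \<otimes>\<^bsub>heisenberg_group\<^esub> A = \<one>\<^bsub>heisenberg_group\<^esub>"
    by (simp add: heisenberg_group_def heis_mult flip: heis_0)
  then show "\<exists>B\<in>carrier heisenberg_group. B \<otimes>\<^bsub>heisenberg_group\<^esub> A = \<one>\<^bsub>heisenberg_group\<^esub>"
    using heis_in_carrier by blast
qed (use heis_in_carrier in \<open>auto simp: heisenberg_group_def heis_mult matrix_mul_assoc\<close>)

lemma subgroup_heisenberg_lattice: "subgroup heisenberg_lattice heisenberg_group"
proof (rule group.subgroupI[OF group_heisenberg])
  show "heisenberg_lattice \<subseteq> carrier heisenberg_group"
    by (auto simp: heisenberg_lattice_def)
  show "heisenberg_lattice \<noteq> {}"
    using heis_in_lattice_iff[of 0 0 0] by auto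
next
  fix A assume A: "A \<in> heisenberg_lattice"
  then obtain x z y where xyz: "A = heis x z y"
    by (auto simp: heisenberg_lattice_def heisenberg_group_def)
  have "heis (-x) (x * y - z) (-y) \<otimes>\<^bsub>heisenberg_group\<^esub> A = \<one>\<^bsub>heisenberg_group\<^esub>"
    by (simp add: xyz heisenberg_group_def heis_mult flip: heis_0)
  then have "inv\<^bsub>heisenberg_group\<^esub> A = heis (-x) (x * y - z) (-y)"
    using group.inv_equality[OF group_heisenberg] heis_in_carrier xyz by blast
  then show "inv\<^bsub>heisenberg_group\<^esub> A \<in> heisenberg_lattice"
    using A by (simp add: xyz heis_in_lattice_iff)
next
  fix A B assume AB: "A \<in> heisenberg_lattice" "B \<in> heisenberg_lattice"
  then obtain x z y x' z' y' where "A = heis x z y" "B = heis x' z' y'"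
    by (auto simp: heisenberg_lattice_def heisenberg_group_def)
  with AB show "A \<otimes>\<^bsub>heisenberg_group\<^esub> B \<in> heisenberg_lattice"
    by (simp add: heisenberg_group_def heis_mult heis_in_lattice_iff)
qed

lemma topspace_heisenberg_nilmanifold:
  "topspace heisenberg_nilmanifold = rcosets\<^bsub>heisenberg_group\<^esub> heisenberg_lattice"
  by (auto simp: heisenberg_nilmanifold_def RCOSETS_def)

subsection \<open>The skew product\<close>

definition smooth :: "(real \<Rightarrow> real) \<Rightarrow> bool" where
  "smooth \<phi> \<longleftrightarrow> (\<forall>k t. (deriv ^^ k) \<phi> differentiable (at t))"

text \<open>
  A point of the circle is a coset \<open>\<tau> \<subseteq> \<real>\<close>, on which 1-periodic functions are constant;
  \<open>the_elem\<close> extracts the common value.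
\<close>

definition skew_product ::
    "real \<Rightarrow> (real \<Rightarrow> real) \<Rightarrow> (real \<Rightarrow> real) \<Rightarrow> (real \<Rightarrow> real)
      \<Rightarrow> real set \<times> (real^3^3) set \<Rightarrow> real set \<times> (real^3^3) set" where
  "skew_product \<alpha> \<phi>\<^sub>1 \<phi>\<^sub>2 \<psi> = (\<lambda>(\<tau>, C).
     (\<tau> #>\<^bsub>real_add_group\<^esub> \<alpha>,
      C #>\<^bsub>heisenberg_group\<^esub> the_elem ((\<lambda>t. heis (\<phi>\<^sub>2 t) (\<psi> t) (\<phi>\<^sub>1 t)) ` \<tau>)))"

lemma skew_product_coset:
  assumes "\<And>t. \<phi>\<^sub>1 (t + 1) = \<phi>\<^sub>1 t" "\<And>t. \<phi>\<^sub>2 (t + 1) = \<phi>\<^sub>2 t" "\<And>t. \<psi> (t + 1) = \<psi> t"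
    and g: "g \<in> carrier heisenberg_group"
  shows "skew_product \<alpha> \<phi>\<^sub>1 \<phi>\<^sub>2 \<psi>
           (\<int> #>\<^bsub>real_add_group\<^esub> t, heisenberg_lattice #>\<^bsub>heisenberg_group\<^esub> g) =
         (\<int> #>\<^bsub>real_add_group\<^esub> (t + \<alpha>),
          heisenberg_lattice #>\<^bsub>heisenberg_group\<^esub>
            (g \<otimes>\<^bsub>heisenberg_group\<^esub> heis (\<phi>\<^sub>2 t) (\<psi> t) (\<phi>\<^sub>1 t)))"
proof -
  have per: "\<phi> (k + t) = \<phi> t" if "\<And>t. \<phi> (t + 1) = \<phi> t" "k \<in> \<int>" for \<phi> :: "real \<Rightarrow> real" and k t
  proof -
    interpret periodic_fun_simple' \<phi> by standard (rule that(1))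
    from that(2) obtain m where "k = of_int m" by (auto elim: Ints_cases)
    then show ?thesis by (simp add: add.commute plus_of_int)
  qed
  have coset: "\<int> #>\<^bsub>real_add_group\<^esub> t = (\<lambda>k. k + t) ` \<int>" for t :: real
    by (auto simp: r_coset_def real_add_group_def)
  have "(\<lambda>t. heis (\<phi>\<^sub>2 t) (\<psi> t) (\<phi>\<^sub>1 t)) ` (\<int> #>\<^bsub>real_add_group\<^esub> t)
      = {heis (\<phi>\<^sub>2 t) (\<psi> t) (\<phi>\<^sub>1 t)}"
  proof (rule Set.set_eqI)
    show "h \<in> (\<lambda>t. heis (\<phi>\<^sub>2 t) (\<psi> t) (\<phi>\<^sub>1 t)) ` (\<int> #>\<^bsub>real_add_group\<^esub> t) \<longleftrightarrow>
        h \<in> {heis (\<phi>\<^sub>2 t) (\<psi> t) (\<phi>\<^sub>1 t)}" for h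
      using per[where \<phi> = \<phi>\<^sub>1 and t = t, OF assms(1)] per[where \<phi> = \<phi>\<^sub>2 and t = t, OF assms(2)]
        per[where \<phi> = \<psi> and t = t, OF assms(3)] Ints_0
      unfolding coset by (auto simp: image_iff)
  qed
  moreover have "(\<int> #>\<^bsub>real_add_group\<^esub> t) #>\<^bsub>real_add_group\<^esub> \<alpha> = \<int> #>\<^bsub>real_add_group\<^esub> (t + \<alpha>)"
    by (auto simp: r_coset_def real_add_group_def add.assoc)
  moreover have "(heisenberg_lattice #>\<^bsub>heisenberg_group\<^esub> g) #>\<^bsub>heisenberg_group\<^esub> h
      = heisenberg_lattice #>\<^bsub>heisenberg_group\<^esub> (g \<otimes>\<^bsub>heisenberg_group\<^esub> h)" for h
    by (auto simp: r_coset_def heisenberg_group_def matrix_mul_assoc)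
  ultimately show ?thesis
    by (simp add: skew_product_def)
qed

end

theory Submission
  imports
    Defs
    "HOL-Complex_Analysis.Complex_Analysis"
    "HOL-Number_Theory.Number_Theory"
    "HOL-Computational_Algebra.Nth_Powers"
begin

text \<open>
  Write \<open>\<alpha> = k / q\<close>. Along a residue class modulo \<open>q\<close> the circle coordinate of the orbit is constant,
  and the other coordinate is \<open>\<Gamma> heis (x n) (z n) (y n)\<close> with \<open>x\<close>, \<open>y\<close> affine and \<open>z\<close> quadratic in \<open>n\<close>,
  the leading coefficient of \<open>z\<close> being half the product of the slopes \<open>u\<close> of \<open>x\<close> and \<open>v\<close> of \<open>y\<close>.
  Moving \<open>x n\<close> to its fractional part turns a function on the nilmanifold that vanishes for \<open>x \<in> \<int>\<close>
  into a continuous function on a torus; approximating it by trigonometric polynomials leaves the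
  bracket phases \<open>e (u V n\<^sup>2 / 2 - V n \<lfloor>u n + x0\<rfloor>) f (u n + x0)\<close> with \<open>V \<in> \<int> v\<close>, where \<open>f\<close> is 1-periodic
  with \<open>f 0 = 0\<close>.

  If \<open>V \<notin> \<rat> + \<rat> u\<close>, Katai's criterion applies: after van der Corput differencing, the correlations
  along \<open>p n\<close> and \<open>q n\<close> are nonresonant linear phases times continuous functions of \<open>u n\<close>. If
  \<open>V \<in> \<rat> + \<rat> u\<close>, the bracket phase is, on residue classes, a quadratic phase times a continuous
  function of \<open>u n\<close>. The only phases out of reach of Katai's criterion are the rational ones, that
  is, periodic sequences. For these, dilations by units reduce the claim to Dirichlet characters,
  where it follows from the nonvanishing of \<open>L (1 + i t, \<chi>)\<close> and Newman's Tauberian theorem.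
\<close>

subsection \<open>Averages\<close>

text \<open>Katai's criterion cannot see periodic sequences: if p and q are congruent modulo the
  period, then \<open>a (p * n) * cnj (a (q * n))\<close> is \<open>|a (p n)|^2\<close> and does not
  cancel. This is what brings in the Dirichlet characters. On the nilmanifold the obstacle is the
  lack of a continuous fundamental domain: reducing x modulo 1 changes z by a multiple of y, with a
  jump at every integer x. A function vanishing there does not feel the jump, and by sin^2 + cos^2 =
  1 every function is a sum of two such functions, the cosine half after a translation of x by 1/2.
  The leading coefficient of z arises from the corner entry of the matrix product, which accumulates
  the products of an x-increment with all later y-increments. It has exactly the value for which
  differencing the bracket phase leaves an integer multiple of V n and otherwise only functions of
  the position of u n modulo 1: the bracket grows like u n, and the linear terms so produced cancel
  those coming from the square.\<close>

definition mean_zero :: "(nat \<Rightarrow> complex) \<Rightarrow> bool" where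
  "mean_zero b \<longleftrightarrow> (\<lambda>N. 1 / of_nat N * (\<Sum>n = 1..N. b n)) \<longlonglongrightarrow> 0"

lemma mean_zero_iff:
  "mean_zero b \<longleftrightarrow> (\<forall>e>0. \<forall>\<^sub>F N in sequentially. norm (\<Sum>n = 1..N. b n) \<le> e * real N)"
proof
  assume "mean_zero b"
  show "\<forall>e>0. \<forall>\<^sub>F N in sequentially. norm (\<Sum>n = 1..N. b n) \<le> e * real N"
  proof (intro allI impI)
    fix e :: real assume "e > 0"
    have "\<forall>\<^sub>F N in sequentially. norm (1 / of_nat N * (\<Sum>n = 1..N. b n)) < e"
      using tendstoD[OF \<open>mean_zero b\<close>[unfolded mean_zero_def] \<open>e > 0\<close>] by (simp add: dist_norm)
    then show "\<forall>\<^sub>F N in sequentially. norm (\<Sum>n = 1..N. b n) \<le> e * real N"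
      using eventually_gt_at_top[of 0]
      by eventually_elim (auto simp: norm_mult norm_divide field_simps)
  qed
next
  assume R: "\<forall>e>0. \<forall>\<^sub>F N in sequentially. norm (\<Sum>n = 1..N. b n) \<le> e * real N"
  show "mean_zero b" unfolding mean_zero_def
  proof (rule tendstoI)
    fix e :: real assume "e > 0"
    then have "\<forall>\<^sub>F N in sequentially. norm (\<Sum>n = 1..N. b n) \<le> e/2 * real N" using R half_gt_zero by blast
    then show "\<forall>\<^sub>F N in sequentially. dist (1 / of_nat N * (\<Sum>n = 1..N. b n)) 0 < e"
      using eventually_gt_at_top[of 0]
    proof eventually_elim
      case (elim N)
      have "norm (\<Sum>n = 1..N. b n) < e * N" using elim \<open>e > 0\<close> by (smt (verit) mult_strict_right_mono field_sum_of_halves of_nat_0_less_iff)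
      then show ?case using elim by (simp add: norm_mult norm_divide field_simps)
    qed
  qed
qed

lemma mean_zeroI:
  assumes "\<And>e. e > 0 \<Longrightarrow> \<forall>\<^sub>F N in sequentially. norm (\<Sum>n = 1..N. b n) \<le> e * real N"
  shows "mean_zero b"
  using assms mean_zero_iff by blast

lemma mean_zeroD:
  "mean_zero b \<Longrightarrow> e > 0 \<Longrightarrow> \<forall>\<^sub>F N in sequentially. norm (\<Sum>n = 1..N. b n) \<le> e * real N"
  using mean_zero_iff by blast

lemma mean_zero_cong:
  assumes "\<And>n. n > 0 \<Longrightarrow> a n = b n"
  shows "mean_zero a \<longleftrightarrow> mean_zero b"
proof -
  have "(\<Sum>n = 1..N. a n) = (\<Sum>n = 1..N. b n)" for N by (intro sum.cong) (auto intro: assms)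
  then show ?thesis by (simp add: mean_zero_def)
qed

lemma mean_zero_0 [simp]: "mean_zero (\<lambda>n. 0)"
  by (simp add: mean_zero_def)

lemma mean_zero_add: "mean_zero a \<Longrightarrow> mean_zero b \<Longrightarrow> mean_zero (\<lambda>n. a n + b n)"
  unfolding mean_zero_def by (drule (1) tendsto_add) (simp add: sum.distrib algebra_simps)

lemma mean_zero_cmult: "mean_zero a \<Longrightarrow> mean_zero (\<lambda>n. c * a n)"
  unfolding mean_zero_def
  by (drule tendsto_mult_left[where c = c]) (simp add: sum_distrib_left[symmetric] mult.left_commute)

lemma mean_zero_sum: "(\<And>i. i \<in> I \<Longrightarrow> mean_zero (a i)) \<Longrightarrow> mean_zero (\<lambda>n. \<Sum>i\<in>I. a i n)"
  by (induction I rule: infinite_finite_induct) (auto intro: mean_zero_add)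

lemma mean_zero_cnj: "mean_zero a \<Longrightarrow> mean_zero (\<lambda>n. cnj (a n))"
  by (simp add: mean_zero_iff flip: cnj_sum)

lemma mean_zero_uniform_limit:
  assumes "\<And>e. e > 0 \<Longrightarrow> \<exists>b'. mean_zero b' \<and> (\<forall>n. norm (b n - b' n) \<le> e)"
  shows "mean_zero b"
proof (rule mean_zeroI)
  fix e :: real assume "e > 0"
  then obtain b' where b': "mean_zero b'" "\<And>n. norm (b n - b' n) \<le> e/2" using assms[of "e/2"] by auto
  show "\<forall>\<^sub>F N in sequentially. norm (\<Sum>n = 1..N. b n) \<le> e * real N"
    using mean_zeroD[OF b'(1) half_gt_zero[OF \<open>e > 0\<close>]]
  proof eventually_elim
    case (elim N)
    have "(\<Sum>n = 1..N. b n) = (\<Sum>n = 1..N. b' n) + (\<Sum>n = 1..N. b n - b' n)"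
      by (simp add: sum_subtractf)
    moreover have "norm (\<Sum>n = 1..N. b n - b' n) \<le> e / 2 * N"
      using sum_norm_le[of "{1..N}" "\<lambda>n. b n - b' n" "\<lambda>_. e/2"] b' by (simp add: mult.commute)
    ultimately show ?case using elim norm_triangle_ineq by (smt (verit) field_sum_of_halves distrib_right)
  qed
qed

lemma norm_sum_shift_diff_le:
  fixes b :: "nat \<Rightarrow> complex" and C :: real and N h :: nat
  assumes "\<And>n. norm (b n) \<le> C"
  shows "norm ((\<Sum>n = 1..N. b (n + h)) - (\<Sum>n = 1..N. b n)) \<le> 2 * C * h"
proof (induction h)
  case (Suc h)
  have "(\<Sum>n = 1..N. b (n + Suc h)) - (\<Sum>n = 1..N. b (n + h)) = b (N + Suc h) - b (Suc h)"
    by (induction N) (auto simp: algebra_simps)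
  moreover have "norm (b (N + Suc h) - b (Suc h)) \<le> 2 * C"
    using norm_triangle_ineq4[of "b (N + Suc h)" "b (Suc h)"] assms[of "N + Suc h"] assms[of "Suc h"] by simp
  ultimately have "norm ((\<Sum>n = 1..N. b (n + Suc h)) - (\<Sum>n = 1..N. b (n + h))) \<le> 2 * C" by simp
  then show ?case using Suc norm_triangle_ineq[of "(\<Sum>n = 1..N. b (n + Suc h)) - (\<Sum>n = 1..N. b (n + h))"
     "(\<Sum>n = 1..N. b (n + h)) - (\<Sum>n = 1..N. b n)"] by (simp add: algebra_simps)
qed simp

lemma mean_zero_shift:
  assumes "mean_zero b" "\<And>n. norm (b n) \<le> C"
  shows "mean_zero (\<lambda>n. b (n + h))"
proof (rule mean_zeroI)
  fix e :: real assume "e > 0"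
  have "\<forall>\<^sub>F N in sequentially. 2 * C * h \<le> e/2 * real N"
    using \<open>e > 0\<close> by real_asymp
  then show "\<forall>\<^sub>F N in sequentially. norm (\<Sum>n = 1..N. b (n + h)) \<le> e * real N"
    using mean_zeroD[OF assms(1) half_gt_zero[OF \<open>e > 0\<close>]]
  proof eventually_elim
    case (elim N)
    have "norm (\<Sum>n = 1..N. b (n + h)) \<le> norm ((\<Sum>n = 1..N. b (n + h)) - (\<Sum>n = 1..N. b n)) + norm (\<Sum>n = 1..N. b n)"
      by (metis diff_add_cancel norm_triangle_ineq)
    also have "\<dots> \<le> e * N" using elim norm_sum_shift_diff_le[of b C h N] assms(2) by simp
    finally show ?case .
  qed
qed

text \<open>Cauchy-Schwarz in \<open>m\<close> removes the bounded weights \<open>c\<close> and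
  leaves only correlations of the \<open>g i\<close> among themselves. The weights are 1 in van der
  Corput's inequality and the Moebius function in Katai's criterion.\<close>

lemma norm_sum_mult_sum_le:
  fixes c :: "nat \<Rightarrow> complex" and g :: "'i \<Rightarrow> nat \<Rightarrow> complex"
  assumes c: "\<And>m. norm (c m) \<le> 1" and "finite I"
  shows "(norm (\<Sum>m = 1..N. c m * (\<Sum>i\<in>I. g i m)))\<^sup>2
           \<le> real N * (\<Sum>i\<in>I. \<Sum>j\<in>I. norm (\<Sum>m = 1..N. g i m * cnj (g j m)))"
proof -
  define v where "v m = (\<Sum>i\<in>I. g i m)" for m
  have "norm (\<Sum>m = 1..N. c m * v m) \<le> (\<Sum>m = 1..N. norm (v m))"
    by (rule sum_norm_le) (simp add: norm_mult c mult_left_le_one_le)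
  then have "(norm (\<Sum>m = 1..N. c m * v m))\<^sup>2 \<le> (\<Sum>m = 1..N. norm (v m))\<^sup>2"
    by (rule power_mono) simp
  also have "\<dots> \<le> (\<Sum>m = 1..N. (norm (v m))\<^sup>2) * real N"
    using sum_squared_le_sum_of_squares[of "\<lambda>m. norm (v m)" "{1..N}"] by simp
  also have "(\<Sum>m = 1..N. (norm (v m))\<^sup>2) = Re (\<Sum>m = 1..N. v m * cnj (v m))"
    unfolding complex_norm_square[symmetric] by simp
  also have "(\<Sum>m = 1..N. v m * cnj (v m)) = (\<Sum>i\<in>I. \<Sum>j\<in>I. \<Sum>m = 1..N. g i m * cnj (g j m))"
    unfolding v_def cnj_sum sum_product
    by (subst sum.swap, intro sum.cong refl, subst sum.swap) simp
  also have "Re \<dots> \<le> norm \<dots>" by (rule complex_Re_le_cmod)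
  also have "\<dots> \<le> (\<Sum>i\<in>I. \<Sum>j\<in>I. norm (\<Sum>m = 1..N. g i m * cnj (g j m)))"
    by (intro sum_norm_le order_refl)
  finally show ?thesis by (simp add: v_def mult.commute mult_right_mono)
qed

text \<open>Averaging over the shifts \<open>i * l0\<close>, \<open>i < H\<close>, keeps all nonzero differences of shifts
  above the threshold \<open>l0\<close>.\<close>

lemma van_der_Corput:
  assumes b: "\<And>n. norm (b n) \<le> 1"
    and corr: "\<And>l. l \<ge> l0 \<Longrightarrow> mean_zero (\<lambda>n. b (n + l) * cnj (b n))"
  shows "mean_zero b"
proof (rule mean_zeroI)
  fix e :: real assume "e > 0"
  \<comment> \<open>The diagonal terms give \<open>H * N^2\<close> and the off-diagonal
    correlations, at most \<open>N / H\<close> each, another \<open>H * N^2\<close>. The total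
    \<open>2 * H * N^2\<close> is below \<open>(e / 2 * H * N)^2\<close> once
    \<open>H * e^2 \<ge> 8\<close>.\<close>
  obtain H :: nat where H: "H > 8 / e\<^sup>2" using reals_Archimedean2 by blast
  have "8 / e\<^sup>2 > 0" using \<open>e > 0\<close> by simp
  then have H0: "H > 0" using H by (cases "H = 0") auto
  define g where "g i n = b (n + i * l0)" for i n
  have corr': "mean_zero (\<lambda>n. g i n * cnj (g j n))" if "i \<noteq> j" for i j
  proof -
    have *: "mean_zero (\<lambda>n. g i n * cnj (g j n))" if "i > j" for i j
    proof -
      obtain d where d: "i = j + d" "d > 0" using \<open>i > j\<close> less_imp_add_positive by metis
      then have "d * l0 \<ge> l0" by simp
      have "mean_zero (\<lambda>n. b (n + j * l0 + d * l0) * cnj (b (n + j * l0)))"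
        by (rule mean_zero_shift[OF corr[OF \<open>d * l0 \<ge> l0\<close>], where C = 1])
           (use b in \<open>simp add: norm_mult mult_le_one\<close>)
      then show ?thesis by (simp add: g_def d algebra_simps)
    qed
    show ?thesis
    proof (cases "i > j")
      case False
      then have "mean_zero (\<lambda>n. g j n * cnj (g i n))" using * that by simp
      from mean_zero_cnj[OF this] show ?thesis by (simp add: mult.commute)
    qed (use * in simp)
  qed
  have ev1: "\<forall>\<^sub>F N in sequentially. \<forall>i\<in>{..<H}. \<forall>j\<in>{..<H}. i \<noteq> j \<longrightarrow>
      norm (\<Sum>m = 1..N. g i m * cnj (g j m)) \<le> 1 / H * N"
  proof (intro eventually_ball_finite finite_lessThan ballI)
    fix i j assume "i \<in> {..<H}" "j \<in> {..<H}"
    show "\<forall>\<^sub>F N in sequentially. i \<noteq> j \<longrightarrow> norm (\<Sum>m = 1..N. g i m * cnj (g j m)) \<le> 1 / H * N"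
      using mean_zeroD[OF corr'[of i j], of "1 / real H"] H0 by (cases "i = j") auto
  qed
  have ev2: "\<forall>\<^sub>F N in sequentially. 2 * real H * l0 \<le> e/2 * real N"
    using \<open>e > 0\<close> by real_asymp
  show "\<forall>\<^sub>F N in sequentially. norm (\<Sum>n = 1..N. b n) \<le> e * real N"
    using ev1 ev2
  proof eventually_elim
    case (elim N)
    define T where "T = (\<Sum>m = 1..N. 1 * (\<Sum>i<H. g i m))"
    have "(norm T)\<^sup>2 \<le> real N * (\<Sum>i<H. \<Sum>j<H. norm (\<Sum>m = 1..N. g i m * cnj (g j m)))"
      unfolding T_def by (rule norm_sum_mult_sum_le) auto
    also have "\<dots> \<le> real N * (\<Sum>i<H. \<Sum>j<H. (if i = j then real N else 0) + 1 / H * N)"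
    proof (intro mult_left_mono sum_mono)
      fix i j assume ij: "i \<in> {..<H}" "j \<in> {..<H}"
      show "norm (\<Sum>m = 1..N. g i m * cnj (g j m)) \<le> (if i = j then real N else 0) + 1 / H * N"
      proof (cases "i = j")
        case True
        have "norm (\<Sum>m = 1..N. g i m * cnj (g j m)) \<le> (\<Sum>m = 1..N. 1)"
          by (rule sum_norm_le) (use b in \<open>simp add: norm_mult mult_le_one g_def\<close>)
        then show ?thesis using True by (simp add: add_increasing2)
      qed (use elim ij in auto)
    qed simp
    also have "\<dots> = real N * (2 * H * real N)" using H0 by (simp add: sum.distrib sum_distrib_left[symmetric])
    finally have "(norm T)\<^sup>2 \<le> 2 * H * (real N)\<^sup>2" by (simp add: power2_eq_square mult_ac)
    also have "\<dots> \<le> (e / 2 * H * N)\<^sup>2"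
    proof -
      have "8 \<le> H * e\<^sup>2" using H \<open>e > 0\<close> by (simp add: field_simps)
      then have "8 * (H * (real N)\<^sup>2) \<le> H * e\<^sup>2 * (H * (real N)\<^sup>2)" by (intro mult_right_mono) auto
      then show ?thesis by (simp add: power_mult_distrib power_divide power2_eq_square field_simps)
    qed
    finally have T: "norm T \<le> e / 2 * H * N" using \<open>e > 0\<close> by (auto intro: power2_le_imp_le)
    have "H * (\<Sum>n = 1..N. b n) - T = (\<Sum>i<H. (\<Sum>n = 1..N. b n) - (\<Sum>n = 1..N. g i n))"
      unfolding T_def by (simp add: sum_subtractf sum.swap[of _ "{..<H}"])
    also have "norm \<dots> \<le> (\<Sum>i<H. 2 * real H * l0)"
    proof (rule sum_norm_le)
      fix i assume "i \<in> {..<H}"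
      have "norm ((\<Sum>n = 1..N. b n) - (\<Sum>n = 1..N. g i n)) \<le> 2 * 1 * real (i * l0)"
        using norm_sum_shift_diff_le[of b 1 "i * l0" N, OF b] unfolding g_def by (subst norm_minus_commute)
      also have "\<dots> \<le> 2 * real H * l0" using \<open>i \<in> _\<close> by (simp add: mult_right_mono)
      finally show "norm ((\<Sum>n = 1..N. b n) - (\<Sum>n = 1..N. g i n)) \<le> 2 * real H * l0" .
    qed
    also have "\<dots> \<le> H * (e / 2 * N)" using mult_left_mono[OF elim(2), of "real H"] by simp
    finally have "norm (H * (\<Sum>n = 1..N. b n)) \<le> H * (e / 2 * N) + e / 2 * H * N"
      using T norm_triangle_ineq[of "H * (\<Sum>n = 1..N. b n) - T" T] by (simp add: algebra_simps)
    then have "H * norm (\<Sum>n = 1..N. b n) \<le> H * (e * N)" by (simp add: norm_mult field_simps)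
    then show ?case using H0 by simp
  qed
qed

subsection \<open>Katai's orthogonality criterion\<close>

lemma card_multiples_le: "d > 0 \<Longrightarrow> card {n \<in> {1..N}. d dvd n} = N div d"
proof -
  assume "d > 0"
  have "{n \<in> {1..N}. d dvd n} = (\<lambda>m. d * m) ` {1..N div d}"
  proof (intro equalityI subsetI)
    fix n assume "n \<in> {n \<in> {1..N}. d dvd n}"
    then obtain m where "n = d * m" "1 \<le> d * m" "d * m \<le> N" by auto
    then show "n \<in> (\<lambda>m. d * m) ` {1..N div d}"
      using \<open>d > 0\<close> by (auto simp: less_eq_div_iff_mult_less_eq mult.commute intro!: imageI)
  qed (use \<open>d > 0\<close> in \<open>auto simp: less_eq_div_iff_mult_less_eq mult.commute\<close>)
  moreover have "inj_on (\<lambda>m. d * m) {1..N div d}" using \<open>d > 0\<close> by (auto simp: inj_on_def)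
  ultimately show ?thesis by (simp add: card_image)
qed

lemma le_of_mult_le: "0 < p \<Longrightarrow> p * k \<le> N \<Longrightarrow> k \<le> (N::nat)"
  by (rule order_trans[of _ "p * k"]) auto

lemma real_nat_div_ge: "real n / real d - 1 \<le> real (n div d)"
  using real_of_int_floor_ge_diff_one[of "real n / real d"] by (simp add: floor_divide_of_nat_eq)

text \<open>Erdos's argument. If the reciprocals of the primes from \<open>k\<close> on sum to less
  than 1/2, at most half of the integers up to \<open>N\<close> have a prime factor
  \<open>\<ge> k\<close>. Every other one is a square times a squarefree number built from the
  finitely many primes below \<open>k\<close>, so there are only \<open>O (sqrt N)\<close> of
  them.\<close>

lemma sum_inverse_primes_unbounded:
  "\<exists>P. finite P \<and> (\<forall>p\<in>P. prime p) \<and> (\<Sum>p\<in>P. 1 / real p) > B"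
proof (rule ccontr)
  assume "\<not> ?thesis"
  then have bd: "(\<Sum>p\<in>P. 1 / real p) \<le> B" if "finite P" "\<forall>p\<in>P. prime p" for P
    using that not_less by blast
  define f where "f n = (if prime n then 1 / real n else 0)" for n :: nat
  have "summable f"
  proof (rule summableI_nonneg_bounded[where x = B])
    show "sum f {..<n} \<le> B" for n
    proof -
      have "sum f {..<n} = (\<Sum>p\<in>{p\<in>{..<n}. prime p}. 1 / real p)"
        by (subst sum.inter_filter) (auto simp: f_def)
      also have "\<dots> \<le> B" by (rule bd) auto
      finally show ?thesis .
    qed
  qed (auto simp: f_def)
  then obtain k where k: "\<And>m n. m \<ge> k \<Longrightarrow> norm (sum f {m..<n}) < 1 / 2"
    using summable_Cauchy[THEN iffD1, rule_format, of f "1/2"] by auto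
  define X where "X = {p. prime p \<and> p < k}"
  have finX: "finite X" unfolding X_def by (rule finite_subset[of _ "{..<k}"]) auto
  \<comment> \<open>With this \<open>s\<close>, half of \<open>N = s ^ 2\<close> is
    \<open>2 * (2 ^ card X * s)\<close>, twice the bound for the set \<open>V\<close> of integers
    without large prime factors.\<close>
  define s :: nat where "s = 2 ^ (card X + 2)"
  define N where "N = s ^ 2"
  define U where "U = {n\<in>{1..N}. \<exists>p. prime p \<and> p \<ge> k \<and> p dvd n}"
  define V where "V = {1..N} - U"
  have "s > 0" by (simp add: s_def)
  have "real (card U) \<le> N / 2"
  proof -
    have "U \<subseteq> (\<Union>p\<in>{p\<in>{k..<Suc N}. prime p}. {n\<in>{1..N}. p dvd n})"
    proof
      fix n assume "n \<in> U"
      then obtain p where p: "1 \<le> n" "n \<le> N" "prime p" "k \<le> p" "p dvd n" by (auto simp: U_def)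
      then have "p \<le> N" using dvd_imp_le[of p n] by simp
      with p show "n \<in> (\<Union>p\<in>{p\<in>{k..<Suc N}. prime p}. {n\<in>{1..N}. p dvd n})" by auto
    qed
    then have "card U \<le> (\<Sum>p\<in>{p\<in>{k..<Suc N}. prime p}. card {n\<in>{1..N}. p dvd n})"
      by (intro order_trans[OF card_mono card_UN_le]) auto
    also have "\<dots> = (\<Sum>p\<in>{p\<in>{k..<Suc N}. prime p}. N div p)"
      by (intro sum.cong refl card_multiples_le) (auto simp: prime_gt_0_nat)
    finally have "real (card U) \<le> (\<Sum>p\<in>{p\<in>{k..<Suc N}. prime p}. real (N div p))" by (metis of_nat_le_iff of_nat_sum)
    also have "\<dots> \<le> (\<Sum>p\<in>{p\<in>{k..<Suc N}. prime p}. N * (1 / real p))"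
      by (intro sum_mono) (simp add: of_nat_div_le_of_nat)
    also have "\<dots> = N * sum f {k..<Suc N}"
      by (subst sum.inter_filter, simp, unfold sum_distrib_left, intro sum.cong) (auto simp: f_def)
    also have "\<dots> \<le> N * (1 / 2)" using k[of k "Suc N"] by (intro mult_left_mono) auto
    finally show ?thesis by simp
  qed
  moreover have "card V \<le> 2 ^ card X * s"
  proof -
    have "(\<lambda>n. (prime_factors (squarefree_part n), square_part n)) ` V \<subseteq> Pow X \<times> {1..s}"
    proof (intro image_subsetI SigmaI)
      fix n assume "n \<in> V"
      then have n: "n > 0" "n \<le> N" "\<And>p. prime p \<Longrightarrow> p dvd n \<Longrightarrow> p < k"
        by (auto simp: V_def U_def not_le)
      have d1: "squarefree_part n dvd n" and d2: "(square_part n)\<^sup>2 dvd n"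
        using squarefree_decompose[of n] dvd_triv_left dvd_triv_right by metis+
      show "prime_factors (squarefree_part n) \<in> Pow X"
        using n(3) d1 by (auto simp: X_def in_prime_factors_iff intro: dvd_trans)
      have "(square_part n)\<^sup>2 \<le> s\<^sup>2"
        using order_trans[OF dvd_imp_le[OF d2 n(1)] n(2)] unfolding N_def .
      moreover have "square_part n > 0" using d2 n by (intro Nat.gr0I) simp
      ultimately show "square_part n \<in> {1..s}" by (auto simp: power2_nat_le_eq_le Suc_le_eq)
    qed
    moreover have "inj_on (\<lambda>n. (prime_factors (squarefree_part n), square_part n)) V"
    proof (rule inj_onI)
      fix m n assume "m \<in> V" "n \<in> V" and eq: "(prime_factors (squarefree_part m), square_part m) = (prime_factors (squarefree_part n), square_part n)"
      have *: "squarefree_part (n::nat) = \<Prod>(prime_factors (squarefree_part n))" for n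
      proof -
        have "squarefree_part n = (\<Prod>p\<in>prime_factors (squarefree_part n). p ^ multiplicity p (squarefree_part n))"
          by (rule prime_factorization_nat) (simp add: zero_less_iff_neq_zero)
        also have "\<dots> = \<Prod>(prime_factors (squarefree_part n))"
        proof (rule prod.cong[OF refl])
          fix p assume p: "p \<in> prime_factors (squarefree_part n)"
          then have "multiplicity p (squarefree_part n) = 1"
            using prime_multiplicity_squarefree_part_le_Suc_0[of p n]
            by (auto simp: prime_factors_multiplicity)
          then show "p ^ multiplicity p (squarefree_part n) = p" by simp
        qed
        finally show ?thesis .
      qed
      from eq have "prime_factors (squarefree_part m) = prime_factors (squarefree_part n)"
        and sq: "square_part m = square_part n" by simp_all
      then have "squarefree_part m = squarefree_part n" by (subst *[of m], subst *[of n]) (rule arg_cong)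
      with sq show "m = n" by (rule squarefree_decomposition_unique)
    qed
    ultimately have "card V \<le> card (Pow X \<times> {1..s})"
      by (intro card_inj_on_le) (auto simp: finX)
    then show ?thesis by (simp add: card_cartesian_product card_Pow finX)
  qed
  moreover have "card U + card V = N"
    unfolding V_def by (subst card_Diff_subset) (auto simp: U_def intro!: le_add_diff_inverse card_mono[of "{1..N}", simplified])
  ultimately have "real N / 2 \<le> 2 ^ card X * s" by (smt (verit) field_sum_of_halves of_nat_add of_nat_le_iff of_nat_mult of_nat_power of_nat_numeral)
  then show False using \<open>s > 0\<close> unfolding N_def s_def by (simp add: power2_eq_square power_add)
qed

section \<open>Multiplicativity of the Moebius function\<close>

lemma moebius_0 [simp]: "moebius 0 = 0"
  by (simp add: moebius_def)

lemma moebius_1 [simp]: "moebius (Suc 0) = 1"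
  by (simp add: moebius_def)

lemma abs_moebius_le: "\<bar>moebius n\<bar> \<le> 1"
  by (simp add: moebius_def)

lemma norm_moebius_le: "norm (of_int (moebius n) :: complex) \<le> 1"
  unfolding norm_of_int using abs_moebius_le[of n] by linarith

lemma moebius_mult_coprime:
  assumes "coprime m n"
  shows "moebius (m * n) = moebius m * moebius n"
proof (cases "m = 0 \<or> n = 0")
  case False
  then have "prime_factors (m * n) = prime_factors m \<union> prime_factors n"
    by (simp add: prime_factors_product)
  moreover have "prime_factors m \<inter> prime_factors n = {}"
    using assms by (auto simp: in_prime_factors_iff dest: coprime_common_divisor)
  ultimately have "card (prime_factors (m * n)) = card (prime_factors m) + card (prime_factors n)"
    by (simp add: card_Un_disjoint)
  moreover have "squarefree (m * n) \<longleftrightarrow> squarefree m \<and> squarefree n"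
    using assms squarefree_mult_coprime squarefree_multD by blast
  ultimately show ?thesis by (simp add: moebius_def power_add)
qed auto

lemma moebius_prime: "prime p \<Longrightarrow> moebius p = -1"
  by (simp add: moebius_def squarefree_prime prime_prime_factors)

lemma moebius_mult_not_coprime: "\<not> coprime m n \<Longrightarrow> moebius (m * n) = 0"
proof -
  assume "\<not> coprime m n"
  then obtain d where "d dvd m" "d dvd n" "\<not> is_unit d" by (auto simp: coprime_def)
  then have "d ^ 2 dvd m * n" "\<not> is_unit d" by (auto simp: power2_eq_square mult_dvd_mono)
  then show ?thesis by (auto simp: moebius_def squarefree_def)
qed

text \<open>The number \<open>w n\<close> of primes of \<open>P\<close> dividing \<open>n\<close>
  has mean about \<open>A = (\<Sum>p\<in>P. 1 / p)\<close> and variance of the same order, so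
  \<open>A * S\<close> is close to the sum \<open>T\<close> weighted by \<open>w\<close>. Writing
  \<open>n = p * m\<close> and using \<open>moebius (p * m) = - moebius m\<close> for most pairs
  turns \<open>T\<close> into \<open>- M\<close>. There \<open>moebius m\<close> multiplies
  \<open>\<Sum>p\<in>P. a (p * m)\<close> and is removed by Cauchy-Schwarz; only correlations of
  \<open>a\<close> along different primes remain.\<close>

theorem Katai_orthogonality:
  fixes a :: "nat \<Rightarrow> complex"
  assumes a: "\<And>n. norm (a n) \<le> 1"
    and corr: "\<And>p q. prime p \<Longrightarrow> prime q \<Longrightarrow> p \<noteq> q \<Longrightarrow> mean_zero (\<lambda>n. a (p * n) * cnj (a (q * n)))"
  shows "mean_zero (\<lambda>n. of_int (moebius n) * a n)"
proof (rule mean_zeroI)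
  fix e :: real assume "e > 0"
  define B :: real where "B = (\<Sum>n. 1 / real (Suc n) ^ 2)"
  have smB: "summable (\<lambda>n. 1 / real (Suc n) ^ 2)"
    using inverse_power_summable[of 2, where 'a = real] by (subst summable_Suc_iff) (simp add: inverse_eq_divide)
  have B0: "B \<ge> 0" unfolding B_def by (intro suminf_nonneg smB) auto
  \<comment> \<open>The errors below add up to \<open>N * (2 * sqrt (A + 1) + B)\<close>: one square
    root from the variance, one from Cauchy-Schwarz, and \<open>B\<close> from the pairs with
    \<open>p dvd m\<close>. Division by \<open>A\<close> wins because \<open>A\<close> can be made
    arbitrarily large.\<close>
  have "\<forall>\<^sub>F A in at_top. 2 * sqrt (A + 1) + B \<le> e * A"
    using \<open>e > 0\<close> by real_asymp
  then obtain A0 where A0: "\<And>A. A \<ge> A0 \<Longrightarrow> 2 * sqrt (A + 1) + B \<le> e * A"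
    by (auto simp: eventually_at_top_linorder)
  obtain P where P: "finite P" "\<And>p. p \<in> P \<Longrightarrow> prime p" "(\<Sum>p\<in>P. 1 / real p) > max A0 1"
    using sum_inverse_primes_unbounded[of "max A0 1"] by metis
  define A where "A = (\<Sum>p\<in>P. 1 / real p)"
  have A: "A > 0" "2 * sqrt (A + 1) + B \<le> e * A" using P(3) A0[of A] by (auto simp: A_def)
  have Ppos: "p > 0" if "p \<in> P" for p using P(2) that prime_gt_0_nat by blast
  define w :: "nat \<Rightarrow> real" where "w n = (\<Sum>p\<in>P. if p dvd n then 1 else 0)" for n
  let ?mu = "\<lambda>n. of_int (moebius n) :: complex"
  have count: "(\<Sum>n = 1..N. if d dvd n then 1 else 0 :: real) = real (N div d)" if "d > 0" for d N
    unfolding card_multiples_le[OF that, of N, symmetric] by (subst sum.inter_filter[symmetric]) auto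
  \<comment> \<open>Turan-Kubilius inequality. The rounding in \<open>N div p\<close> only costs the
    term \<open>2 * A * card P\<close>, which does not depend on \<open>N\<close>.\<close>
  have TK: "(\<Sum>n = 1..N. (w n - A)\<^sup>2) \<le> N * A + 2 * A * card P" for N
  proof -
    have "(\<Sum>n = 1..N. (w n)\<^sup>2) = (\<Sum>p\<in>P. \<Sum>q\<in>P. \<Sum>n = 1..N. (if p dvd n then 1 else 0) * (if q dvd n then 1 else 0))"
      unfolding w_def power2_eq_square sum_product
      by (simp only: sum.swap[of _ _ "{1..N}"])
    also have "\<dots> \<le> (\<Sum>p\<in>P. \<Sum>q\<in>P. N * (1 / p * (1 / q)) + (if q = p then N * (1 / p) else 0))"
    proof (intro sum_mono)
      fix p q assume pq: "p \<in> P" "q \<in> P"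
      show "(\<Sum>n = 1..N. (if p dvd n then 1 else 0) * (if q dvd n then 1 else 0)) \<le>
          N * (1 / p * (1 / q)) + (if q = p then N * (1 / p) else 0)"
      proof (cases "p = q")
        case True
        have "(\<Sum>n = 1..N. (if p dvd n then 1 else 0) * (if q dvd n then 1 else 0)) = (\<Sum>n = 1..N. if p dvd n then 1 else 0 :: real)"
          by (intro sum.cong) (auto simp: True)
        also have "\<dots> \<le> N / p" using count[of p N] Ppos[OF pq(1)] by (simp add: of_nat_div_le_of_nat)
        finally show ?thesis using True by (simp add: add_increasing)
      next
        case False
        then have "coprime p q" using P(2) pq primes_coprime by blast
        then have "(\<Sum>n = 1..N. (if p dvd n then 1 else 0) * (if q dvd n then 1 else 0)) = (\<Sum>n = 1..N. if p * q dvd n then 1 else 0 :: real)"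
          by (intro sum.cong) (auto simp: divides_mult dest: dvd_mult_left dvd_mult_right)
        also have "\<dots> \<le> N / (p * q)" using count[of "p * q" N] Ppos pq of_nat_div_le_of_nat[of N "p * q", where 'a = real] by simp
        finally show ?thesis using False by simp
      qed
    qed
    also have "\<dots> = N * (A * A) + N * A"
      by (simp add: sum.distrib P(1) A_def sum_distrib_left sum_distrib_right mult_ac)
    finally have w2: "(\<Sum>n = 1..N. (w n)\<^sup>2) \<le> N * (A * A) + N * A" .
    have "N * A - card P = (\<Sum>p\<in>P. N / p - 1)"
      by (simp add: A_def sum_subtractf sum_distrib_left)
    also have "\<dots> \<le> (\<Sum>p\<in>P. real (N div p))"
      by (intro sum_mono) (rule real_nat_div_ge)
    also have "\<dots> = (\<Sum>n = 1..N. w n)"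
      unfolding w_def by (subst sum.swap, intro sum.cong refl count[symmetric] Ppos)
    finally have w1: "N * A - card P \<le> (\<Sum>n = 1..N. w n)" .
    have "(\<Sum>n = 1..N. (w n - A)\<^sup>2) = (\<Sum>n = 1..N. (w n)\<^sup>2) - 2 * A * (\<Sum>n = 1..N. w n) + N * A\<^sup>2"
      by (simp add: power2_diff sum.distrib sum_subtractf sum_distrib_left mult_ac)
    also have "\<dots> \<le> N * (A * A) + N * A - 2 * A * (N * A - card P) + N * A\<^sup>2"
    proof -
      have "2 * A * (N * A - card P) \<le> 2 * A * (\<Sum>n = 1..N. w n)"
        by (rule mult_left_mono[OF w1]) (use A(1) in simp)
      then show ?thesis using w2 by linarith
    qed
    also have "\<dots> = N * A + 2 * A * card P" by (simp add: power2_eq_square algebra_simps)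
    finally show ?thesis .
  qed
  \<comment> \<open>Truncation to \<open>p * m \<le> N\<close> lets all sums over \<open>m\<close>
    run up to the same \<open>N\<close>; the product for \<open>p\<close> and \<open>q\<close> then
    lives on \<open>m \<le> N div max p q\<close>.\<close>
  define g where "g N p m = (if p * m \<le> N then a (p * m) else 0)" for N p m
  \<comment> \<open>Chosen so that the at most \<open>card P ^ 2\<close> off-diagonal correlations
    contribute at most \<open>N\<close> altogether.\<close>
  define d where "d = 1 / real (Suc (card P ^ 2))"
  have "d > 0" unfolding d_def by (simp only: zero_less_divide_1_iff of_nat_0_less_iff zero_less_Suc)
  have dP: "d * real (card P) ^ 2 \<le> 1" unfolding d_def by (simp add: divide_le_eq add_pos_nonneg)
  have ev1: "\<forall>\<^sub>F N in sequentially. \<forall>p\<in>P. \<forall>q\<in>P. p \<noteq> q \<longrightarrow>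
      norm (\<Sum>m = 1..N. g N p m * cnj (g N q m)) \<le> d * N"
  proof (intro eventually_ball_finite P(1) ballI)
    fix p q assume pq: "p \<in> P" "q \<in> P"
    show "\<forall>\<^sub>F N in sequentially. p \<noteq> q \<longrightarrow> norm (\<Sum>m = 1..N. g N p m * cnj (g N q m)) \<le> d * N"
    proof (cases "p = q")
      case False
      have "filterlim (\<lambda>N. N div max p q) sequentially sequentially"
        by (rule filterlim_at_top_div_const_nat) (use Ppos pq in \<open>auto simp: less_max_iff_disj\<close>)
      from eventually_compose_filterlim[OF mean_zeroD[OF corr[OF P(2)[OF pq(1)] P(2)[OF pq(2)] False] \<open>d > 0\<close>] this]
      show ?thesis
      proof eventually_elim
        case (elim N)
        have "(\<Sum>m = 1..N. g N p m * cnj (g N q m)) = (\<Sum>m = 1..N div max p q. a (p * m) * cnj (a (q * m)))"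
        proof (rule sum.mono_neutral_cong_right)
          have *: "m \<le> N div max p q \<longleftrightarrow> p * m \<le> N \<and> q * m \<le> N" for m
            using Ppos[OF pq(1)]
            by (subst less_eq_div_iff_mult_less_eq) (auto simp: less_max_iff_disj mult.commute[of m] nat_mult_max_left)
          show "{1..N div max p q} \<subseteq> {1..N}" by (auto intro: order_trans[OF _ div_le_dividend])
          show "\<forall>i\<in>{1..N} - {1..N div max p q}. g N p i * cnj (g N q i) = 0"
            using * by (auto simp: g_def)
          show "g N p m * cnj (g N q m) = a (p * m) * cnj (a (q * m))" if "m \<in> {1..N div max p q}" for m
            using * that by (simp add: g_def)
        qed simp
        also have "norm \<dots> \<le> d * real (N div max p q)" using elim by simp
        also have "\<dots> \<le> d * N" using \<open>d > 0\<close> by (intro mult_left_mono) auto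
        finally show ?case by simp
      qed
    qed simp
  qed
  have ev2: "\<forall>\<^sub>F N in sequentially. 2 * A * card P \<le> real N"
    by real_asymp
  show "\<forall>\<^sub>F N in sequentially. norm (\<Sum>n = 1..N. ?mu n * a n) \<le> e * real N"
    using ev1 ev2
  proof eventually_elim
    case (elim N)
    define S where "S = (\<Sum>n = 1..N. ?mu n * a n)"
    define T where "T = (\<Sum>n = 1..N. ?mu n * a n * w n)"
    define M where "M = (\<Sum>m = 1..N. ?mu m * (\<Sum>p\<in>P. g N p m))"
    have "A * S - T = (\<Sum>n = 1..N. ?mu n * a n * (A - w n))"
      by (simp add: S_def T_def sum_subtractf sum_distrib_left algebra_simps)
    also have "norm \<dots> \<le> (\<Sum>n = 1..N. \<bar>w n - A\<bar>)"
    proof (rule sum_norm_le)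
      fix n
      have "norm (?mu n * a n * (A - w n)) = norm (?mu n) * norm (a n) * \<bar>A - w n\<bar>"
        by (metis norm_mult norm_of_real of_real_diff real_norm_def)
      also have "\<dots> \<le> 1 * \<bar>A - w n\<bar>"
        using norm_moebius_le[of n] a[of n] by (intro mult_right_mono mult_le_one) auto
      finally show "norm (?mu n * a n * (A - w n)) \<le> \<bar>w n - A\<bar>" by simp
    qed
    also have "\<dots> \<le> N * sqrt (A + 1)"
    proof (rule power2_le_imp_le)
      have "(\<Sum>n = 1..N. \<bar>w n - A\<bar>)\<^sup>2 \<le> (\<Sum>n = 1..N. (w n - A)\<^sup>2) * N"
        using sum_squared_le_sum_of_squares[of "\<lambda>n. \<bar>w n - A\<bar>" "{1..N}"] by simp
      also have "\<dots> \<le> (N * A + N) * N" using TK[of N] elim(2) by (intro mult_right_mono) auto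
      also have "\<dots> = (N * sqrt (A + 1))\<^sup>2" using A(1) by (simp add: power_mult_distrib power2_eq_square algebra_simps)
      finally show "(\<Sum>n = 1..N. \<bar>w n - A\<bar>)\<^sup>2 \<le> (N * sqrt (A + 1))\<^sup>2" .
    qed (use A(1) in auto)
    finally have 1: "norm (A * S - T) \<le> N * sqrt (A + 1)" .
    have "T = (\<Sum>p\<in>P. \<Sum>n = 1..N. if p dvd n then ?mu n * a n else 0)"
      unfolding T_def w_def by (subst sum.swap) (auto simp: sum_distrib_left intro!: sum.cong)
    also have "\<dots> = (\<Sum>p\<in>P. \<Sum>m = 1..N. ?mu (p * m) * g N p m)"
    proof (rule sum.cong[OF refl])
      fix p assume "p \<in> P"
      have "(\<Sum>n = 1..N. if p dvd n then ?mu n * a n else 0) = (\<Sum>n\<in>{n\<in>{1..N}. p dvd n}. ?mu n * a n)"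
        by (subst sum.inter_filter) auto
      also have "\<dots> = (\<Sum>m\<in>{m\<in>{1..N}. p * m \<le> N}. ?mu (p * m) * a (p * m))"
        by (rule sum.reindex_bij_witness[of _ "\<lambda>m. p * m" "\<lambda>n. n div p"])
           (use Ppos[OF \<open>p \<in> P\<close>] in \<open>auto elim!: dvdE intro: le_of_mult_le\<close>)
      also have "\<dots> = (\<Sum>m = 1..N. ?mu (p * m) * g N p m)"
        by (subst sum.inter_filter) (auto simp: g_def intro!: sum.cong)
      finally show "(\<Sum>n = 1..N. if p dvd n then ?mu n * a n else 0) = (\<Sum>m = 1..N. ?mu (p * m) * g N p m)" .
    qed
    finally have T: "T = (\<Sum>p\<in>P. \<Sum>m = 1..N. ?mu (p * m) * g N p m)" .
    have M': "M = (\<Sum>p\<in>P. \<Sum>m = 1..N. ?mu m * g N p m)"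
      unfolding M_def by (subst sum.swap) (simp add: sum_distrib_left)
    \<comment> \<open>The factor \<open>moebius (p * m) + moebius m\<close> vanishes unless
      \<open>p dvd m\<close>, which leaves at most \<open>N / p^2\<close> values of
      \<open>m\<close>. Summed over \<open>P\<close> this stays below \<open>N * B\<close> however
      large \<open>P\<close> is.\<close>
    have "T + M = (\<Sum>p\<in>P. \<Sum>m = 1..N. (?mu (p * m) + ?mu m) * g N p m)"
      unfolding T M' by (simp add: sum.distrib distrib_right)
    also have "norm \<dots> \<le> (\<Sum>p\<in>P. N * (1 / real p ^ 2))"
    proof (rule sum_norm_le)
      fix p assume p: "p \<in> P"
      have "norm (\<Sum>m = 1..N. (?mu (p * m) + ?mu m) * g N p m) \<le> (\<Sum>m = 1..N. if p dvd m \<and> p * m \<le> N then 1 else 0)"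
      proof (rule sum_norm_le)
        fix m
        show "norm ((?mu (p * m) + ?mu m) * g N p m) \<le> (if p dvd m \<and> p * m \<le> N then 1 else 0)"
        proof (cases "p dvd m")
          case True
          then have "\<not> coprime p m" using P(2)[OF p] by (metis coprime_absorb_left not_prime_unit)
          then show ?thesis using True norm_moebius_le[of m] a[of "p * m"]
            by (simp add: g_def moebius_mult_not_coprime norm_mult mult_le_one)
        next
          case False
          then have "coprime p m" using P(2)[OF p] prime_imp_coprime by blast
          then show ?thesis using False P(2)[OF p] by (simp add: moebius_mult_coprime moebius_prime)
        qed
      qed
      also have "\<dots> = real (card {m\<in>{1..N}. p dvd m \<and> p * m \<le> N})"
        by (subst sum.inter_filter[symmetric]) auto
      also have "{m\<in>{1..N}. p dvd m \<and> p * m \<le> N} = {m\<in>{1..N div p}. p dvd m}"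
        using Ppos[OF p] by (auto simp: less_eq_div_iff_mult_less_eq mult.commute[of _ p] intro: le_of_mult_le)
      also have "real (card \<dots>) \<le> N * (1 / real p ^ 2)"
        using card_multiples_le[OF Ppos[OF p], of "N div p"] of_nat_div_le_of_nat[of N "p * p", where 'a = real]
        by (simp add: div_mult2_eq power2_eq_square)
      finally show "norm (\<Sum>m = 1..N. (?mu (p * m) + ?mu m) * g N p m) \<le> N * (1 / real p ^ 2)" .
    qed
    also have "\<dots> = N * (\<Sum>p\<in>P. 1 / real p ^ 2)" by (simp add: sum_distrib_left)
    also have "\<dots> \<le> N * B"
    proof (rule mult_left_mono)
      have "inj_on (\<lambda>p. p - 1) P" using Ppos by (intro inj_onI) (metis Suc_diff_1)
      then have "(\<Sum>p\<in>P. 1 / real p ^ 2) = (\<Sum>n\<in>(\<lambda>p. p - 1) ` P. 1 / real (Suc n) ^ 2)"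
        using Ppos by (subst sum.reindex) (auto intro!: sum.cong simp: of_nat_diff Suc_leI)
      also have "\<dots> \<le> B" unfolding B_def by (intro sum_le_suminf smB) (use P(1) in auto)
      finally show "(\<Sum>p\<in>P. 1 / real p ^ 2) \<le> B" .
    qed simp
    finally have 2: "norm (T + M) \<le> N * B" .
    have 3: "norm M \<le> N * sqrt (A + 1)"
    proof (rule power2_le_imp_le)
      have "(norm M)\<^sup>2 \<le> N * (\<Sum>p\<in>P. \<Sum>q\<in>P. norm (\<Sum>m = 1..N. g N p m * cnj (g N q m)))"
        unfolding M_def by (rule norm_sum_mult_sum_le[OF norm_moebius_le P(1)])
      also have "\<dots> \<le> N * (\<Sum>p\<in>P. \<Sum>q\<in>P. (if q = p then N * (1 / p) else 0) + d * N)"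
      proof (intro mult_left_mono sum_mono)
        fix p q assume pq: "p \<in> P" "q \<in> P"
        show "norm (\<Sum>m = 1..N. g N p m * cnj (g N q m)) \<le> (if q = p then N * (1 / p) else 0) + d * N"
        proof (cases "q = p")
          case True
          have "norm (\<Sum>m = 1..N. g N p m * cnj (g N q m)) \<le> (\<Sum>m = 1..N. if m \<le> N div p then 1 else 0)"
            using a Ppos[OF pq(1)] by (intro sum_norm_le)
              (auto simp: True g_def norm_mult mult_le_one less_eq_div_iff_mult_less_eq mult.commute)
          also have "\<dots> = real (card {m\<in>{1..N}. m \<le> N div p})"
            by (subst sum.inter_filter[symmetric]) auto
          also have "\<dots> \<le> real (card {1..N div p})" by (intro of_nat_mono card_mono) auto
          also have "\<dots> \<le> N * (1 / p)" using of_nat_div_le_of_nat[of N p, where 'a = real] by simp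
          finally show ?thesis using True \<open>d > 0\<close> by (simp add: add_increasing2)
        qed (use elim(1) pq in auto)
      qed simp
      also have "\<dots> = N * (N * A + d * card P ^ 2 * N)"
        by (simp add: sum.distrib P(1) A_def sum_distrib_left power2_eq_square algebra_simps)
      also have "\<dots> \<le> N * (N * A + 1 * N)"
        using mult_right_mono[OF dP, of "real N"] by (intro mult_left_mono add_left_mono) auto
      also have "\<dots> = (N * sqrt (A + 1))\<^sup>2" using A(1) by (simp add: power_mult_distrib power2_eq_square algebra_simps)
      finally show "(norm M)\<^sup>2 \<le> (N * sqrt (A + 1))\<^sup>2" .
    qed (use A(1) in auto)
    have "A * norm S = norm (A * S)" using A(1) by (simp add: norm_mult)
    also have "A * S = (A * S - T) + (T + M) - M" by simp
    also have "norm \<dots> \<le> norm (A * S - T) + norm (T + M) + norm M"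
      by (rule order_trans[OF norm_triangle_ineq4 add_right_mono[OF norm_triangle_ineq]])
    also have "\<dots> \<le> N * (2 * sqrt (A + 1) + B)" using 1 2 3 by (simp add: algebra_simps)
    also have "\<dots> \<le> N * (e * A)" using A(2) by (intro mult_left_mono) auto
    finally have "A * norm S \<le> A * (e * N)" by (simp add: mult_ac)
    then show ?case using A(1) by (simp add: S_def)
  qed
qed

subsection \<open>Newman's Tauberian theorem\<close>

lemma has_contour_integral_inverse_part_circlepath:
  assumes "a < b" "R > 0"
  shows "((\<lambda>z. 1 / z) has_contour_integral (\<i> * of_real (b - a))) (part_circlepath 0 R a b)"
proof -
  have "((\<lambda>t. \<i>) has_integral (\<i> * of_real (b - a))) {a..b}"
    using has_integral_const_real[of \<i> a b] assms by (simp add: scaleR_conv_of_real mult.commute)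
  also have "(\<lambda>t. \<i>) = (\<lambda>t. 1 / (0 + R * cis t) * R * \<i> * cis t)"
    using assms by (auto simp: fun_eq_iff field_simps)
  finally show ?thesis using assms by (simp add: has_contour_integral_part_circlepath_iff)
qed

lemma Newman_kernel_circle:
  fixes z :: complex
  assumes "norm z = R" "R > 0"
  shows "norm (1 / z + z / R\<^sup>2) = 2 * \<bar>Re z\<bar> / R\<^sup>2"
proof -
  have "1 / z = cnj z / R\<^sup>2"
  proof -
    have "z \<noteq> 0" "R \<noteq> 0" using assms by auto
    moreover have "z * cnj z = R\<^sup>2" using complex_norm_square[of z] assms by simp
    ultimately show ?thesis by (simp add: field_simps)
  qed
  then have "1 / z + z / R\<^sup>2 = of_real (2 * Re z / R\<^sup>2)"
    using complex_add_cnj[of z] by (simp add: add_divide_distrib[symmetric] add.commute)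
  then show ?thesis using assms by (metis abs_divide abs_mult abs_numeral abs_power2 norm_of_real)
qed

text \<open>The star centre is -1. This slit plane avoids 0 and contains both the left half circle
  and the left box, so a function with its only singularity at 0 has the same integral along the two
  paths.\<close>

lemma starlike_slit: "starlike (- {z::complex. Im z = 0 \<and> Re z \<ge> 0})"
  unfolding starlike_def
proof (intro bexI[of _ "-1"] ballI subsetI)
  fix x w :: complex assume x: "x \<in> - {z. Im z = 0 \<and> Re z \<ge> 0}" and w: "w \<in> closed_segment (-1) x"
  then obtain u where u: "0 \<le> u" "u \<le> 1" "w = (1 - u) *\<^sub>R (-1) + u *\<^sub>R x" by (auto simp: in_segment)
  show "w \<in> - {z. Im z = 0 \<and> Re z \<ge> 0}"
  proof
    assume "w \<in> {z. Im z = 0 \<and> Re z \<ge> 0}"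
    then have *: "u * Im x = 0" "u - 1 + u * Re x \<ge> 0" using u by auto
    then have "u > 0" using u(1) by (cases "u = 0") auto
    then have "Im x = 0" "Re x < 0" using * x by auto
    then have "u * Re x < 0" using \<open>u > 0\<close> by (simp add: mult_pos_neg)
    then show False using * u by linarith
  qed
qed auto

lemma open_slit: "open (- {z::complex. Im z = 0 \<and> Re z \<ge> 0})"
  by (intro open_Compl closed_Collect_conj closed_Collect_eq closed_Collect_le continuous_intros)

text \<open>The kernel \<open>1/z + z/R^2\<close> has modulus \<open>2 |Re z| / R^2\<close> on the circle of radius \<open>R\<close>,
  which cancels the blow-up of both \<open>G - P\<close> and \<open>P\<close> at the imaginary axis.\<close>

lemma Newman_contour_estimate:
  fixes G P :: "complex \<Rightarrow> complex" and L R d M e :: real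
  assumes R: "0 < d" "d \<le> R" and "M \<ge> 0" "e \<ge> 0"
    and U: "convex U" "open U" "G holomorphic_on U" and P: "P holomorphic_on UNIV"
    and sub: "\<And>z. norm z \<le> R \<Longrightarrow> Re z \<ge> 0 \<Longrightarrow> z \<in> U"
      "\<And>z. -d \<le> Re z \<Longrightarrow> Re z \<le> 0 \<Longrightarrow> \<bar>Im z\<bar> \<le> R \<Longrightarrow> z \<in> U"
    and right: "\<And>z. norm z = R \<Longrightarrow> Re z > 0 \<Longrightarrow> norm (G z - P z) \<le> exp (- L * Re z) / Re z"
    and left: "\<And>z. norm z = R \<Longrightarrow> Re z < 0 \<Longrightarrow> norm (P z) \<le> exp (- L * Re z) * (1 / \<bar>Re z\<bar> + e)"
    and M: "\<And>z. -d \<le> Re z \<Longrightarrow> Re z \<le> 0 \<Longrightarrow> \<bar>Im z\<bar> \<le> R \<Longrightarrow> norm (G z) \<le> M"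
    and L: "L \<ge> 0"
  shows "2 * pi * norm (G 0 - P 0) \<le> 4 * pi / R + 2 * pi * e + 6 * M * d / R + 2 * R * M * (1 / d + 2 / R) * exp (- L * d)"
proof -
  \<comment> \<open>The factor \<open>exp (L * z)\<close>, in the application the power
    \<open>z\<close> of \<open>N\<close>, balances the sizes of \<open>G - P\<close> and
    \<open>P\<close>. It equals 1 at 0, as does \<open>1 + z^2 / R^2\<close>, so Cauchy's formula
    still returns \<open>G 0 - P 0\<close>.\<close>
  define K where "K z = exp (L * z) * (1 / z + z / R\<^sup>2)" for z :: complex
  \<comment> \<open>\<open>A\<close> is the right half circle. On the left \<open>G\<close> is only
    known in a thin strip, so its contour is the box of width \<open>d\<close> with sides
    \<open>b1\<close>, \<open>b2\<close>, \<open>b3\<close>; \<open>P\<close> is entire, and its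
    integral is moved from the box to the half circle \<open>C\<close>.\<close>
  define A where "A = part_circlepath 0 R (-pi/2) (pi/2)"
  define C where "C = part_circlepath 0 R (pi/2) (3*pi/2)"
  define b1 where "b1 = linepath (\<i> * R) (Complex (-d) R)"
  define b2 where "b2 = linepath (Complex (-d) R) (Complex (-d) (-R))"
  define b3 where "b3 = linepath (Complex (-d) (-R)) (- \<i> * R)"
  have R0: "R > 0" using R by simp
  have cispi: "cis (pi/2) = \<i>" "cis (-pi/2) = -\<i>" "cis (3*pi/2) = -\<i>"
  proof -
    show "cis (pi/2) = \<i>" "cis (-pi/2) = -\<i>" by (simp_all add: complex_eq_iff)
    have e: "3*pi/2 = pi/2 + pi" by simp
    show "cis (3*pi/2) = -\<i>" unfolding e cis_mult[symmetric] by simp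
  qed
  have ends: "pathstart A = - \<i> * R" "pathfinish A = \<i> * R" "pathstart C = \<i> * R" "pathfinish C = - \<i> * R"
    unfolding A_def C_def pathstart_part_circlepath pathfinish_part_circlepath cis_conv_exp[symmetric] cispi
    by simp_all
  define B where "B = b1 +++ b2 +++ b3"
  have B: "valid_path B" "pathstart B = \<i> * R" "pathfinish B = - \<i> * R" and vA: "valid_path A" "valid_path C"
    by (auto simp: B_def b1_def b2_def b3_def A_def C_def intro!: valid_path_join)
  have seg: "path_image b1 = {z. Im z = R \<and> -d \<le> Re z \<and> Re z \<le> 0}"
    "path_image b2 = {z. Re z = -d \<and> \<bar>Im z\<bar> \<le> R}"
    "path_image b3 = {z. Im z = -R \<and> -d \<le> Re z \<and> Re z \<le> 0}"
    using R0 R by (auto simp: b1_def b2_def b3_def closed_segment_same_Im closed_segment_same_Re closed_segment_eq_real_ivl)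
  have piB: "path_image B = path_image b1 \<union> path_image b2 \<union> path_image b3"
    unfolding B_def by (subst path_image_join, simp add: b1_def b2_def b3_def, subst path_image_join)
      (auto simp: b1_def b2_def b3_def)
  have piA: "norm z = R" "Re z \<ge> 0" if z: "z \<in> path_image A" for z
  proof -
    obtain t where "z = 0 + R * cis t" "t \<in> closed_segment (-pi/2) (pi/2)" using z
      unfolding A_def path_image_part_circlepath' by (elim imageE)
    then have "z = 0 + R * cis t" "-pi/2 \<le> t" "t \<le> pi/2" by (auto simp: closed_segment_eq_real_ivl)
    then show "norm z = R" "Re z \<ge> 0" using R0 by (auto simp: norm_mult intro!: mult_nonneg_nonneg cos_ge_zero)
  qed
  have piC: "norm z = R" "Re z \<le> 0" if z: "z \<in> path_image C" for z
  proof -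
    obtain t where "z = 0 + R * cis t" "t \<in> closed_segment (pi/2) (3*pi/2)" using z
      unfolding C_def path_image_part_circlepath' by (elim imageE)
    then have t: "z = 0 + R * cis t" "pi/2 \<le> t" "t \<le> 3*pi/2" by (auto simp: closed_segment_eq_real_ivl)
    have "cos t \<le> 0" using cos_ge_zero[of "t - pi"] t by (simp add: cos_diff)
    then show "norm z = R" "Re z \<le> 0" using R0 t by (auto simp: norm_mult mult_nonneg_nonpos)
  qed
  have axis: "z = \<i> * R \<or> z = - \<i> * R" if "norm z = R" "Re z = 0" for z
    using that R0 by (auto simp: cmod_def complex_eq_iff)
  have nzB: "0 \<notin> path_image B" using R0 R seg piB by auto
  have nzA: "0 \<notin> path_image A" using piA R0 by force
  have nzC: "0 \<notin> path_image C" using piC R0 by force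
  have slit: "path_image B \<subseteq> - {z. Im z = 0 \<and> Re z \<ge> 0}" "path_image C \<subseteq> - {z. Im z = 0 \<and> Re z \<ge> 0}"
  proof -
    show "path_image B \<subseteq> - {z. Im z = 0 \<and> Re z \<ge> 0}" using R0 R seg piB by auto
    show "path_image C \<subseteq> - {z. Im z = 0 \<and> Re z \<ge> 0}"
    proof (rule subsetI, rule ComplI)
      fix z assume z: "z \<in> path_image C" "z \<in> {z. Im z = 0 \<and> Re z \<ge> 0}"
      then have "Re z = 0" "Im z = 0" using piC[of z] by auto
      then have "z = 0" by (simp add: complex_eq_iff)
      then show False using z nzC by simp
    qed
  qed
  have deform: "contour_integral B f = contour_integral C f"
    if "f holomorphic_on - {z. Im z = 0 \<and> Re z \<ge> 0}" for f
  proof -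
    let ?S = "- {z::complex. Im z = 0 \<and> Re z \<ge> 0}"
    have int: "f contour_integrable_on B" "f contour_integrable_on C"
      using that slit B vA by (auto intro!: contour_integrable_holomorphic_simple[OF _ open_slit])
    have "(f has_contour_integral 0) (B +++ reversepath C)"
      using slit B vA that
      by (intro Cauchy_theorem_starlike_simple[OF open_slit starlike_slit])
        (auto simp: ends path_image_join valid_path_imp_reverse)
    moreover have "(f has_contour_integral (contour_integral B f + - contour_integral C f)) (B +++ reversepath C)"
      using int B vA by (intro has_contour_integral_join has_contour_integral_reversepath has_contour_integral_integral)
        (auto simp: valid_path_imp_reverse)
    ultimately show ?thesis using has_contour_integral_unique by fastforce
  qed
  define g where "g = A +++ B"
  have g: "valid_path g" "pathfinish g = pathstart g" "path_image g = path_image A \<union> path_image B"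
    using B vA ends by (auto simp: g_def path_image_join)
  have gU: "path_image g \<subseteq> U - {0}"
    using nzA nzB g(3) piB seg piA sub R by auto
  have zU: "0 \<in> U" using sub(1)[of 0] R0 by simp
  have inv_hol: "(\<lambda>z. 1 / z) holomorphic_on - {z. Im z = 0 \<and> Re z \<ge> 0}"
    by (intro holomorphic_intros) (auto simp: complex_eq_iff)
  \<comment> \<open>Computed as the integral of \<open>1 / z\<close> after replacing the box by the
    half circle \<open>C\<close>: each half circle contributes \<open>\<i> * pi\<close>.\<close>
  have wind: "winding_number g 0 = 1"
  proof -
    have "contour_integral g (\<lambda>z. 1 / z) = contour_integral A (\<lambda>z. 1 / z) + contour_integral B (\<lambda>z. 1 / z)"
      unfolding g_def using nzA nzB vA B
      by (intro contour_integral_join) (auto intro!: contour_integrable_holomorphic_simple[of _ "-{0}"] holomorphic_intros)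
    also have "contour_integral B (\<lambda>z. 1 / z) = contour_integral C (\<lambda>z. 1 / z)" by (rule deform[OF inv_hol])
    also have "contour_integral C (\<lambda>z. 1 / z) = \<i> * of_real (3*pi/2 - pi/2)"
      unfolding C_def by (rule contour_integral_unique, rule has_contour_integral_inverse_part_circlepath) (use R0 in auto)
    also have "contour_integral A (\<lambda>z. 1 / z) = \<i> * of_real (pi/2 - (-pi/2))"
      unfolding A_def by (rule contour_integral_unique, rule has_contour_integral_inverse_part_circlepath) (use R0 in auto)
    finally have "contour_integral g (\<lambda>z. 1 / z) = 2 * pi * \<i>" by (simp add: algebra_simps)
    moreover have "winding_number g 0 = 1 / (2 * pi * \<i>) * contour_integral g (\<lambda>w. 1 / (w - 0))"
      by (rule winding_number_valid_path) (use g gU in auto)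
    ultimately show ?thesis by simp
  qed
  have hol: "(\<lambda>z. (G z - P z) * exp (L * z) * (1 + z\<^sup>2 / R\<^sup>2)) holomorphic_on U"
    by (intro holomorphic_intros U holomorphic_on_subset[OF P]) auto
  have "((\<lambda>z. ((G z - P z) * exp (L * z) * (1 + z\<^sup>2 / R\<^sup>2)) / (z - 0)) has_contour_integral
      (2 * pi * \<i> * winding_number g 0 * ((G 0 - P 0) * exp (of_real L * 0) * (1 + 0\<^sup>2 / of_real (R\<^sup>2))))) g"
    by (rule Cauchy_integral_formula_convex_simple[OF U(1) hol _ g(1) gU g(2)])
      (use zU U(2) in \<open>auto simp: interior_open\<close>)
  then have "((\<lambda>z. ((G z - P z) * exp (L * z) * (1 + z\<^sup>2 / R\<^sup>2)) / (z - 0)) has_contour_integral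
      (2 * pi * \<i> * (G 0 - P 0))) g" by (simp add: wind)
  moreover have "((G z - P z) * exp (L * z) * (1 + z\<^sup>2 / R\<^sup>2)) / (z - 0) = (G z - P z) * K z" if "z \<in> path_image g" for z :: complex
  proof -
    have "z \<noteq> 0" using that gU by auto
    then have "(1 + z\<^sup>2 / R\<^sup>2) / (z - 0) = 1 / z + z / R\<^sup>2"
      by (simp add: add_divide_distrib power2_eq_square)
    then show ?thesis unfolding K_def by (metis mult.assoc times_divide_eq_right)
  qed
  ultimately have I: "((\<lambda>z. (G z - P z) * K z) has_contour_integral (2 * pi * \<i> * (G 0 - P 0))) g"
    by (rule has_contour_integral_eq)
  have Khol: "K holomorphic_on -{0}" unfolding K_def by (intro holomorphic_intros) (use R0 in auto)
  have opU: "open (U - {0})" using U by auto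
  have KU: "(\<lambda>z. G z * K z) holomorphic_on U - {0}"
    by (intro holomorphic_on_mult holomorphic_on_subset[OF U(3)] holomorphic_on_subset[OF Khol]) auto
  have PK: "(\<lambda>z. P z * K z) holomorphic_on -{0}"
    by (intro holomorphic_on_mult holomorphic_on_subset[OF P] Khol) auto
  have GPK: "(\<lambda>z. (G z - P z) * K z) holomorphic_on U - {0}"
    by (intro holomorphic_on_mult holomorphic_on_diff holomorphic_on_subset[OF U(3)] holomorphic_on_subset[OF P] holomorphic_on_subset[OF Khol]) auto
  have ci: "(\<lambda>z. (G z - P z) * K z) contour_integrable_on A" "(\<lambda>z. (G z - P z) * K z) contour_integrable_on B"
    "(\<lambda>z. G z * K z) contour_integrable_on B" "(\<lambda>z. P z * K z) contour_integrable_on B" "(\<lambda>z. P z * K z) contour_integrable_on C"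
    using g gU vA B nzC nzB
    by (auto intro!: contour_integrable_holomorphic_simple[OF GPK opU] contour_integrable_holomorphic_simple[OF KU opU]
       contour_integrable_holomorphic_simple[OF PK])
  have "2 * pi * \<i> * (G 0 - P 0) = contour_integral A (\<lambda>z. (G z - P z) * K z) + contour_integral B (\<lambda>z. (G z - P z) * K z)"
    using I unfolding g_def by (subst contour_integral_unique[symmetric], assumption) (use ci vA B in auto)
  also have "contour_integral B (\<lambda>z. (G z - P z) * K z) = contour_integral B (\<lambda>z. G z * K z) - contour_integral B (\<lambda>z. P z * K z)"
    unfolding left_diff_distrib by (rule contour_integral_diff[OF ci(3,4)])
  also have "contour_integral B (\<lambda>z. P z * K z) = contour_integral C (\<lambda>z. P z * K z)"
    by (rule deform, rule holomorphic_on_subset[OF PK]) auto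
  finally have eq: "2 * pi * \<i> * (G 0 - P 0) = contour_integral A (\<lambda>z. (G z - P z) * K z) + (contour_integral B (\<lambda>z. G z * K z) - contour_integral C (\<lambda>z. P z * K z))" .
  have Kc: "norm (K z) = exp (L * Re z) * (2 * \<bar>Re z\<bar> / R\<^sup>2)" if "norm z = R" for z
    unfolding K_def norm_mult Newman_kernel_circle[OF that R0] by simp
  have 1: "norm (contour_integral A (\<lambda>z. (G z - P z) * K z)) \<le> 2 / R\<^sup>2 * R * (pi/2 - (-pi/2))"
    unfolding A_def
  \<comment> \<open>The two end points are excepted because they lie on the imaginary axis, where
    \<open>right\<close> says nothing.\<close>
  proof (rule contour_integral_bound_part_circlepath_strong[where k = "{\<i> * R, - \<i> * R}"])
    fix z assume z: "z \<in> path_image (part_circlepath 0 R (-pi/2) (pi/2)) - {\<i> * R, - \<i> * R}"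
    then have z': "norm z = R" "Re z > 0" using piA[of z] axis[of z] unfolding A_def by force+
    have "norm ((G z - P z) * K z) \<le> (exp (- L * Re z) / Re z) * (exp (L * Re z) * (2 * \<bar>Re z\<bar> / R\<^sup>2))"
      unfolding norm_mult Kc[OF z'(1)] by (intro mult_right_mono right z') auto
    also have "\<dots> = 2 / R\<^sup>2" using z' by (simp add: exp_minus field_simps)
    finally show "norm ((G z - P z) * K z) \<le> 2 / R\<^sup>2" .
  qed (use ci(1) R0 in \<open>auto simp: A_def\<close>)
  have 2: "norm (contour_integral C (\<lambda>z. P z * K z)) \<le> (2 / R\<^sup>2 + 2 * e / R) * R * (3*pi/2 - pi/2)"
    unfolding C_def
  proof (rule contour_integral_bound_part_circlepath_strong[where k = "{\<i> * R, - \<i> * R}"])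
    fix z assume z: "z \<in> path_image (part_circlepath 0 R (pi/2) (3*pi/2)) - {\<i> * R, - \<i> * R}"
    then have z': "norm z = R" "Re z < 0" using piC[of z] axis[of z] unfolding C_def by force+
    have "norm (P z * K z) \<le> (exp (- L * Re z) * (1 / \<bar>Re z\<bar> + e)) * (exp (L * Re z) * (2 * \<bar>Re z\<bar> / R\<^sup>2))"
      unfolding norm_mult Kc[OF z'(1)] by (intro mult_right_mono left z') auto
    also have "\<dots> = (exp (- L * Re z) * exp (L * Re z)) * ((1 / \<bar>Re z\<bar> + e) * (2 * \<bar>Re z\<bar> / R\<^sup>2))"
      by (simp only: mult_ac)
    also have "exp (- L * Re z) * exp (L * Re z) = 1" by (simp add: mult_exp_exp)
    also have "1 * ((1 / \<bar>Re z\<bar> + e) * (2 * \<bar>Re z\<bar> / R\<^sup>2)) = 2 / R\<^sup>2 + e * (2 * \<bar>Re z\<bar> / R\<^sup>2)"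
    proof -
      have "1 / \<bar>Re z\<bar> * (2 * \<bar>Re z\<bar> / R\<^sup>2) = 2 / R\<^sup>2" using z' by simp
      then show ?thesis unfolding distrib_right by simp
    qed
    also have "\<dots> \<le> 2 / R\<^sup>2 + e * (2 * R / R\<^sup>2)"
      using abs_Re_le_cmod[of z] z' \<open>e \<ge> 0\<close> by (intro add_left_mono mult_left_mono divide_right_mono) auto
    also have "\<dots> = 2 / R\<^sup>2 + 2 * e / R" using R0 by (simp add: power2_eq_square)
    finally show "norm (P z * K z) \<le> 2 / R\<^sup>2 + 2 * e / R" .
  qed (use ci(5) R0 \<open>e \<ge> 0\<close> in \<open>auto simp: C_def\<close>)
  \<comment> \<open>On the horizontal sides \<open>R \<le> norm z \<le> 2 * R\<close>, because
    \<open>d \<le> R\<close>; this is the origin of the constant 3.\<close>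
  have horiz: "norm (G z * K z) \<le> M * (3 / R)" if z: "\<bar>Im z\<bar> = R" "-d \<le> Re z" "Re z \<le> 0" for z
  proof -
    have "norm z \<ge> R" using abs_Im_le_cmod[of z] z by simp
    have "norm z \<le> 2 * R" using cmod_le[of z] z R by simp
    have "norm z > 0" using z R by auto
    have "norm (1 / z + z / R\<^sup>2) \<le> 1 / norm z + norm z / R\<^sup>2"
      using norm_triangle_ineq[of "1 / z" "z / R\<^sup>2"] R0 by (simp add: norm_divide norm_power)
    also have "\<dots> \<le> 1 / R + 2 * R / R\<^sup>2" using \<open>norm z \<ge> R\<close> \<open>norm z \<le> 2 * R\<close> R0
      by (intro add_mono divide_left_mono divide_right_mono mult_pos_pos \<open>norm z > 0\<close>) auto
    also have "\<dots> = 3 / R" using R0 by (simp add: power2_eq_square)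
    finally have k: "norm (1 / z + z / R\<^sup>2) \<le> 3 / R" .
    have "norm (G z * K z) = norm (G z) * (exp (L * Re z) * norm (1 / z + z / R\<^sup>2))"
      by (simp add: K_def norm_mult)
    also have "\<dots> \<le> M * (1 * (3 / R))"
      using z L R0 M[of z] k by (intro mult_mono) (auto simp: mult_nonneg_nonpos \<open>M \<ge> 0\<close>)
    finally show ?thesis by simp
  qed
  have vert: "norm (G z * K z) \<le> M * (exp (- L * d) * (1 / d + 2 / R))" if z: "\<bar>Im z\<bar> \<le> R" "Re z = -d" for z
  proof -
    have "norm z \<ge> d" using abs_Re_le_cmod[of z] z R by simp
    have "norm z \<le> 2 * R" using cmod_le[of z] z R by simp
    have "norm z > 0" using z R by auto
    have "norm (1 / z + z / R\<^sup>2) \<le> 1 / norm z + norm z / R\<^sup>2"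
      using norm_triangle_ineq[of "1 / z" "z / R\<^sup>2"] R0 by (simp add: norm_divide norm_power)
    also have "\<dots> \<le> 1 / d + 2 * R / R\<^sup>2" using \<open>norm z \<ge> d\<close> \<open>norm z \<le> 2 * R\<close> R0 R
      by (intro add_mono divide_left_mono divide_right_mono mult_pos_pos \<open>norm z > 0\<close>) auto
    also have "\<dots> = 1 / d + 2 / R" using R0 by (simp add: power2_eq_square)
    finally have k: "norm (1 / z + z / R\<^sup>2) \<le> 1 / d + 2 / R" .
    have "norm (G z * K z) = norm (G z) * (exp (L * Re z) * norm (1 / z + z / R\<^sup>2))"
      by (simp add: K_def norm_mult)
    also have "\<dots> \<le> M * (exp (- L * d) * (1 / d + 2 / R))"
      using z L R0 R M[of z] k by (intro mult_mono) (auto simp: \<open>M \<ge> 0\<close>)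
    finally show ?thesis .
  qed
  have sub3: "(\<lambda>z. G z * K z) contour_integrable_on b1" "(\<lambda>z. G z * K z) contour_integrable_on b2" "(\<lambda>z. G z * K z) contour_integrable_on b3"
    using gU g(3) piB
    by (auto intro!: contour_integrable_holomorphic_simple[OF KU opU] simp: b1_def b2_def b3_def)
  have "contour_integral B (\<lambda>z. G z * K z) = contour_integral b1 (\<lambda>z. G z * K z) + (contour_integral b2 (\<lambda>z. G z * K z) + contour_integral b3 (\<lambda>z. G z * K z))"
    unfolding B_def using sub3 by (simp add: b1_def b2_def b3_def valid_path_join contour_integrable_join)
  also have "norm \<dots> \<le> M * (3 / R) * d + (M * (exp (- L * d) * (1 / d + 2 / R)) * (2 * R) + M * (3 / R) * d)"
  proof (intro norm_triangle_le add_mono)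
    have "norm (contour_integral b1 (\<lambda>z. G z * K z)) \<le> M * (3 / R) * norm (Complex (-d) R - \<i> * R)"
      unfolding b1_def by (rule contour_integral_bound_linepath)
        (use sub3 horiz seg R0 \<open>M \<ge> 0\<close> in \<open>auto simp: b1_def\<close>)
    also have "Complex (-d) R - \<i> * R = of_real (-d)" by (simp add: complex_eq_iff)
    finally show "norm (contour_integral b1 (\<lambda>z. G z * K z)) \<le> M * (3 / R) * d" using R by simp
    have "norm (contour_integral b2 (\<lambda>z. G z * K z)) \<le> M * (exp (- L * d) * (1 / d + 2 / R)) * norm (Complex (-d) (-R) - Complex (-d) R)"
      unfolding b2_def by (rule contour_integral_bound_linepath)
        (use sub3 vert seg R0 R \<open>M \<ge> 0\<close> in \<open>auto simp: b2_def\<close>)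
    also have "Complex (-d) (-R) - Complex (-d) R = \<i> * of_real (- (2 * R))" by (simp add: complex_eq_iff)
    finally show "norm (contour_integral b2 (\<lambda>z. G z * K z)) \<le> M * (exp (- L * d) * (1 / d + 2 / R)) * (2 * R)"
      using R0 by (simp add: norm_mult)
    have "norm (contour_integral b3 (\<lambda>z. G z * K z)) \<le> M * (3 / R) * norm (- \<i> * R - Complex (-d) (-R))"
      unfolding b3_def by (rule contour_integral_bound_linepath)
        (use sub3 horiz seg R0 \<open>M \<ge> 0\<close> in \<open>auto simp: b3_def\<close>)
    also have "- \<i> * R - Complex (-d) (-R) = of_real d" by (simp add: complex_eq_iff)
    finally show "norm (contour_integral b3 (\<lambda>z. G z * K z)) \<le> M * (3 / R) * d" using R by simp
  qed
  finally have 3: "norm (contour_integral B (\<lambda>z. G z * K z)) \<le> M * (3 / R) * d + (M * (exp (- L * d) * (1 / d + 2 / R)) * (2 * R) + M * (3 / R) * d)" .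
  have "2 * pi * norm (G 0 - P 0) = norm (2 * pi * \<i> * (G 0 - P 0))" by (simp add: norm_mult)
  also have "\<dots> \<le> norm (contour_integral A (\<lambda>z. (G z - P z) * K z)) + (norm (contour_integral B (\<lambda>z. G z * K z)) + norm (contour_integral C (\<lambda>z. P z * K z)))"
    unfolding eq by (intro norm_triangle_le add_left_mono norm_triangle_ineq4)
  also have "\<dots> \<le> 2 / R\<^sup>2 * R * (pi/2 - (-pi/2)) + ((M * (3 / R) * d + (M * (exp (- L * d) * (1 / d + 2 / R)) * (2 * R) + M * (3 / R) * d)) + (2 / R\<^sup>2 + 2 * e / R) * R * (3*pi/2 - pi/2))"
    by (intro add_mono 1 2 3)
  also have "\<dots> = 4 * pi / R + 2 * pi * e + 6 * M * d / R + 2 * R * M * (1 / d + 2 / R) * exp (- L * d)"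
    using R0 R(1) by (simp add: power2_eq_square field_simps)
  finally show ?thesis .
qed

text \<open>Mean value theorem for \<open>x powr y / y\<close>. It serves tails with
  \<open>y < 0\<close> and initial sums with \<open>0 < y \<le> 1\<close>. At \<open>n = 1\<close>
  the term \<open>0 powr y\<close> is 0 by convention, which gives a true inequality for
  \<open>y > 0\<close> only.\<close>

lemma powr_diff_le:
  fixes y :: real
  assumes "n \<ge> 1" "y \<noteq> 0" "y \<le> 1" "y > 0 \<or> n \<ge> 2"
  shows "real n powr (y - 1) \<le> (real n powr y - real (n - 1) powr y) / y"
proof (cases "n = 1")
  case False
  then have n: "n \<ge> 2" using assms by simp
  have "\<exists>z>real (n - 1). z < real n \<and> real n powr y / y - real (n - 1) powr y / y = (real n - real (n - 1)) * (z powr (y - 1))"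
  proof (rule MVT2)
    fix x assume "real (n - 1) \<le> x" "x \<le> real n"
    then have "x > 0" using n by auto
    then show "((\<lambda>x. x powr y / y) has_real_derivative x powr (y - 1)) (at x)"
      using assms(2) by (auto intro!: derivative_eq_intros simp: powr_diff)
  qed (use n in auto)
  then obtain z where z: "z > real (n - 1)" "z < real n"
    "real n powr y / y - real (n - 1) powr y / y = (real n - real (n - 1)) * (z powr (y - 1))" by blast
  have "real n powr (y - 1) \<le> z powr (y - 1)"
    using z n assms by (intro powr_mono2') auto
  then show ?thesis using z n by (simp add: diff_divide_distrib of_nat_diff)
qed (use assms in \<open>auto simp: field_simps\<close>)

lemma powr_diff_ge:
  fixes y :: real
  assumes "n \<ge> 1" "y \<ge> 1"
  shows "real n powr (y - 1) \<le> (real (n + 1) powr y - real n powr y) / y"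
proof -
  have "\<exists>z>real n. z < real (n + 1) \<and> real (n + 1) powr y / y - real n powr y / y = (real (n + 1) - real n) * (z powr (y - 1))"
  proof (rule MVT2)
    fix x assume "real n \<le> x"
    then have "x > 0" using assms by auto
    then show "((\<lambda>x. x powr y / y) has_real_derivative x powr (y - 1)) (at x)"
      using assms(2) by (auto intro!: derivative_eq_intros simp: powr_diff)
  qed auto
  then obtain z where z: "z > real n" "z < real (n + 1)"
    "real (n + 1) powr y / y - real n powr y / y = (real (n + 1) - real n) * (z powr (y - 1))" by blast
  have "real n powr (y - 1) \<le> z powr (y - 1)"
    using z assms by (intro powr_mono2) auto
  then show ?thesis using z by (simp add: diff_divide_distrib)
qed

text \<open>For \<open>y > 1\<close> the summands increase, so the comparison with the integral has
  to leave out the last one, which accounts for the term \<open>1 / N\<close>.\<close>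

lemma sum_powr_le:
  assumes "y > 0" "N \<ge> 1"
  shows "(\<Sum>n = 1..N. real n powr (y - 1)) \<le> real N powr y * (1 / y + 1 / N)"
proof (cases "y \<le> 1")
  case True
  have "(\<Sum>n = 1..N. real n powr (y - 1)) \<le> (\<Sum>n = 1..N. (real n powr y - real (n - 1) powr y) / y)"
    by (intro sum_mono powr_diff_le) (use assms True in auto)
  also have "\<dots> = real N powr y / y"
    unfolding sum_divide_distrib[symmetric] by (induction N) auto
  also have "\<dots> \<le> real N powr y * (1 / y + 1 / N)"
    by (simp add: distrib_left)
  finally show ?thesis .
next
  case False
  obtain M where M: "N = Suc M" using assms by (cases N) auto
  have "(\<Sum>n = 1..M. real n powr (y - 1)) \<le> (\<Sum>n = 1..M. (real (n + 1) powr y - real n powr y) / y)"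
    by (intro sum_mono powr_diff_ge) (use False in auto)
  also have "\<dots> = (real (M + 1) powr y - 1) / y"
    unfolding sum_divide_distrib[symmetric] by (induction M) auto
  also have "\<dots> \<le> real N powr y / y" using assms M by (simp add: divide_right_mono)
  finally have "(\<Sum>n = 1..N. real n powr (y - 1)) \<le> real N powr y / y + real N powr (y - 1)"
    using M by simp
  also have "\<dots> = real N powr y * (1 / y + 1 / N)" using assms by (simp add: powr_diff distrib_left)
  finally show ?thesis .
qed

lemma norm_nat_powr: "norm (of_nat n powr z :: complex) = real n powr Re z"
  using norm_powr_real_powr[of "of_nat n" z] by simp

text \<open>\<open>G\<close> is \<open>F\<close> recentred at 1 and \<open>P\<close> the
  \<open>N\<close>-th partial sum of the series. With \<open>L = ln N\<close>, comparison of sums of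
  powers with integrals yields the two half-circle bounds of the contour estimate, the excess
  \<open>e\<close> there being \<open>1 / N\<close>. The parameters are fixed in the order
  \<open>R\<close>, strip and \<open>M\<close>, \<open>d\<close>, \<open>N\<close>.\<close>

theorem Newman_tauberian:
  fixes a :: "nat \<Rightarrow> complex" and F :: "complex \<Rightarrow> complex"
  assumes a: "\<And>n. norm (a n) \<le> 1"
    and S: "open S" "{s. Re s \<ge> 1} \<subseteq> S" "F holomorphic_on S"
    and F: "\<And>s. Re s > 1 \<Longrightarrow> (\<lambda>n. a (Suc n) / of_nat (Suc n) powr s) sums F s"
  shows "(\<lambda>N. \<Sum>n = 1..N. a n / of_nat n) \<longlonglongrightarrow> F 1"
proof (rule LIMSEQ_I)
  fix r :: real assume "r > 0"
  \<comment> \<open>Makes the term \<open>4 * pi / R\<close> of the contour estimate at most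
    \<open>pi * r / 2\<close>.\<close>
  define R where "R = max 1 (8 / r)"
  have R: "R \<ge> 1" "4 / R \<le> r / 2" using \<open>r > 0\<close> by (auto simp: R_def field_simps max_def)
  define G where "G z = F (1 + z)" for z
  define K where "K = {z. 0 \<le> Re z \<and> Re z \<le> R + 1 \<and> \<bar>Im z\<bar> \<le> R + 1}"
  define S' where "S' = (\<lambda>z. 1 + z) -` S"
  have "open S'" unfolding S'_def by (intro open_vimage S continuous_intros)
  have GS: "G holomorphic_on S'" unfolding G_def S'_def
    by (rule holomorphic_on_compose_gen[OF _ S(3), unfolded o_def]) (auto intro!: holomorphic_intros)
  have K_eq: "K = cbox (Complex 0 (-R-1)) (Complex (R+1) (R+1))"
    by (auto simp: K_def in_cbox_complex_iff)
  \<comment> \<open>Holomorphy to the left of the line has no uniform width; compactness of the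
    rectangle supplies a width \<open>d0\<close> valid up to height \<open>R + 1\<close>.\<close>
  have "compact K" unfolding K_eq by (rule compact_cbox)
  moreover have "K \<subseteq> S'" using S(2) by (auto simp: K_def S'_def intro!: subsetD[OF S(2)])
  ultimately obtain d0 where d0: "d0 > 0" "(\<Union>x\<in>K. ball x d0) \<subseteq> S'"
    using compact_subset_open_imp_ball_epsilon_subset \<open>open S'\<close> by metis
  define U where "U = {z. - d0 < Re z \<and> Re z < R + 1 \<and> \<bar>Im z\<bar> < R + 1}"
  have U_eq: "U = box (Complex (-d0) (-R-1)) (Complex (R+1) (R+1))"
    by (auto simp: U_def in_box_complex_iff)
  have U: "convex U" "open U" unfolding U_eq by auto
  have "U \<subseteq> S'"
  proof
    fix z assume z: "z \<in> U"
    define w where "w = Complex (max 0 (Re z)) (Im z)"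
    have "w \<in> K" using z by (auto simp: w_def K_def U_def)
    have "norm (w - z) = \<bar>max 0 (Re z) - Re z\<bar>" by (simp add: w_def cmod_def)
    also have "\<dots> < d0" using z d0(1) by (auto simp: U_def max_def)
    finally have "z \<in> ball w d0" by (simp add: dist_norm)
    then show "z \<in> S'" using d0(2) \<open>w \<in> K\<close> by blast
  qed
  then have GU: "G holomorphic_on U" using GS holomorphic_on_subset by blast
  define Q where "Q = cbox (Complex (-d0/2) (-R)) (Complex 0 R)"
  have "Q \<subseteq> U" using d0(1) R by (auto simp: Q_def U_def in_cbox_complex_iff)
  then have "compact (G ` Q)" unfolding Q_def
    by (intro compact_continuous_image holomorphic_on_imp_continuous_on holomorphic_on_subset[OF GU]) auto
  then obtain M where M: "M > 0" "\<And>z. z \<in> Q \<Longrightarrow> norm (G z) \<le> M"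
    using compact_imp_bounded bounded_pos by (metis imageI)
  \<comment> \<open>The bound \<open>M\<close> belongs to a strip fixed beforehand, so
    \<open>d\<close> may still shrink to make \<open>6 * M * d / R\<close> at most
    \<open>3 * r / 4\<close>.\<close>
  define d where "d = min (min (d0 / 2) 1) (r / (8 * M))"
  have d: "0 < d" "d \<le> R" "d \<le> d0 / 2" "6 * M * d / R \<le> r * 3 / 4"
  proof -
    show "0 < d" "d \<le> R" "d \<le> d0 / 2" using d0 \<open>r > 0\<close> M R by (auto simp: d_def)
    have "M * d \<le> M * (r / (8 * M))" using M by (intro mult_left_mono) (auto simp: d_def)
    then have "6 * M * d \<le> r * 3 / 4" using M by simp
    moreover have "6 * M * d / R \<le> 6 * M * d / 1" using R M \<open>0 < d\<close> by (intro divide_left_mono) auto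
    ultimately show "6 * M * d / R \<le> r * 3 / 4" by simp
  qed
  have "\<forall>\<^sub>F N :: nat in sequentially. 2 * pi * (1 / N) + 2 * R * M * (1 / d + 2 / R) * exp (- ln N * d) < r / 4"
  proof -
    have "(\<lambda>N::nat. exp (- ln N * d)) \<longlonglongrightarrow> 0" "(\<lambda>N::nat. 1 / real N) \<longlonglongrightarrow> 0" using d(1) by real_asymp+
    then have "(\<lambda>N::nat. 2 * pi * (1 / N) + 2 * R * M * (1 / d + 2 / R) * exp (- ln N * d)) \<longlonglongrightarrow>
        2 * pi * 0 + 2 * R * M * (1 / d + 2 / R) * 0" by (intro tendsto_add tendsto_mult_left)
    then show ?thesis by (rule order_tendstoD) (use \<open>r > 0\<close> in simp)
  qed
  then obtain N0 :: nat where N0: "\<And>N::nat. N \<ge> N0 \<Longrightarrow> 2 * pi * (1 / N) + 2 * R * M * (1 / d + 2 / R) * exp (- ln N * d) < r / 4"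
    by (auto simp: eventually_sequentially)
  show "\<exists>no. \<forall>N\<ge>no. norm ((\<Sum>n = 1..N. a n / of_nat n) - F 1) < r"
  proof (intro exI[of _ "max N0 1"] allI impI)
    fix N assume "N \<ge> max N0 1"
    then have N: "N \<ge> 1" "N \<ge> N0" by auto
    define P where "P z = (\<Sum>n = 1..N. a n / of_nat n powr (1 + z))" for z
    have "P holomorphic_on UNIV" unfolding P_def
      by (intro holomorphic_intros) auto
    have expN: "exp (- ln N * x) = real N powr (-x)" for x using N by (simp add: powr_def mult.commute)
    have right: "norm (G z - P z) \<le> exp (- ln N * Re z) / Re z" if "Re z > 0" for z
    proof -
      have sums: "(\<lambda>n. a (Suc n) / of_nat (Suc n) powr (1 + z)) sums G z" unfolding G_def by (rule F) (use that in auto)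
      have "(\<lambda>n. a (Suc (n + N)) / of_nat (Suc (n + N)) powr (1 + z)) sums (G z - P z)"
      proof -
        have "P z = (\<Sum>n<N. a (Suc n) / of_nat (Suc n) powr (1 + z))"
          unfolding P_def by (rule sum.reindex_bij_witness[of _ Suc "\<lambda>n. n - 1"]) auto
        then show ?thesis using sums_split_initial_segment[OF sums, of N] by simp
      qed
      moreover have tel: "(\<lambda>n. (real (n + N) powr (- Re z) - real (Suc (n + N)) powr (- Re z)) / Re z) sums (real N powr (- Re z) / Re z)"
      proof -
        have "(\<lambda>n. real (n + N) powr (- Re z)) \<longlonglongrightarrow> 0" using that by real_asymp
        then have "(\<lambda>n. real (n + N) powr (- Re z) - real (Suc n + N) powr (- Re z)) sums (real (0 + N) powr (- Re z) - 0)"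
          by (rule telescope_sums')
        from sums_divide[OF this, of "Re z"] show ?thesis by simp
      qed
      moreover have "norm (a (Suc (n + N)) / of_nat (Suc (n + N)) powr (1 + z)) \<le> (real (n + N) powr (- Re z) - real (Suc (n + N)) powr (- Re z)) / Re z" for n
      proof -
        have "norm (a (Suc (n + N)) / of_nat (Suc (n + N)) powr (1 + z)) \<le> 1 / real (Suc (n + N)) powr (1 + Re z)"
          unfolding norm_divide norm_nat_powr by (simp add: divide_right_mono a)
        also have "\<dots> = real (Suc (n + N)) powr - (1 + Re z)" by (simp only: powr_minus_divide)
        also have "- (1 + Re z) = - Re z - 1" by simp
        also have "real (Suc (n + N)) powr (- Re z - 1) \<le> (real (Suc (n + N)) powr (- Re z) - real (Suc (n + N) - 1) powr (- Re z)) / (- Re z)"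
          by (rule powr_diff_le) (use that N in auto)
        finally show ?thesis by (simp add: minus_divide_left[symmetric] minus_divide_right diff_divide_distrib)
      qed
      ultimately have "norm (G z - P z) \<le> real N powr (- Re z) / Re z"
        by (rule norm_sums_le)
      then show ?thesis by (simp only: expN)
    qed
    have left: "norm (P z) \<le> exp (- ln N * Re z) * (1 / \<bar>Re z\<bar> + 1 / N)" if "Re z < 0" for z
    proof -
      have "norm (P z) \<le> (\<Sum>n = 1..N. real n powr (- Re z - 1))"
        unfolding P_def
      proof (rule sum_norm_le)
        fix n
        have "norm (a n / of_nat n powr (1 + z)) \<le> 1 / real n powr (1 + Re z)"
          unfolding norm_divide norm_nat_powr by (simp add: divide_right_mono a)
        also have "\<dots> = real n powr - (1 + Re z)" by (simp only: powr_minus_divide)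
        also have "- (1 + Re z) = - Re z - 1" by simp
        finally show "norm (a n / of_nat n powr (1 + z)) \<le> real n powr (- Re z - 1)" .
      qed
      also have "\<dots> \<le> real N powr (- Re z) * (1 / (- Re z) + 1 / N)"
        by (rule sum_powr_le) (use that N in auto)
      finally show ?thesis using that by (simp only: expN abs_of_neg)
    qed
    have "2 * pi * norm (G 0 - P 0) \<le> 4 * pi / R + 2 * pi * (1 / N) + 6 * M * d / R + 2 * R * M * (1 / d + 2 / R) * exp (- ln N * d)"
    proof (rule Newman_contour_estimate[where U = U])
      show "z \<in> U" if "norm z \<le> R" "Re z \<ge> 0" for z
        using that abs_Re_le_cmod[of z] abs_Im_le_cmod[of z] d0 by (auto simp: U_def)
      show "z \<in> U" if "-d \<le> Re z" "Re z \<le> 0" "\<bar>Im z\<bar> \<le> R" for z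
        using that d d0 R by (auto simp: U_def)
      show "norm (G z) \<le> M" if "-d \<le> Re z" "Re z \<le> 0" "\<bar>Im z\<bar> \<le> R" for z
        using that d by (intro M) (auto simp: Q_def in_cbox_complex_iff)
      show "P holomorphic_on UNIV" by fact
    qed (use d M U GU right left N in auto)
    also have "\<dots> < pi * r + r"
    proof -
      have "4 * pi / R \<le> pi * (r / 2)" using R(2) mult_left_mono[of "4 / R" "r / 2" pi] by simp
      moreover have "pi * (r / 2) \<le> pi * r" using \<open>r > 0\<close> by (intro mult_left_mono) auto
      ultimately show ?thesis using N0[OF N(2)] d(4) by linarith
    qed
    also have "\<dots> \<le> 2 * pi * r"
    proof -
      have "1 * r \<le> pi * r" using \<open>r > 0\<close> pi_ge_two by (intro mult_right_mono) auto
      then show ?thesis by simp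
    qed
    finally have "norm (G 0 - P 0) < r" by simp
    moreover have "P 0 = (\<Sum>n = 1..N. a n / of_nat n)" unfolding P_def by (intro sum.cong) auto
    ultimately show "norm ((\<Sum>n = 1..N. a n / of_nat n) - F 1) < r"
      by (simp add: G_def norm_minus_commute)
  qed
qed

text \<open>Kronecker's lemma. By Abel summation the sum of \<open>a\<close> is \<open>N\<close>
  times the deviation of \<open>T N\<close> from its limit minus the sum of the earlier deviations,
  and both are \<open>o (N)\<close>.\<close>

lemma mean_zero_if_summable_divide:
  fixes a :: "nat \<Rightarrow> complex"
  assumes "(\<lambda>N. \<Sum>n = 1..N. a n / of_nat n) \<longlonglongrightarrow> l"
  shows "mean_zero a"
proof (rule mean_zeroI)
  fix e :: real assume "e > 0"
  define T where "T N = (\<Sum>n = 1..N. a n / of_nat n)" for N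
  obtain N0 where N0: "\<And>N. N \<ge> N0 \<Longrightarrow> norm (T N - l) < e / 4"
    using LIMSEQ_D[OF assms, of "e/4"] \<open>e > 0\<close> unfolding T_def by auto
  define C where "C = (\<Sum>n<N0. norm (T n - l))"
  have abel: "(\<Sum>n = 1..N. a n) = of_nat N * (T N - l) - (\<Sum>n<N. T n - l)" for N
  proof (induction N)
    case (Suc N)
    have "a (Suc N) = of_nat (Suc N) * (T (Suc N) - T N)" by (simp add: T_def del: of_nat_Suc)
    then show ?case using Suc by (simp add: algebra_simps)
  qed simp
  have "\<forall>\<^sub>F N :: nat in sequentially. C \<le> e / 2 * N" using \<open>e > 0\<close> by real_asymp
  then show "\<forall>\<^sub>F N in sequentially. norm (\<Sum>n = 1..N. a n) \<le> e * real N"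
    using eventually_ge_at_top[of N0]
  proof eventually_elim
    case (elim N)
    have "norm (\<Sum>n<N. T n - l) \<le> (\<Sum>n<N. (if n < N0 then norm (T n - l) else 0) + e / 4)"
      by (rule sum_norm_le) (use N0 \<open>e > 0\<close> in \<open>auto intro: less_imp_le simp: not_less\<close>)
    also have "\<dots> = (\<Sum>n\<in>{n\<in>{..<N}. n < N0}. norm (T n - l)) + e / 4 * N"
      by (subst sum.inter_filter) (auto simp: sum.distrib)
    also have "{n\<in>{..<N}. n < N0} = {..<N0}" using elim by auto
    finally have 1: "norm (\<Sum>n<N. T n - l) \<le> C + e / 4 * N" by (simp add: C_def)
    have "norm (of_nat N * (T N - l)) \<le> N * (e / 4)"
      unfolding norm_mult using N0[OF elim(2)] by (intro mult_mono) auto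
    then show ?case unfolding abel
      using 1 elim(1) norm_triangle_ineq4[of "of_nat N * (T N - l)" "\<Sum>n<N. T n - l"] by (simp add: mult.commute[of e])
  qed
qed

subsection \<open>Dirichlet series\<close>

lemma sum_divisors_coprime_mult:
  fixes f :: "nat \<Rightarrow> 'a :: comm_monoid_add"
  assumes "coprime a b" "a > 0" "b > 0"
  shows "(\<Sum>d | d dvd a * b. f d) = (\<Sum>x | x dvd a. \<Sum>y | y dvd b. f (x * y))"
proof -
  have "(\<Sum>x | x dvd a. \<Sum>y | y dvd b. f (x * y)) = (\<Sum>(x, y)\<in>{x. x dvd a} \<times> {y. y dvd b}. f (x * y))"
    by (rule sum.cartesian_product)
  also have "\<dots> = (\<Sum>d | d dvd a * b. f d)"
  proof -
    have inj: "inj_on (\<lambda>(x, y). x * y) ({x. x dvd a} \<times> {y. y dvd b})"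
    proof (rule inj_onI, clarify)
      fix x y x' y' assume *: "x dvd a" "y dvd b" "x' dvd a" "y' dvd b" "x * y = x' * y'"
      have cop: "coprime x y'" "coprime x' y" using assms(1) * by (auto intro: coprime_divisors)
      have "x dvd x' * y'" "x' dvd x * y" using *(5) by (metis dvd_triv_left)+
      then have "x dvd x'" "x' dvd x" using cop by (simp_all add: coprime_dvd_mult_left_iff)
      then have "x = x'" by (rule dvd_antisym)
      moreover have "x > 0" using *(1) assms(2) by (intro Nat.gr0I) auto
      ultimately show "x = x' \<and> y = y'" using *(5) by simp
    qed
    have img: "(\<lambda>(x, y). x * y) ` ({x. x dvd a} \<times> {y. y dvd b}) = {d. d dvd a * b}"
    proof (intro equalityI subsetI)
      fix d assume "d \<in> {d. d dvd a * b}"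
      then obtain x y where "d = x * y" "x dvd a" "y dvd b" using division_decomp[of d a b] by auto
      then show "d \<in> (\<lambda>(x, y). x * y) ` ({x. x dvd a} \<times> {y. y dvd b})" by auto
    qed (auto simp: mult_dvd_mono)
    show ?thesis unfolding img[symmetric] by (subst sum.reindex[OF inj]) (simp add: case_prod_unfold o_def)
  qed
  finally show ?thesis ..
qed

lemma divisors_prime_power:
  fixes p :: nat
  assumes "prime p"
  shows "{d. d dvd p ^ k} = (\<lambda>j. p ^ j) ` {..k}"
  using assms by (auto simp: divides_primepow_nat le_imp_power_dvd)

lemma sum_divisors_prime_power:
  fixes p :: nat and f :: "nat \<Rightarrow> 'a :: comm_monoid_add"
  assumes "prime p"
  shows "(\<Sum>d | d dvd p ^ k. f d) = (\<Sum>j\<le>k. f (p ^ j))"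
proof -
  have "inj_on (\<lambda>j. p ^ j) {..k}"
    using prime_gt_1_nat[OF assms] by (auto intro!: inj_onI simp: power_inject_exp)
  then show ?thesis unfolding divisors_prime_power[OF assms] by (simp add: sum.reindex)
qed

lemma prime_power_decompose:
  assumes "n > 1"
  obtains p k m :: nat where "prime p" "k > 0" "n = p ^ k * m" "coprime (p ^ k) m" "m > 0" "m < n"
proof -
  obtain p where p: "prime p" "p dvd n" using assms prime_factor_nat[of n] by auto
  define k where "k = multiplicity p n"
  have k: "k > 0" using p assms by (simp add: k_def prime_multiplicity_gt_zero_iff)
  obtain m where m: "n = p ^ k * m" "\<not> p dvd m"
    unfolding k_def by (rule multiplicity_decompose'[of n p]) (use p assms in auto)
  then have "m > 0" by (cases "m = 0") auto
  have "coprime p m" using p m prime_imp_coprime by blast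
  moreover have "p ^ k > 1" using one_less_power[OF prime_gt_1_nat[OF p(1)] k] .
  ultimately show ?thesis using that[of p k m] p k m \<open>m > 0\<close> by simp
qed

text \<open>Splitting off one full prime power factors the sum, and the factor at \<open>p\<close>
  is \<open>moebius 1 + moebius p = 0\<close>, higher powers contributing nothing.\<close>

lemma sum_moebius_divisors: "n > 0 \<Longrightarrow> (\<Sum>d | d dvd n. moebius d) = (if n = 1 then 1 else 0)"
proof (cases "n = 1")
  case False
  assume "n > 0"
  then obtain p k m where n: "prime p" "k > 0" "n = p ^ k * m" "coprime (p ^ k) m" "m > 0"
    using False prime_power_decompose[of n] by (metis One_nat_def Suc_lessI)
  have "p ^ k > 0" using n(1) prime_gt_0_nat by simp
  have "(\<Sum>d | d dvd n. moebius d) = (\<Sum>x | x dvd p ^ k. \<Sum>y | y dvd m. moebius (x * y))"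
    unfolding n(3) by (rule sum_divisors_coprime_mult) (use n \<open>p ^ k > 0\<close> in auto)
  also have "\<dots> = (\<Sum>x | x dvd p ^ k. \<Sum>y | y dvd m. moebius x * moebius y)"
    by (intro sum.cong refl moebius_mult_coprime) (rule coprime_divisors[OF _ _ n(4)], simp_all)
  also have "\<dots> = (\<Sum>x | x dvd p ^ k. moebius x) * (\<Sum>y | y dvd m. moebius y)"
    by (simp add: sum_product)
  also have "(\<Sum>x | x dvd p ^ k. moebius x) = (\<Sum>j\<le>k. moebius (p ^ j))"
    by (rule sum_divisors_prime_power[OF n(1)])
  also have "\<dots> = (\<Sum>j\<in>{0, 1}. moebius (p ^ j))"
  proof (rule sum.mono_neutral_right)
    show "\<forall>j\<in>{..k} - {0, 1}. moebius (p ^ j) = 0"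
    proof
      fix j assume "j \<in> {..k} - {0, 1}"
      then obtain i where "j = Suc (Suc i)" by (metis DiffE insertCI not0_implies_Suc One_nat_def)
      then have "moebius (p ^ j) = moebius (p * (p ^ Suc i))" by simp
      also have "\<dots> = 0" using n(1) by (intro moebius_mult_not_coprime) auto
      finally show "moebius (p ^ j) = 0" .
    qed
  qed (use n in auto)
  also have "\<dots> = 0" using n(1) by (simp add: moebius_prime)
  finally show ?thesis using False by simp
qed auto

text \<open>Absolute convergence permits regrouping the double series by the product of the indices.
  Index 0 must carry no mass: 0 has infinitely many factorisations, and the sum over the infinite
  set of its divisors is 0 by convention.\<close>

lemma dirichlet_convolution_sums:
  fixes f g :: "nat \<Rightarrow> complex"
  assumes f: "summable (\<lambda>n. norm (f n))" "f 0 = 0" and g: "summable (\<lambda>n. norm (g n))" "g 0 = 0"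
  shows "(\<lambda>n. \<Sum>d | d dvd n. f d * g (n div d)) sums (suminf f * suminf g)"
proof -
  have Sf: "(f has_sum suminf f) UNIV" "(g has_sum suminf g) UNIV"
    using f g by (auto intro!: norm_summable_imp_has_sum summable_sums summable_norm_cancel)
  have abs: "(\<lambda>n. norm (f n)) summable_on UNIV" "(\<lambda>n. norm (g n)) summable_on UNIV"
    using f g by (auto intro!: norm_summable_imp_summable_on)
  have "(\<lambda>p. norm (case p of (d, e) \<Rightarrow> f d * g e)) summable_on (UNIV \<times> UNIV)"
    by (rule summable_on_SigmaI[where g = "\<lambda>d. norm (f d) * (\<Sum>\<^sub>\<infinity>e. norm (g e))"])
      (use abs in \<open>auto simp: norm_mult intro!: has_sum_cmult_right summable_on_cmult_left has_sum_infsum\<close>)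
  then have "(\<lambda>(d, e). f d * g e) summable_on (UNIV \<times> UNIV)" by (rule abs_summable_summable)
  then have "((\<lambda>(d, e). f d * g e) has_sum (suminf f * suminf g)) (UNIV \<times> UNIV)"
    by (intro has_sum_SigmaI[where g = "\<lambda>d. f d * suminf g"])
      (auto intro!: has_sum_cmult_right has_sum_cmult_left Sf)
  also have "?this \<longleftrightarrow> ((\<lambda>(d, e). f d * g e) has_sum (suminf f * suminf g)) ({0<..} \<times> {0<..})"
    using f(2) g(2) by (intro has_sum_cong_neutral) (auto, (metis neq0_conv)+)
  also have "\<dots> \<longleftrightarrow> ((\<lambda>(n, d). f d * g (n div d)) has_sum (suminf f * suminf g)) (SIGMA n:{0<..}. {d. d dvd n})"
    by (rule has_sum_reindex_bij_witness[where j = "\<lambda>(d, e). (d * e, d)" and i = "\<lambda>(n, d). (d, n div d)"])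
      (auto elim!: dvdE)
  finally have "((\<lambda>n. \<Sum>d | d dvd n. f d * g (n div d)) has_sum (suminf f * suminf g)) {0<..}"
    by (rule has_sum_SigmaD) (auto intro!: has_sum_finite simp del: mem_Collect_eq simp: finite_divisors_nat)
  also have "?this \<longleftrightarrow> ((\<lambda>n. \<Sum>d | d dvd n. f d * g (n div d)) has_sum (suminf f * suminf g)) UNIV"
    by (intro has_sum_cong_neutral) auto
  finally show ?thesis by (rule has_sum_imp_sums)
qed

lemma of_nat_mult_powr: "of_nat (m * n) powr s = of_nat m powr s * (of_nat n powr s :: complex)"
  using powr_times_real[of "of_nat m" "of_nat n" s] by simp

lemma summable_powr_ln:
  assumes "Re s > 1"
  shows "summable (\<lambda>n. ln (real n) * real n powr (- Re s))"
proof -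
  \<comment> \<open>Half of the excess over 1 is spent on \<open>ln n \<le> n powr e / e\<close>,
    the other half keeps the series convergent.\<close>
  define e where "e = (Re s - 1) / 2"
  have e: "e > 0" using assms by (simp add: e_def)
  have "summable (\<lambda>n. 1 / e * real n powr (e - Re s))"
    by (intro summable_mult) (use e in \<open>simp add: summable_real_powr_iff e_def field_simps\<close>)
  then show ?thesis
  proof (rule summable_comparison_test[rotated], intro exI[of _ 1] allI impI)
    fix n :: nat assume n: "n \<ge> 1"
    have "e * ln n = ln (real n powr e)" using n by (simp add: ln_powr)
    also have "\<dots> \<le> real n powr e" using n by (intro order_trans[OF ln_le_minus_one]) auto
    finally have "ln (real n) \<le> 1 / e * real n powr e" using e by (simp add: field_simps)
    then have "ln (real n) * real n powr (- Re s) \<le> 1 / e * real n powr e * real n powr (- Re s)"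
      by (intro mult_right_mono) auto
    also have "\<dots> = 1 / e * real n powr (e - Re s)" by (simp add: powr_add[symmetric])
    finally show "norm (ln (real n) * real n powr (- Re s)) \<le> 1 / e * real n powr (e - Re s)"
      using n by simp
  qed
qed

text \<open>At \<open>n = 0\<close> the quotient has denominator \<open>0 powr s = 0\<close> and is
  therefore 0, so the series can be summed over all natural numbers.\<close>

definition dterm :: "(nat \<Rightarrow> complex) \<Rightarrow> complex \<Rightarrow> nat \<Rightarrow> complex" where
  "dterm a s n = a n / of_nat n powr s"

lemma dterm_0 [simp]: "dterm a s 0 = 0"
  by (simp add: dterm_def)

lemma norm_dterm: "norm (dterm a s n) = norm (a n) * real n powr (- Re s)"
  by (simp add: dterm_def norm_divide norm_nat_powr powr_minus_divide)

lemma dterm_mult: "d dvd n \<Longrightarrow> dterm a s d * dterm b s (n div d) = a d * b (n div d) / of_nat n powr s"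
  by (elim dvdE) (auto simp: dterm_def of_nat_mult_powr simp del: of_nat_mult)

lemma summable_dterm:
  assumes "\<And>n. norm (a n) \<le> C" "Re s > 1"
  shows "summable (\<lambda>n. norm (dterm a s n))"
proof (rule summable_comparison_test[of _ "\<lambda>n. C * real n powr (- Re s)"], intro exI allI impI)
  show "norm (norm (dterm a s n)) \<le> C * real n powr (- Re s)" for n
    by (simp add: norm_dterm mult_right_mono assms)
  show "summable (\<lambda>n. C * real n powr (- Re s))"
    by (intro summable_mult) (use assms in \<open>simp add: summable_real_powr_iff\<close>)
qed

lemma summable_dterm_ln:
  assumes "\<And>n. n > 0 \<Longrightarrow> norm (a n) \<le> ln (real n)" "Re s > 1"
  shows "summable (\<lambda>n. norm (dterm a s n))"
proof (rule summable_comparison_test[OF _ summable_powr_ln[OF assms(2)]], intro exI[of _ 1] allI impI)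
  show "norm (norm (dterm a s n)) \<le> ln (real n) * real n powr (- Re s)" if "n \<ge> 1" for n
    using that by (simp add: norm_dterm mult_right_mono assms)
qed

lemma dterm_convolution_sums:
  assumes "summable (\<lambda>n. norm (dterm a s n))" "summable (\<lambda>n. norm (dterm b s n))"
  shows "dterm (\<lambda>n. \<Sum>d | d dvd n. a d * b (n div d)) s sums (suminf (dterm a s) * suminf (dterm b s))"
proof -
  have "(\<lambda>n. \<Sum>d | d dvd n. dterm a s d * dterm b s (n div d)) sums (suminf (dterm a s) * suminf (dterm b s))"
    by (rule dirichlet_convolution_sums) (use assms in auto)
  also have "(\<lambda>n. \<Sum>d | d dvd n. dterm a s d * dterm b s (n div d)) = dterm (\<lambda>n. \<Sum>d | d dvd n. a d * b (n div d)) s"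
    by (auto simp: fun_eq_iff dterm_mult dterm_def[of "\<lambda>n. \<Sum>d | d dvd n. a d * b (n div d)"] sum_divide_distrib intro!: sum.cong)
  finally show ?thesis .
qed

text \<open>Termwise differentiation, justified by a majorant that is uniform on a disc reaching
  only half way to the line \<open>Re s = 1\<close>.\<close>

lemma suminf_dterm_has_field_derivative:
  assumes a: "\<And>n. norm (a n) \<le> C" and s: "Re s > 1"
  shows "dterm (\<lambda>n. - of_real (ln (real n)) * a n) s sums deriv (\<lambda>s. suminf (dterm a s)) s"
    and "((\<lambda>s. suminf (dterm a s)) has_field_derivative deriv (\<lambda>s. suminf (dterm a s)) s) (at s)"
proof -
  let ?S = "{s::complex. Re s > 1}"
  have C: "C \<ge> 0" using a[of 0] norm_ge_zero order_trans by blast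
  have op: "open ?S" by (simp add: open_halfspace_Re_gt)
  have der: "((\<lambda>s. dterm a s n) has_field_derivative dterm (\<lambda>n. - of_real (ln (real n)) * a n) s n) (at s)" for n s
  proof (cases "n = 0")
    case False
    have "((\<lambda>s. a n / exp (s * of_real (ln (real n)))) has_field_derivative
        - (a n * (exp (s * of_real (ln (real n))) * of_real (ln (real n)))) / (exp (s * of_real (ln (real n))))\<^sup>2) (at s)"
      by (auto intro!: derivative_eq_intros simp: power2_eq_square)
    then show ?thesis using False unfolding dterm_def powr_def
      by (simp add: power2_eq_square Ln_of_nat mult_ac)
  qed simp
  have "\<exists>g g'. \<forall>x\<in>?S. (\<lambda>n. dterm a x n) sums g x \<and> (\<lambda>n. dterm (\<lambda>n. - of_real (ln (real n)) * a n) x n) sums g' x \<and>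
      (g has_field_derivative g' x) (at x)"
  proof (rule series_and_derivative_comparison_complex[OF op der])
    fix x :: complex assume x: "x \<in> ?S"
    define d where "d = (Re x - 1) / 2"
    have d: "d > 0" using x by (simp add: d_def)
    define h where "h n = complex_of_real (C * real n powr (- (1 + d)))" for n
    have "summable (\<lambda>n. C * real n powr (- (1 + d)))"
      by (intro summable_mult) (use d in \<open>simp add: summable_real_powr_iff\<close>)
    then have 1: "summable h" unfolding h_def by (rule summable_of_real)
    have 2: "range h \<subseteq> \<real>\<^sub>\<ge>\<^sub>0" using C by (auto simp: h_def)
    have 3: "norm (dterm a y n) \<le> norm (h n)" if "y \<in> ball x d \<inter> ?S" for n y
    proof -
      have "\<bar>Re x - Re y\<bar> < d" using that abs_Re_le_cmod[of "x - y"] by (auto simp: dist_norm)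
      then have y: "Re y \<ge> 1 + d" unfolding d_def by (auto simp: field_simps abs_if split: if_splits)
      have "real n powr (- Re y) \<le> real n powr (- (1 + d))"
        by (cases "n = 0") (use y in \<open>auto intro!: powr_mono\<close>)
      then have "norm (dterm a y n) \<le> C * real n powr (- (1 + d))"
        unfolding norm_dterm by (intro mult_mono a) (use C in auto)
      then show ?thesis using C unfolding h_def norm_of_real by simp
    qed
    show "\<exists>d h. 0 < d \<and> summable h \<and> range h \<subseteq> \<real>\<^sub>\<ge>\<^sub>0 \<and> (\<forall>\<^sub>F n in sequentially. \<forall>y\<in>ball x d \<inter> ?S. norm (dterm a y n) \<le> cmod (h n))"
    proof (rule exI[of _ d], rule exI[of _ h], intro conjI)
      show "\<forall>\<^sub>F n in sequentially. \<forall>y\<in>ball x d \<inter> ?S. norm (dterm a y n) \<le> norm (h n)"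
        by (intro always_eventually allI ballI 3)
    qed (fact d 1 2)+
  qed
  then obtain g g' where g: "\<And>x. Re x > 1 \<Longrightarrow> dterm a x sums g x"
    "\<And>x. Re x > 1 \<Longrightarrow> dterm (\<lambda>n. - of_real (ln (real n)) * a n) x sums g' x"
    "\<And>x. Re x > 1 \<Longrightarrow> (g has_field_derivative g' x) (at x)" by auto
  have "((\<lambda>s. suminf (dterm a s)) has_field_derivative g' s) (at s)"
    by (rule has_field_derivative_transform_within_open[OF g(3)[OF s] op]) (use s g(1) sums_unique in auto)
  moreover from this have "deriv (\<lambda>s. suminf (dterm a s)) s = g' s" by (rule DERIV_imp_deriv)
  ultimately show "((\<lambda>s. suminf (dterm a s)) has_field_derivative deriv (\<lambda>s. suminf (dterm a s)) s) (at s)"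
    and "dterm (\<lambda>n. - of_real (ln (real n)) * a n) s sums deriv (\<lambda>s. suminf (dterm a s)) s"
    using g(2)[OF s] by simp_all
qed

section \<open>Analytic continuation to the right half-plane\<close>

abbreviation right_halfplane :: "complex set" where
  "right_halfplane \<equiv> {s. Re s > 0}"

lemma open_right_halfplane: "open right_halfplane"
  by (simp add: open_halfspace_Re_gt)

lemma connected_right_halfplane: "connected right_halfplane"
  by (intro convex_connected convex_halfspace_Re_gt)

lemma powr_neg_segment_bound:
  assumes "n \<ge> 1" "Re s > 0" "real n \<le> x" "x \<le> real n + 1"
  shows "norm (of_real x powr (-s) - of_nat n powr (-s)) \<le> norm s * real n powr (- Re s - 1)"
proof -
  let ?S = "closed_segment (of_nat n) (of_nat n + 1) :: complex set"
  have mem: "z \<in> ?S \<longleftrightarrow> Im z = 0 \<and> real n \<le> Re z \<and> Re z \<le> real n + 1" for z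
    by (subst closed_segment_same_Im) (auto simp: closed_segment_eq_real_ivl)
  have "norm (of_real x powr (-s) - of_nat n powr (-s)) \<le> norm s * real n powr (- Re s - 1) * norm (of_real x - of_nat n :: complex)"
  proof (rule field_differentiable_bound[of ?S])
    fix z assume z: "z \<in> ?S"
    then have zr: "Im z = 0" "real n \<le> Re z" by (auto simp: mem)
    then have "z \<notin> \<real>\<^sub>\<le>\<^sub>0" using assms(1) by (auto simp: complex_nonpos_Reals_iff)
    then show "((\<lambda>z. z powr (-s)) has_field_derivative - s * z powr (- s - 1)) (at z within ?S)"
      by (auto intro!: derivative_eq_intros)
    have "norm (z powr (- s - 1)) = Re z powr (- Re s - 1)"
      by (subst norm_powr_real_powr) (use zr in \<open>auto simp: complex_is_Real_iff\<close>)
    also have "\<dots> \<le> real n powr (- Re s - 1)" using zr assms by (intro powr_mono2') auto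
    finally show "norm (- s * z powr (- s - 1)) \<le> norm s * real n powr (- Re s - 1)"
      by (simp add: norm_mult mult_left_mono)
  qed (use assms in \<open>auto simp: mem\<close>)
  also have "\<dots> \<le> norm s * real n powr (- Re s - 1) * 1"
  proof (rule mult_left_mono)
    have "of_real x - of_nat n = complex_of_real (x - real n)" by simp
    then show "norm (of_real x - of_nat n :: complex) \<le> 1" using assms by (simp only: norm_of_real)
  qed simp
  finally show ?thesis by simp
qed

text \<open>\<open>zeta_reg s\<close> is the continuation of \<open>(s - 1) \<zeta>(s)\<close>: the subtracted part of each term telescopes.\<close>

definition zeta_term :: "nat \<Rightarrow> complex \<Rightarrow> complex" where
  "zeta_term n s = (s - 1) * of_nat n powr (-s) - (of_nat n powr (1 - s) - of_nat (n + 1) powr (1 - s))"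

text \<open>Two mean value estimates: \<open>zeta_term n s\<close> is the increment of
  \<open>g\<close> over \<open>[n, n + 1]\<close>, and the derivative of \<open>g\<close> is in turn
  \<open>s - 1\<close> times a difference of \<open>-s\<close>-th powers. The power of
  \<open>n\<close> gained in this way gives convergence for \<open>Re s > 0\<close>.\<close>

lemma zeta_term_bound:
  assumes "n \<ge> 1" "Re s > 0"
  shows "norm (zeta_term n s) \<le> norm (s - 1) * norm s * real n powr (- Re s - 1)"
proof -
  let ?S = "closed_segment (of_nat n) (of_nat n + 1) :: complex set"
  have mem: "z \<in> ?S \<longleftrightarrow> Im z = 0 \<and> real n \<le> Re z \<and> Re z \<le> real n + 1" for z
    by (subst closed_segment_same_Im) (auto simp: closed_segment_eq_real_ivl)
  define g where "g z = (s - 1) * of_nat n powr (-s) * z + z powr (1 - s)" for z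
  have "norm (g (of_nat n + 1) - g (of_nat n)) \<le> norm (s - 1) * norm s * real n powr (- Re s - 1) * norm (of_nat n + 1 - of_nat n :: complex)"
  proof (rule field_differentiable_bound[of ?S])
    fix z assume z: "z \<in> ?S"
    then have zr: "Im z = 0" "real n \<le> Re z" "Re z \<le> real n + 1" by (auto simp: mem)
    then have "z \<notin> \<real>\<^sub>\<le>\<^sub>0" using assms(1) by (auto simp: complex_nonpos_Reals_iff)
    then have "((\<lambda>z. g z) has_field_derivative (s - 1) * of_nat n powr (-s) + (1 - s) * z powr (1 - s - 1)) (at z within ?S)"
      unfolding g_def by (auto intro!: derivative_eq_intros)
    also have "(s - 1) * of_nat n powr (-s) + (1 - s) * z powr (1 - s - 1) = - ((s - 1) * (of_real (Re z) powr (-s) - of_nat n powr (-s)))"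
    proof -
      have "z = of_real (Re z)" using zr by (simp add: complex_eq_iff)
      moreover have "1 - s - 1 = - s" by simp
      ultimately show ?thesis by (simp add: algebra_simps)
    qed
    finally show "(g has_field_derivative - ((s - 1) * (of_real (Re z) powr (-s) - of_nat n powr (-s)))) (at z within ?S)" .
    show "norm (- ((s - 1) * (of_real (Re z) powr (-s) - of_nat n powr (-s)))) \<le> norm (s - 1) * norm s * real n powr (- Re s - 1)"
      using powr_neg_segment_bound[OF assms zr(2,3)] by (simp add: norm_mult mult_left_mono mult.assoc)
  qed (auto simp: mem)
  also have "g (of_nat n + 1) - g (of_nat n) = zeta_term n s"
    by (simp add: g_def zeta_term_def algebra_simps)
  finally show ?thesis by simp
qed

text \<open>A majorant whose constant \<open>K\<close> is continuous in \<open>s\<close> is uniform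
  on closed discs, so the Weierstrass test applies. It serves both \<open>zeta_reg\<close> and
  \<open>corr\<close>.\<close>

lemma holomorphic_suminf_right_halfplane:
  fixes f :: "nat \<Rightarrow> complex \<Rightarrow> complex"
  assumes hol: "\<And>n. f n holomorphic_on right_halfplane"
    and bnd: "\<And>n s. Re s > 0 \<Longrightarrow> norm (f n s) \<le> K s * real (Suc n) powr (- Re s - 1)"
    and K: "continuous_on UNIV K"
  shows "(\<lambda>s. \<Sum>n. f n s) holomorphic_on right_halfplane"
    and "Re s > 0 \<Longrightarrow> summable (\<lambda>n. f n s)"
proof -
  obtain g where g: "\<forall>x\<in>right_halfplane. (\<lambda>n. f n x) sums g x \<and> g field_differentiable at x"
  proof (rule series_differentiable_comparison_complex[OF open_right_halfplane])
    show "f n field_differentiable at x" if "x \<in> right_halfplane" for n x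
      using hol that open_right_halfplane holomorphic_on_imp_differentiable_at by blast
    fix x :: complex assume x: "x \<in> right_halfplane"
    define d where "d = Re x / 2"
    have d: "d > 0" using x by (simp add: d_def)
    have "compact (K ` cball x d)"
      by (intro compact_continuous_image continuous_on_subset[OF K]) auto
    then obtain M where M: "\<And>y. y \<in> cball x d \<Longrightarrow> norm (K y) \<le> M"
      using compact_imp_bounded[THEN bounded_pos[THEN iffD1]] by (metis imageI)
    have "M \<ge> 0" by (rule order_trans[OF norm_ge_zero M[of x]]) (use d in simp)
    define h where "h n = complex_of_real (M * real (Suc n) powr (- d - 1))" for n
    have "summable (\<lambda>n. real (Suc n) powr (- d - 1))"
      using d by (subst summable_Suc_iff) (simp add: summable_real_powr_iff)
    then have 1: "summable h" unfolding h_def by (intro summable_of_real summable_mult)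
    have 2: "range h \<subseteq> \<real>\<^sub>\<ge>\<^sub>0" using \<open>M \<ge> 0\<close> by (auto simp: h_def)
    have 3: "norm (f n y) \<le> norm (h n)" if "y \<in> ball x d \<inter> right_halfplane" for n y
    proof -
      have y: "y \<in> cball x d" "Re y > 0" "\<bar>Re x - Re y\<bar> < d"
        using that abs_Re_le_cmod[of "x - y"] by (auto simp: dist_norm)
      then have "Re y \<ge> d" unfolding d_def by (auto simp: abs_if field_simps split: if_splits)
      then have le: "real (Suc n) powr (- Re y - 1) \<le> real (Suc n) powr (- d - 1)" by (intro powr_mono) auto
      have "norm (f n y) \<le> K y * real (Suc n) powr (- Re y - 1)" by (rule bnd[OF y(2)])
      also have "\<dots> \<le> M * real (Suc n) powr (- d - 1)"
        using M[OF y(1)] \<open>M \<ge> 0\<close> by (intro mult_mono le) auto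
      finally show ?thesis using \<open>M \<ge> 0\<close> unfolding h_def norm_of_real by simp
    qed
    show "\<exists>d h. 0 < d \<and> summable h \<and> range h \<subseteq> \<real>\<^sub>\<ge>\<^sub>0 \<and> (\<forall>\<^sub>F n in sequentially. \<forall>y\<in>ball x d \<inter> right_halfplane. norm (f n y) \<le> cmod (h n))"
    proof (rule exI[of _ d], rule exI[of _ h], intro conjI)
      show "\<forall>\<^sub>F n in sequentially. \<forall>y\<in>ball x d \<inter> right_halfplane. norm (f n y) \<le> cmod (h n)"
        by (intro always_eventually allI ballI 3)
    qed (fact d 1 2)+
  qed auto
  then have "g holomorphic_on right_halfplane"
    by (auto simp: holomorphic_on_def intro: field_differentiable_at_within)
  also have "?this \<longleftrightarrow> (\<lambda>s. \<Sum>n. f n s) holomorphic_on right_halfplane"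
    by (intro holomorphic_cong refl) (use g sums_unique in auto)
  finally show "(\<lambda>s. \<Sum>n. f n s) holomorphic_on right_halfplane" .
  show "Re s > 0 \<Longrightarrow> summable (\<lambda>n. f n s)" using g sums_summable by auto
qed

definition zeta_reg :: "complex \<Rightarrow> complex" where
  "zeta_reg s = 1 + (\<Sum>n. zeta_term (Suc n) s)"

lemma zeta_reg_holomorphic: "zeta_reg holomorphic_on right_halfplane"
  and summable_zeta_term: "Re s > 0 \<Longrightarrow> summable (\<lambda>n. zeta_term (Suc n) s)"
proof -
  have *: "zeta_term (Suc n) holomorphic_on right_halfplane" for n
    unfolding zeta_term_def by (intro holomorphic_intros)
  note ** = holomorphic_suminf_right_halfplane[of "\<lambda>n. zeta_term (Suc n)" "\<lambda>s. norm (s - 1) * norm s"]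
  show "zeta_reg holomorphic_on right_halfplane"
    unfolding zeta_reg_def by (intro holomorphic_on_add holomorphic_on_const **(1) * zeta_term_bound continuous_intros) simp_all
  show "Re s > 0 \<Longrightarrow> summable (\<lambda>n. zeta_term (Suc n) s)"
    by (rule **(2)) (auto intro!: * zeta_term_bound continuous_intros simp del: of_nat_Suc)
qed

lemma zeta_reg_1 [simp]: "zeta_reg 1 = 1"
proof -
  have "zeta_term (Suc n) 1 = 0" for n by (simp add: zeta_term_def del: of_nat_Suc)
  then show ?thesis by (simp add: zeta_reg_def)
qed

lemma tendsto_nat_powr_0: "Re z < 0 \<Longrightarrow> (\<lambda>N. of_nat (Suc N) powr z :: complex) \<longlonglongrightarrow> 0"
proof (rule tendsto_norm_zero_cancel)
  assume "Re z < 0"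
  then show "(\<lambda>N. norm (of_nat (Suc N) powr z :: complex)) \<longlonglongrightarrow> 0"
    unfolding norm_nat_powr by real_asymp
qed

text \<open>For \<open>Re s > 1\<close> the subtracted differences telescope to 1, which explains
  the constant in \<open>zeta_reg\<close>.\<close>

lemma zeta_reg_eq:
  assumes "Re s > 1"
  shows "zeta_reg s = (s - 1) * suminf (dterm (\<lambda>_. 1) s)"
proof -
  have sm: "summable (dterm (\<lambda>_. 1) s)" 
    by (rule summable_norm_cancel[OF summable_dterm[of _ 1]]) (use assms in auto)
  have A: "(\<lambda>N. \<Sum>n<N. zeta_term (Suc n) s) \<longlonglongrightarrow> zeta_reg s - 1"
    using summable_LIMSEQ[OF summable_zeta_term[of s]] assms by (simp add: zeta_reg_def)
  have B: "(\<Sum>n<N. zeta_term (Suc n) s) = (s - 1) * (\<Sum>n<Suc N. dterm (\<lambda>_. 1) s n) - (1 - of_nat (Suc N) powr (1 - s))" for N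
    by (induction N) (simp_all add: zeta_term_def dterm_def powr_minus_divide algebra_simps)
  have "(\<lambda>N. (s - 1) * (\<Sum>n<Suc N. dterm (\<lambda>_. 1) s n) - (1 - of_nat (Suc N) powr (1 - s))) \<longlonglongrightarrow>
      (s - 1) * suminf (dterm (\<lambda>_. 1) s) - (1 - 0)"
    by (intro tendsto_intros tendsto_nat_powr_0 filterlim_compose[OF summable_LIMSEQ[OF sm] filterlim_Suc]) (use assms in auto)
  with A[unfolded B] have "zeta_reg s - 1 = (s - 1) * suminf (dterm (\<lambda>_. 1) s) - (1 - 0)"
    by (rule LIMSEQ_unique)
  then show ?thesis by simp
qed

subsection \<open>Dirichlet characters\<close>

locale periodic_seq =
  fixes q :: nat and f :: "nat \<Rightarrow> complex"
  assumes q: "q > 0" and periodic: "f (n + q) = f n"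
begin

definition mean :: complex where "mean = (\<Sum>r<q. f r) / of_nat q"

text \<open>Removal of the mean makes these partial sums periodic, hence bounded; their boundedness
  carries the continuation beyond \<open>Re s = 1\<close>.\<close>

definition discr :: "nat \<Rightarrow> complex" where "discr n = (\<Sum>k = 1..n. f k) - of_nat n * mean"

lemma discr_0 [simp]: "discr 0 = 0"
  by (simp add: discr_def)

lemma discr_Suc: "discr (Suc n) = discr n + (f (Suc n) - mean)"
  by (simp add: discr_def algebra_simps)

lemma sum_period: "(\<Sum>k = 1..n + q. f k) = (\<Sum>k = 1..n. f k) + (\<Sum>r<q. f r)"
proof (induction n)
  case 0
  have "(\<Sum>k = 1..q. f k) = (\<Sum>r<q. f (Suc r))"
    by (rule sum.reindex_bij_witness[of _ Suc "\<lambda>n. n - 1"]) auto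
  also have "\<dots> + f 0 = (\<Sum>r<q. f r) + f q"
    by (subst sum.lessThan_Suc[symmetric], subst sum.lessThan_Suc_shift) simp
  finally show ?case using periodic[of 0] by simp
next
  case (Suc n)
  then show ?case using periodic[of "Suc n"] by simp
qed

lemma discr_periodic: "discr (n + q) = discr n"
proof -
  have "of_nat q * mean = (\<Sum>r<q. f r)" using q by (simp add: mean_def)
  then show ?thesis unfolding discr_def sum_period by (simp add: distrib_right)
qed

lemma discr_mod: "discr n = discr (n mod q)"
proof -
  have "discr (r + k * q) = discr r" for r k
    by (induction k) (simp_all add: discr_periodic add.assoc[symmetric] add.commute[of q])
  from this[of "n mod q" "n div q"] show ?thesis by simp
qed

lemma discr_bounded: "norm (discr n) \<le> (\<Sum>r<q. norm (discr r))"
  unfolding discr_mod[of n] by (rule member_le_sum) (use q in auto)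

text \<open>Abel summation against the bounded sums \<open>discr\<close>; \<open>cont\<close> below continues the Dirichlet series
  of \<open>f\<close> (its value at the pole 1 is junk when \<open>mean \<noteq> 0\<close>).\<close>

definition corr_term :: "nat \<Rightarrow> complex \<Rightarrow> complex" where
  "corr_term n s = discr n * (of_nat n powr (-s) - of_nat (n + 1) powr (-s))"

definition corr :: "complex \<Rightarrow> complex" where
  "corr s = (\<Sum>n. corr_term (Suc n) s)"

lemma corr_term_bound:
  assumes "Re s > 0"
  shows "norm (corr_term (Suc n) s) \<le> (\<Sum>r<q. norm (discr r)) * norm s * real (Suc n) powr (- Re s - 1)"
proof -
  have "norm (of_nat (Suc n) powr (-s) - of_nat (Suc n + 1) powr (-s)) \<le> norm s * real (Suc n) powr (- Re s - 1)"
    using powr_neg_segment_bound[of "Suc n" s "real (Suc n) + 1"] assms by (subst norm_minus_commute) simp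
  then have "norm (discr (Suc n)) * norm (of_nat (Suc n) powr (-s) - of_nat (Suc n + 1) powr (-s)) \<le>
      (\<Sum>r<q. norm (discr r)) * (norm s * real (Suc n) powr (- Re s - 1))"
    by (intro mult_mono discr_bounded) (auto intro: sum_nonneg)
  then show ?thesis by (simp only: corr_term_def norm_mult mult.assoc)
qed

lemma corr_holomorphic: "corr holomorphic_on right_halfplane"
  and summable_corr_term: "Re s > 0 \<Longrightarrow> summable (\<lambda>n. corr_term (Suc n) s)"
proof -
  have *: "corr_term (Suc n) holomorphic_on right_halfplane" for n
    unfolding corr_term_def by (intro holomorphic_intros)
  note ** = holomorphic_suminf_right_halfplane[of "\<lambda>n. corr_term (Suc n)" "\<lambda>s. (\<Sum>r<q. norm (discr r)) * norm s"]
  show "corr holomorphic_on right_halfplane"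
    unfolding corr_def by (intro **(1) * corr_term_bound continuous_intros)
  show "Re s > 0 \<Longrightarrow> summable (\<lambda>n. corr_term (Suc n) s)"
    by (rule **(2)) (auto intro!: * corr_term_bound continuous_intros simp del: of_nat_Suc)
qed

definition cont :: "complex \<Rightarrow> complex" where
  "cont s = mean * zeta_reg s / (s - 1) + corr s"

lemma norm_f_le: "norm (f n) \<le> (\<Sum>r<q. norm (f r))"
proof -
  have "f (r + k * q) = f r" for r k
    by (induction k) (simp_all add: periodic add.assoc[symmetric] add.commute[of q])
  from this[of "n mod q" "n div q"] have "f n = f (n mod q)" by simp
  then show ?thesis by (simp only:) (rule member_le_sum, use q in auto)
qed

lemma cont_eq:
  assumes s: "Re s > 1"
  shows "cont s = suminf (dterm f s)"
proof -
  have sm: "summable (dterm f s)" using summable_dterm[OF norm_f_le s] by (rule summable_norm_cancel)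
  have sm1: "summable (dterm (\<lambda>_. 1) s)"
    by (rule summable_norm_cancel[OF summable_dterm[of _ 1]]) (use s in auto)
  have A: "(\<lambda>N. \<Sum>n<N. corr_term (Suc n) s) \<longlonglongrightarrow> corr s"
    unfolding corr_def by (rule summable_LIMSEQ[OF summable_corr_term]) (use s in simp)
  \<comment> \<open>Abel summation. The last product is the boundary term, which vanishes in the
    limit because \<open>discr\<close> is bounded.\<close>
  have B: "(\<Sum>n<N. corr_term (Suc n) s) = (\<Sum>n<Suc N. dterm f s n) - mean * (\<Sum>n<Suc N. dterm (\<lambda>_. 1) s n)
      - discr N * of_nat (Suc N) powr (-s)" for N
    by (induction N) (simp_all add: corr_term_def dterm_def discr_Suc powr_minus_divide algebra_simps add_divide_distrib diff_divide_distrib)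
  have "(\<lambda>N. (\<Sum>n<Suc N. dterm f s n) - mean * (\<Sum>n<Suc N. dterm (\<lambda>_. 1) s n)
      - discr N * of_nat (Suc N) powr (-s)) \<longlonglongrightarrow> suminf (dterm f s) - mean * suminf (dterm (\<lambda>_. 1) s) - 0"
  proof (intro tendsto_diff tendsto_mult_left filterlim_compose[OF summable_LIMSEQ[OF sm] filterlim_Suc]
      filterlim_compose[OF summable_LIMSEQ[OF sm1] filterlim_Suc])
    show "(\<lambda>N. discr N * of_nat (Suc N) powr (-s)) \<longlonglongrightarrow> 0"
    proof (rule Lim_null_comparison)
      show "\<forall>\<^sub>F N in sequentially. norm (discr N * of_nat (Suc N) powr (-s)) \<le> (\<Sum>r<q. norm (discr r)) * norm (of_nat (Suc N) powr (-s) :: complex)"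
        unfolding norm_mult by (intro always_eventually allI mult_right_mono discr_bounded) auto
      have "(\<lambda>N. (\<Sum>r<q. norm (discr r)) * norm (of_nat (Suc N) powr (-s) :: complex)) \<longlonglongrightarrow> (\<Sum>r<q. norm (discr r)) * norm (0::complex)"
        by (intro tendsto_mult_left tendsto_norm tendsto_nat_powr_0) (use s in simp)
      then show "(\<lambda>N. (\<Sum>r<q. norm (discr r)) * norm (of_nat (Suc N) powr (-s) :: complex)) \<longlonglongrightarrow> 0" by simp
    qed
  qed
  with A[unfolded B] have "corr s = suminf (dterm f s) - mean * suminf (dterm (\<lambda>_. 1) s) - 0"
    by (rule LIMSEQ_unique)
  moreover have "s \<noteq> 1" using s by auto
  ultimately show ?thesis by (simp add: cont_def zeta_reg_eq[OF s])
qed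

end

lemma (in periodic_seq) f_mod: "f n = f (n mod q)"
proof -
  have "f (r + k * q) = f r" for r k
    by (induction k) (simp_all add: periodic add.assoc[symmetric] add.commute[of q])
  from this[of "n mod q" "n div q"] show ?thesis by simp
qed

lemma (in periodic_seq) f_cong: "[m = n] (mod q) \<Longrightarrow> f m = f n"
  using f_mod[of m] f_mod[of n] by (simp add: cong_def)

locale dchar = periodic_seq q chi for q :: nat and chi :: "nat \<Rightarrow> complex" +
  assumes mult: "chi (m * n) = chi m * chi n" and one: "chi (Suc 0) = 1"
    and noncoprime: "\<not> coprime n q \<Longrightarrow> chi n = 0"
begin

lemma power: "chi (n ^ k) = chi n ^ k"
  by (induction k) (simp_all add: mult one)

lemma norm_coprime:
  assumes "coprime n q"
  shows "norm (chi n) = 1"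
proof -
  have "chi n ^ totient q = chi (n ^ totient q)" by (simp add: power)
  also have "\<dots> = chi 1" using euler_theorem[OF assms] by (intro f_cong)
  finally have "norm (chi n) ^ totient q = 1 ^ totient q" by (simp add: norm_power[symmetric] one)
  then show ?thesis by (rule power_eq_imp_eq_base) (use q in auto)
qed

lemma norm_cases: "norm (chi n) = 1 \<or> chi n = 0"
  using norm_coprime noncoprime by blast

lemma norm_le: "norm (chi n) \<le> 1"
  using norm_cases[of n] by auto

abbreviation Lser :: "complex \<Rightarrow> complex" where "Lser s \<equiv> suminf (dterm chi s)"

lemma moebius_sums:
  assumes "Re s > 1"
  shows "suminf (dterm (\<lambda>n. of_int (moebius n) * chi n) s) * Lser s = 1"
proof -
  have n1: "norm (of_int (moebius n) * chi n) \<le> 1" for n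
    unfolding norm_mult using norm_moebius_le[of n] norm_le[of n] by (intro mult_le_one) auto
  have "dterm (\<lambda>n. \<Sum>d | d dvd n. (of_int (moebius d) * chi d) * chi (n div d)) s sums
      (suminf (dterm (\<lambda>n. of_int (moebius n) * chi n) s) * Lser s)"
    by (rule dterm_convolution_sums[OF summable_dterm[OF n1 assms] summable_dterm[OF norm_le assms]])
  also have "dterm (\<lambda>n. \<Sum>d | d dvd n. (of_int (moebius d) * chi d) * chi (n div d)) s = (\<lambda>n. if n = 1 then 1 else 0)"
  proof
    fix n
    show "dterm (\<lambda>n. \<Sum>d | d dvd n. (of_int (moebius d) * chi d) * chi (n div d)) s n = (if n = 1 then 1 else 0)"
    proof (cases "n = 0")
      case False
      have "(\<Sum>d | d dvd n. (of_int (moebius d) * chi d) * chi (n div d)) = (\<Sum>d | d dvd n. of_int (moebius d) * chi n)"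
        using False by (intro sum.cong refl) (auto simp: mult elim!: dvdE)
      also have "\<dots> = of_int (\<Sum>d | d dvd n. moebius d) * chi n" by (simp add: sum_distrib_right)
      also have "\<dots> = (if n = 1 then 1 else 0)" using False by (simp add: sum_moebius_divisors one)
      finally show ?thesis by (simp add: dterm_def)
    qed simp
  qed
  finally have "(\<lambda>n. if n = 1 then 1 else 0) sums (suminf (dterm (\<lambda>n. of_int (moebius n) * chi n) s) * Lser s)" .
  moreover have "(\<lambda>n. if n = 1 then 1 else 0) sums (1 :: complex)" using sums_single[of 1 "\<lambda>_. 1"] by simp
  ultimately show ?thesis by (rule sums_unique2)
qed

lemma Lser_nonzero: "Re s > 1 \<Longrightarrow> Lser s \<noteq> 0"
  using moebius_sums[of s] by auto

definition mang :: "nat \<Rightarrow> complex" where "mang n = of_real (mangoldt n) * chi n"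

lemma norm_mang_le: "n > 0 \<Longrightarrow> norm (mang n) \<le> ln (real n)"
  using mangoldt_le[of n] mult_mono[OF mangoldt_le[of n] norm_le[of n]] mangoldt_nonneg[of n]
  by (simp add: mang_def norm_mult)

lemma logderiv:
  assumes s: "Re s > 1"
  shows "suminf (dterm mang s) = - deriv Lser s / Lser s"
proof -
  have "dterm (\<lambda>n. \<Sum>d | d dvd n. mang d * chi (n div d)) s sums (suminf (dterm mang s) * Lser s)"
    by (intro dterm_convolution_sums summable_dterm[OF norm_le s] summable_dterm_ln[OF norm_mang_le s])
  also have "dterm (\<lambda>n. \<Sum>d | d dvd n. mang d * chi (n div d)) s = (\<lambda>n. - dterm (\<lambda>n. - of_real (ln (real n)) * chi n) s n)"
  proof
    fix n
    show "dterm (\<lambda>n. \<Sum>d | d dvd n. mang d * chi (n div d)) s n = - dterm (\<lambda>n. - of_real (ln (real n)) * chi n) s n"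
    proof (cases "n = 0")
      case False
      have "(\<Sum>d | d dvd n. mang d * chi (n div d)) = (\<Sum>d | d dvd n. mangoldt d * chi n)"
        using False by (intro sum.cong refl) (auto simp: mult mang_def elim!: dvdE)
      also have "\<dots> = of_real (ln (real n)) * chi n"
        using False by (simp add: sum_distrib_right[symmetric] mangoldt_sum)
      finally show ?thesis by (simp add: dterm_def)
    qed simp
  qed
  finally have "(\<lambda>n. - dterm (\<lambda>n. - of_real (ln (real n)) * chi n) s n) sums (suminf (dterm mang s) * Lser s)" .
  moreover have "(\<lambda>n. - dterm (\<lambda>n. - of_real (ln (real n)) * chi n) s n) sums (- deriv Lser s)"
    by (intro sums_minus suminf_dterm_has_field_derivative[OF norm_le s])
  ultimately have "suminf (dterm mang s) * Lser s = - deriv Lser s" by (rule sums_unique2)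
  then show ?thesis using Lser_nonzero[OF s] by (simp add: field_simps)
qed

lemma logderiv_cont:
  assumes s: "Re s > 1"
  shows "suminf (dterm mang s) = - deriv cont s / cont s" "cont s \<noteq> 0"
proof -
  have "deriv cont s = deriv Lser s"
  proof (rule deriv_cong_ev[OF _ refl])
    have "\<forall>\<^sub>F x in nhds s. x \<in> {x. Re x > 1}"
      by (rule eventually_nhds_in_open) (use s in \<open>auto simp: open_halfspace_Re_gt\<close>)
    then show "\<forall>\<^sub>F x in nhds s. cont x = Lser x" by eventually_elim (simp add: cont_eq)
  qed
  then show "suminf (dterm mang s) = - deriv cont s / cont s" "cont s \<noteq> 0"
    using logderiv[OF s] Lser_nonzero[OF s] by (simp_all add: cont_eq[OF s])
qed

text \<open>Multiplication by the unit \<open>a\<close> permutes the residues, so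
  \<open>chi a\<close> times the sum over a period is that sum itself. Thus a nonzero mean, which is
  a pole at 1, singles out the principal character.\<close>

lemma mean_nonzero_imp_principal:
  assumes "mean \<noteq> 0" "coprime a q"
  shows "chi a = 1"
proof -
  have bij: "bij_betw (\<lambda>r. a * r mod q) {..<q} {..<q}"
  proof (rule bij_betw_imageI)
    show "inj_on (\<lambda>r. a * r mod q) {..<q}"
    proof (rule inj_onI)
      fix r r' assume rr: "r \<in> {..<q}" "r' \<in> {..<q}" "a * r mod q = a * r' mod q"
      then have "[a * r = a * r'] (mod q)" by (simp add: cong_def)
      then have "[r = r'] (mod q)" using assms(2) by (simp add: cong_mult_lcancel_nat)
      then show "r = r'" using rr by (simp add: cong_def)
    qed
    then show "(\<lambda>r. a * r mod q) ` {..<q} = {..<q}"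
      using q by (intro endo_inj_surj) auto
  qed
  have "chi a * (\<Sum>r<q. chi r) = (\<Sum>r<q. chi (a * r mod q))"
    by (simp add: sum_distrib_left mult f_mod[of "a * _", symmetric])
  also have "\<dots> = (\<Sum>r<q. chi r)" by (rule sum.reindex_bij_betw[OF bij])
  finally show ?thesis using assms(1) by (simp add: mean_def)
qed

lemma dchar_square: "dchar q (\<lambda>n. chi n ^ 2)"
  by unfold_locales (use q in \<open>auto simp: periodic mult one noncoprime power_mult_distrib\<close>)

end

text \<open>The limit \<open>m\<close> is the order of the zero of \<open>f\<close> at
  \<open>z\<close>. It is read off the logarithmic derivative along the horizontal ray to the right
  of \<open>z\<close>, which for \<open>Re z = 1\<close> lies where Dirichlet series converge
  absolutely.\<close>

lemma holomorphic_order_limit: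
  fixes f :: "complex \<Rightarrow> complex"
  assumes f: "f holomorphic_on S" and S: "open S" "connected S" and z: "z \<in> S" and nz: "w \<in> S" "f w \<noteq> 0"
  obtains m :: nat where "m = 0 \<longleftrightarrow> f z \<noteq> 0"
    "((\<lambda>x. of_real x * (deriv f (z + of_real x) / f (z + of_real x))) \<longlongrightarrow> of_nat m) (at_right 0)"
proof (cases "f z = 0")
  case False
  have df: "deriv f holomorphic_on S" using f S(1) by (rule holomorphic_deriv)
  have "continuous (at z) f" "continuous (at z) (deriv f)"
    using f df S z holomorphic_on_imp_continuous_on continuous_on_eq_continuous_at by blast+
  then have "(f \<longlongrightarrow> f z) (at z)" "(deriv f \<longlongrightarrow> deriv f z) (at z)" by (auto simp: isCont_def)
  moreover have fl: "filterlim (\<lambda>x. z + of_real x) (at z) (at_right (0::real))"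
    unfolding filterlim_at by (auto intro!: tendsto_eq_intros eventually_at_rightI[of 0 1])
  ultimately have "((\<lambda>x. f (z + of_real x)) \<longlongrightarrow> f z) (at_right 0)" "((\<lambda>x. deriv f (z + of_real x)) \<longlongrightarrow> deriv f z) (at_right 0)"
    using filterlim_compose[OF _ fl] by blast+
  then have "((\<lambda>x. of_real x * (deriv f (z + of_real x) / f (z + of_real x))) \<longlongrightarrow> of_real 0 * (deriv f z / f z)) (at_right 0)"
    using False by (intro tendsto_intros) auto
  then show ?thesis using that[of 0] False by simp
next
  case True
  have "\<not> f constant_on S" unfolding constant_on_def using True z nz by metis
  then obtain g r n where g: "0 < n" "0 < r" "ball z r \<subseteq> S" "g holomorphic_on ball z r"
    "\<And>w. w \<in> ball z r \<Longrightarrow> f w = (w - z) ^ n * g w" "\<And>w. w \<in> ball z r \<Longrightarrow> g w \<noteq> 0"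
    using holomorphic_factor_zero_nonconstant[OF f S z True] by metis
  have dg: "deriv g holomorphic_on ball z r" using g(4) by (rule holomorphic_deriv) simp
  have "continuous (at z) g" "continuous (at z) (deriv g)"
    using g(2,4) dg holomorphic_on_imp_continuous_on continuous_on_eq_continuous_at[OF open_ball] centre_in_ball by blast+
  then have "(g \<longlongrightarrow> g z) (at z)" "(deriv g \<longlongrightarrow> deriv g z) (at z)" by (auto simp: isCont_def)
  moreover have fl: "filterlim (\<lambda>x. z + of_real x) (at z) (at_right (0::real))"
    unfolding filterlim_at by (auto intro!: tendsto_eq_intros eventually_at_rightI[of 0 1])
  ultimately have "((\<lambda>x. g (z + of_real x)) \<longlongrightarrow> g z) (at_right 0)" "((\<lambda>x. deriv g (z + of_real x)) \<longlongrightarrow> deriv g z) (at_right 0)"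
    using filterlim_compose[OF _ fl] by blast+
  moreover have "g z \<noteq> 0" using g(2,6) by simp
  ultimately have lim: "((\<lambda>x. of_nat n + of_real x * (deriv g (z + of_real x) / g (z + of_real x))) \<longlongrightarrow> of_nat n + of_real 0 * (deriv g z / g z)) (at_right 0)"
    by (intro tendsto_intros) auto
  have eq: "of_real x * (deriv f (z + of_real x) / f (z + of_real x)) = of_nat n + of_real x * (deriv g (z + of_real x) / g (z + of_real x))"
    if x: "0 < x" "x < r" for x
  proof -
    define w where "w = z + of_real x"
    have w: "w \<in> ball z r" "w - z = of_real x" using x by (auto simp: w_def dist_norm)
    have "((\<lambda>w. (w - z) ^ n * g w) has_field_derivative
        (of_nat n * (w - z) ^ (n - 1) * g w + (w - z) ^ n * deriv g w)) (at w)"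
      using holomorphic_derivI[OF g(4) open_ball w(1)] by (auto intro!: derivative_eq_intros)
    then have "(f has_field_derivative (of_nat n * (w - z) ^ (n - 1) * g w + (w - z) ^ n * deriv g w)) (at w)"
      by (rule has_field_derivative_transform_within_open[OF _ open_ball w(1)]) (simp add: g(5))
    then have d: "deriv f w = of_nat n * (w - z) ^ (n - 1) * g w + (w - z) ^ n * deriv g w" by (rule DERIV_imp_deriv)
    obtain k where k: "n = Suc k" using g(1) by (cases n) auto
    show ?thesis unfolding w_def[symmetric] d g(5)[OF w(1)] w(2)
      using x g(6)[OF w(1)] by (simp add: k field_simps)
  qed
  have "((\<lambda>x. of_real x * (deriv f (z + of_real x) / f (z + of_real x))) \<longlongrightarrow> of_nat n + of_real 0 * (deriv g z / g z)) (at_right 0)"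
    by (rule Lim_transform_eventually[OF lim]) (use eq g(2) in \<open>auto intro!: eventually_at_rightI[of 0 r]\<close>)
  then show ?thesis using that[of n] True g(1) by simp
qed

context dchar
begin

lemma cont_holomorphic: "cont holomorphic_on right_halfplane - (if mean = 0 then {} else {1})"
proof (cases "mean = 0")
  case True
  then have "cont = corr" by (auto simp: cont_def)
  then show ?thesis using True corr_holomorphic by simp
next
  case False
  have "(\<lambda>s. mean * zeta_reg s / (s - 1) + corr s) holomorphic_on right_halfplane - {1}"
    by (intro holomorphic_intros holomorphic_on_subset[OF zeta_reg_holomorphic] holomorphic_on_subset[OF corr_holomorphic]) auto
  then show ?thesis using False by (simp add: cont_def[abs_def])
qed

text \<open>Since the series of \<open>mang\<close> is \<open>-L'/L\<close>, the number
  \<open>r\<close> is minus the order of \<open>cont\<close> at \<open>z\<close>, a simple pole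
  counting as order -1.\<close>

lemma residue_limit:
  assumes z: "Re z = 1"
  obtains r :: real where "((\<lambda>x. of_real x * suminf (dterm mang (z + of_real x))) \<longlongrightarrow> of_real r) (at_right 0)"
    "z = 1 \<Longrightarrow> mean \<noteq> 0 \<Longrightarrow> r = 1" "\<not> (z = 1 \<and> mean \<noteq> 0) \<Longrightarrow> r \<le> 0"
    "\<not> (z = 1 \<and> mean \<noteq> 0) \<Longrightarrow> cont z = 0 \<Longrightarrow> r \<le> -1"
proof (cases "z = 1 \<and> mean \<noteq> 0")
  case False
  let ?S = "right_halfplane - (if mean = 0 then {} else {1})"
  have S: "open ?S" "connected ?S"
    using connected_open_delete[OF open_right_halfplane connected_right_halfplane, of 1]
      open_right_halfplane connected_right_halfplane by auto
  have zS: "z \<in> ?S" "2 \<in> ?S" "cont 2 \<noteq> 0" using False z logderiv_cont(2)[of 2] by auto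
  obtain m :: nat where m: "m = 0 \<longleftrightarrow> cont z \<noteq> 0"
    "((\<lambda>x. of_real x * (deriv cont (z + of_real x) / cont (z + of_real x))) \<longlongrightarrow> of_nat m) (at_right 0)"
    by (rule holomorphic_order_limit[OF cont_holomorphic S zS])
  have "((\<lambda>x. of_real x * suminf (dterm mang (z + of_real x))) \<longlongrightarrow> - of_nat m) (at_right 0)"
    by (rule Lim_transform_eventually[OF tendsto_minus[OF m(2)]])
      (use z in \<open>auto intro!: eventually_at_rightI[of 0 1] simp: logderiv_cont\<close>)
  then show ?thesis using that[of "- real m"] False m(1) by (cases m) auto
next
  case True
  \<comment> \<open>This is \<open>(s - 1) * cont s\<close> cleared of its denominator: holomorphic
    at 1 as well, with the nonzero value \<open>mean\<close> there.\<close>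
  define H where "H s = mean * zeta_reg s + (s - 1) * corr s" for s
  have H: "H holomorphic_on right_halfplane"
    unfolding H_def by (intro holomorphic_intros zeta_reg_holomorphic corr_holomorphic)
  have H1: "H 1 = mean" by (simp add: H_def)
  obtain m :: nat where m: "m = 0 \<longleftrightarrow> H 1 \<noteq> 0"
    "((\<lambda>x. of_real x * (deriv H (1 + of_real x) / H (1 + of_real x))) \<longlongrightarrow> of_nat m) (at_right 0)"
    by (rule holomorphic_order_limit[OF H open_right_halfplane connected_right_halfplane, of 1 1]) (use True H1 in auto)
  have "((\<lambda>x. 1 - of_real x * (deriv H (1 + of_real x) / H (1 + of_real x))) \<longlongrightarrow> 1 - of_nat m) (at_right 0)"
    by (intro tendsto_intros m(2))
  then have "((\<lambda>x. of_real x * suminf (dterm mang (z + of_real x))) \<longlongrightarrow> 1 - of_nat m) (at_right 0)"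
  proof (rule Lim_transform_eventually, intro eventually_at_rightI[of 0 1])
    fix x :: real assume x: "x \<in> {0<..<1}"
    define s where "s = z + of_real x"
    have s: "Re s > 1" "s - 1 = of_real x" "s \<noteq> 1" using True x by (auto simp: s_def)
    have Hs: "H s = (s - 1) * cont s" using s by (simp add: H_def cont_def field_simps)
    have contd: "(cont has_field_derivative deriv cont s) (at s)"
      by (rule holomorphic_derivI[OF cont_holomorphic]) (use s open_right_halfplane in auto)
    have "((\<lambda>s. (s - 1) * cont s) has_field_derivative (cont s + (s - 1) * deriv cont s)) (at s)"
      by (auto intro!: derivative_eq_intros contd)
    then have "(H has_field_derivative (cont s + (s - 1) * deriv cont s)) (at s)"
      by (rule has_field_derivative_transform_within_open[of _ _ _ "right_halfplane - {1}"])
        (use s open_right_halfplane in \<open>auto simp: H_def cont_def field_simps\<close>)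
    then have d: "deriv H s = cont s + (s - 1) * deriv cont s" by (rule DERIV_imp_deriv)
    have "of_real x * suminf (dterm mang s) = 1 - of_real x * (deriv H s / H s)"
      unfolding logderiv_cont(1)[OF s(1)] d Hs s(2) using logderiv_cont(2)[OF s(1)] x by (simp add: field_simps)
    then show "1 - of_real x * (deriv H (1 + of_real x) / H (1 + of_real x)) = of_real x * suminf (dterm mang (z + of_real x))"
      using True by (simp add: s_def)
  qed simp
  then show ?thesis using that[of "1 - real m"] True m(1) H1 by auto
qed

end

section \<open>Nonvanishing on the line Re s = 1\<close>

interpretation triv: dchar "Suc 0" "\<lambda>_. 1"
  by unfold_locales auto

text \<open>For \<open>w\<close> of modulus 1 and argument \<open>\<theta>\<close> this is \<open>3
  + 4 * cos \<theta> + cos (2 * \<theta>) = 2 * (1 + cos \<theta>)^2\<close>; the value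
  \<open>w = 0\<close> occurs for \<open>n\<close> not coprime to the modulus.\<close>

lemma three_four_one_pointwise:
  fixes w :: complex
  assumes "norm w = 1 \<or> w = 0"
  shows "Re (3 + 4 * w + w\<^sup>2) \<ge> 0"
proof (cases "w = 0")
  case False
  then have "(Re w)\<^sup>2 + (Im w)\<^sup>2 = 1" using assms by (simp add: cmod_def)
  then have "Re (3 + 4 * w + w\<^sup>2) = 2 * (1 + Re w)\<^sup>2" by (simp add: power2_eq_square algebra_simps)
  then show ?thesis by simp
qed simp

context dchar
begin

interpretation sq: dchar q "\<lambda>n. chi n ^ 2"
  by (rule dchar_square)

text \<open>For \<open>z = 1 + \<i> * t\<close> the three series are \<open>-L'/L\<close> for the
  trivial character at \<open>1 + x\<close>, for \<open>chi\<close> at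
  \<open>1 + x + \<i> * t\<close> and for its square at \<open>1 + x + 2 * \<i> * t\<close>. Their
  terms are a common nonnegative weight times 1, \<open>w\<close> and \<open>w^2\<close> when
  \<open>n\<close> is coprime to the modulus; otherwise \<open>w = 0\<close>.\<close>

lemma three_four_one:
  assumes z: "Re z = 1" and x: "x > 0"
  shows "Re (3 * suminf (dterm triv.mang (1 + of_real x)) + 4 * suminf (dterm mang (z + of_real x))
     + suminf (dterm sq.mang (2 * z - 1 + of_real x))) \<ge> 0"
proof -
  have s: "summable (dterm triv.mang (1 + of_real x))" "summable (dterm mang (z + of_real x))"
    "summable (dterm sq.mang (2 * z - 1 + of_real x))"
    using z x by (auto intro!: summable_norm_cancel[OF summable_dterm_ln] triv.norm_mang_le norm_mang_le sq.norm_mang_le)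
  have "(\<lambda>n. 3 * dterm triv.mang (1 + of_real x) n + 4 * dterm mang (z + of_real x) n + dterm sq.mang (2 * z - 1 + of_real x) n)
     sums (3 * suminf (dterm triv.mang (1 + of_real x)) + 4 * suminf (dterm mang (z + of_real x))
     + suminf (dterm sq.mang (2 * z - 1 + of_real x)))"
    by (intro sums_add sums_mult summable_sums s)
  then have A: "(\<lambda>n. Re (3 * dterm triv.mang (1 + of_real x) n + 4 * dterm mang (z + of_real x) n + dterm sq.mang (2 * z - 1 + of_real x) n))
     sums Re (3 * suminf (dterm triv.mang (1 + of_real x)) + 4 * suminf (dterm mang (z + of_real x))
     + suminf (dterm sq.mang (2 * z - 1 + of_real x)))"
    by (rule sums_Re)
  have B: "Re (3 * dterm triv.mang (1 + of_real x) n + 4 * dterm mang (z + of_real x) n + dterm sq.mang (2 * z - 1 + of_real x) n) \<ge> 0" for n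
  proof (cases "n = 0")
    case False
    define w where "w = chi n * of_nat n powr (1 - z)"
    have "norm (of_nat n powr (1 - z) :: complex) = 1" using z False by (simp add: norm_nat_powr)
    then have w: "norm w = 1 \<or> w = 0" using norm_cases[of n] by (auto simp: w_def norm_mult)
    define a where "a = mangoldt n * real n powr (- 1 - x)"
    have "a \<ge> 0" by (simp add: a_def mangoldt_nonneg)
    have P: "of_real (real n powr (- 1 - x)) = (of_nat n powr - (1 + of_real x) :: complex)"
      by (simp add: powr_of_real[symmetric])
    define A where "A = (of_nat n powr (1 - z) :: complex)"
    define E where "E = (of_nat n powr - (1 + of_real x) :: complex)"
    have D: "dterm f s n = f n * of_nat n powr (-s)" for f s
      by (simp add: dterm_def powr_minus_divide)
    have "- (z + of_real x) = (1 - z) + - (1 + of_real x)" by simp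
    then have e1: "of_nat n powr - (z + of_real x) = A * E"
      unfolding A_def E_def powr_add[symmetric] by (simp only:)
    have "- (2 * z - 1 + of_real x) = (1 - z) + (1 - z) + - (1 + of_real x)" by simp
    then have e2: "of_nat n powr - (2 * z - 1 + of_real x) = A * A * E"
      unfolding A_def E_def powr_add[symmetric] by (simp only:)
    have aE: "of_real a = mangoldt n * E" by (simp only: a_def of_real_mult P E_def of_real_mangoldt)
    have "3 * dterm triv.mang (1 + of_real x) n + 4 * dterm mang (z + of_real x) n + dterm sq.mang (2 * z - 1 + of_real x) n
       = of_real a * (3 + 4 * w + w\<^sup>2)"
      unfolding D e1 e2 aE triv.mang_def mang_def sq.mang_def of_real_mangoldt w_def A_def[symmetric] E_def[symmetric]
      by (simp add: power2_eq_square algebra_simps)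
    moreover have "Re (of_real a * v) = a * Re v" for v by simp
    ultimately have "Re (3 * dterm triv.mang (1 + of_real x) n + 4 * dterm mang (z + of_real x) n + dterm sq.mang (2 * z - 1 + of_real x) n)
       = a * Re (3 + 4 * w + w\<^sup>2)" by (simp only:)
    then show ?thesis using three_four_one_pointwise[OF w] \<open>a \<ge> 0\<close> by simp
  qed simp
  show ?thesis by (rule sums_le[OF B sums_zero A])
qed

text \<open>A zero of \<open>cont\<close> at \<open>z\<close> would give the three limits 1, at most
  -1 and at most 0, whereas \<open>3 * 1 + 4 * (-1) + 0 < 0\<close>. If \<open>z = 1\<close> and the
  square is principal, its pole adds 1 and the contradiction is lost, so that case is kept
  apart.\<close>

lemma cont_nonzero_aux:
  assumes z: "Re z = 1" "\<not> (z = 1 \<and> mean \<noteq> 0)" and "z = 1 \<Longrightarrow> sq.mean = 0"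
  shows "cont z \<noteq> 0"
proof
  assume cz: "cont z = 0"
  obtain r0 where r0: "((\<lambda>x. of_real x * suminf (dterm triv.mang (1 + of_real x))) \<longlongrightarrow> of_real r0) (at_right 0)" "r0 = 1"
    by (rule triv.residue_limit[of 1]) (auto simp: triv.mean_def)
  obtain r1 where r1: "((\<lambda>x. of_real x * suminf (dterm mang (z + of_real x))) \<longlongrightarrow> of_real r1) (at_right 0)" "r1 \<le> -1"
    using residue_limit[OF z(1)] z(2) cz by metis
  have "2 * z - 1 = 1 \<longleftrightarrow> z = 1" by (auto simp: field_simps)
  then have n2: "\<not> (2 * z - 1 = 1 \<and> sq.mean \<noteq> 0)" using assms(3) by auto
  have "Re (2 * z - 1) = 1" using z by simp
  then obtain r2 where r2: "((\<lambda>x. of_real x * suminf (dterm sq.mang (2 * z - 1 + of_real x))) \<longlongrightarrow> of_real r2) (at_right 0)" "r2 \<le> 0"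
    by (rule sq.residue_limit) (use n2 in blast)
  let ?F = "\<lambda>x. 3 * (of_real x * suminf (dterm triv.mang (1 + of_real x))) + 4 * (of_real x * suminf (dterm mang (z + of_real x)))
    + of_real x * suminf (dterm sq.mang (2 * z - 1 + of_real x))"
  have "((\<lambda>x. Re (?F x)) \<longlongrightarrow> Re (3 * of_real r0 + 4 * of_real r1 + of_real r2)) (at_right 0)"
    by (intro tendsto_intros r0 r1 r2)
  moreover have "\<forall>\<^sub>F x in at_right 0. Re (?F x) \<ge> 0"
  proof (intro eventually_at_rightI[of 0 1])
    fix x :: real assume "x \<in> {0<..<1}"
    then have x: "x > 0" by simp
    have "Re (?F x) = x * Re (3 * suminf (dterm triv.mang (1 + of_real x)) + 4 * suminf (dterm mang (z + of_real x))
     + suminf (dterm sq.mang (2 * z - 1 + of_real x)))"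
      by (simp add: algebra_simps)
    then show "Re (?F x) \<ge> 0" using three_four_one[OF z(1) x] x by simp
  qed simp
  ultimately have "Re (3 * of_real r0 + 4 * of_real r1 + of_real r2) \<ge> 0"
    by (intro tendsto_lowerbound) auto
  then show False using r0 r1 r2 by simp
qed

end

text \<open>For real characters, \<open>L (1, \<chi>) = 0\<close> would bound the Lambert series of \<open>\<chi>\<close> near \<open>t = 1\<close>, since its
  weights minus \<open>1 / (n (1 - t))\<close> are monotone; but that series dominates \<open>\<Sum> t^(k^2)\<close>.\<close>

lemma geometric_diff_ge:
  fixes t :: real
  assumes t: "0 < t" "t < 1"
  shows "real n * t ^ n * (1 - t) \<le> 1 - t ^ n"
proof -
  have "real n * t ^ n = (\<Sum>i<n. t ^ n)" by simp
  also have "\<dots> \<le> (\<Sum>i<n. t ^ i)" using t by (intro sum_mono power_decreasing) auto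
  finally have "real n * t ^ n * (1 - t) \<le> (\<Sum>i<n. t ^ i) * (1 - t)" using t by (intro mult_right_mono) auto
  also have "\<dots> = 1 - t ^ n" using t by (simp add: sum_gp_strict)
  finally show ?thesis .
qed

text \<open>Arithmetic-geometric mean for the pairs of exponents \<open>i\<close> and
  \<open>n - 1 - i\<close>.\<close>

lemma geometric_sum_square_ge:
  fixes u :: real
  assumes "u \<ge> 0" "n \<ge> 1"
  shows "real n * u ^ (n - 1) \<le> (\<Sum>i<n. (u\<^sup>2) ^ i)"
proof -
  have "2 * (\<Sum>i<n. (u\<^sup>2) ^ i) = (\<Sum>i<n. (u\<^sup>2) ^ i) + (\<Sum>i<n. (u\<^sup>2) ^ (n - Suc i))"
    by (subst sum.nat_diff_reindex) simp
  also have "\<dots> = (\<Sum>i<n. (u ^ i)\<^sup>2 + (u ^ (n - Suc i))\<^sup>2)"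
    by (simp add: sum.distrib power_mult[symmetric] mult.commute)
  also have "\<dots> \<ge> (\<Sum>i<n. 2 * u ^ (n - 1))"
  proof (rule sum_mono)
    fix i assume "i \<in> {..<n}"
    then have "u ^ (n - 1) = u ^ i * u ^ (n - Suc i)" by (simp add: power_add[symmetric])
    then show "2 * u ^ (n - 1) \<le> (u ^ i)\<^sup>2 + (u ^ (n - Suc i))\<^sup>2"
      using sum_squares_bound[of "u ^ i" "u ^ (n - Suc i)"] by simp
  qed
  finally show ?thesis by simp
qed

text \<open>After clearing denominators the claim is \<open>n * (n + 1) * t ^ n \<le> (\<Sum>i<n. t
  ^ i) * (\<Sum>i\<le>n. t ^ i)\<close>, which is two instances of the arithmetic-geometric mean
  with \<open>u = sqrt t\<close>.\<close>

lemma Lambert_weight_decreasing: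
  fixes t :: real
  assumes t: "0 < t" "t < 1" and n: "n \<ge> 1"
  shows "1 / (real (Suc n) * (1 - t)) - t ^ Suc n / (1 - t ^ Suc n) \<le> 1 / (real n * (1 - t)) - t ^ n / (1 - t ^ n)"
proof -
  define u where "u = sqrt t"
  have u: "u > 0" "u\<^sup>2 = t" "u \<le> 1" using t by (auto simp: u_def)
  have lt: "t ^ n < 1" "t ^ Suc n < 1" using t n by (auto simp: power_less_one_iff simp del: power_Suc)
  have "real n * real (Suc n) * t ^ n = (real n * u ^ n) * (real (Suc n) * u ^ n)"
    by (simp add: u(2)[symmetric] power_mult[symmetric] power2_eq_square power_mult_distrib)
  also have "\<dots> \<le> (real n * u ^ (n - 1)) * (real (Suc n) * u ^ (Suc n - 1))"
    using u by (intro mult_mono mult_left_mono power_decreasing) auto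
  also have "\<dots> \<le> (\<Sum>i<n. t ^ i) * (\<Sum>i<Suc n. t ^ i)"
    using geometric_sum_square_ge[of u n] geometric_sum_square_ge[of u "Suc n"] u n
    by (intro mult_mono) (auto intro!: sum_nonneg simp del: sum.lessThan_Suc)
  finally have "real n * real (Suc n) * t ^ n * (1 - t)\<^sup>2 \<le> (\<Sum>i<n. t ^ i) * (\<Sum>i<Suc n. t ^ i) * (1 - t)\<^sup>2"
    by (intro mult_right_mono) auto
  also have "\<dots> = (1 - t ^ n) * (1 - t ^ Suc n)"
    using t unfolding sum_gp_strict by (simp add: power2_eq_square)
  finally have key: "real n * real (Suc n) * t ^ n * (1 - t)\<^sup>2 \<le> (1 - t ^ n) * (1 - t ^ Suc n)" .
  have "t ^ n / (1 - t ^ n) - t ^ Suc n / (1 - t ^ Suc n) = t ^ n * (1 - t) / ((1 - t ^ n) * (1 - t ^ Suc n))"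
    using lt by (simp add: divide_simps) (simp add: algebra_simps)
  also have "\<dots> \<le> 1 / (real n * real (Suc n) * (1 - t))"
    using key lt t n by (simp add: divide_simps power2_eq_square mult_ac del: power_Suc of_nat_Suc)
  also have "\<dots> = 1 / (real n * (1 - t)) - 1 / (real (Suc n) * (1 - t))"
    using t n by (simp add: divide_simps)
  finally show ?thesis by simp
qed

lemma summable_Lambert:
  fixes t :: real
  assumes "0 < t" "t < 1" "\<And>n. \<bar>X n\<bar> \<le> 1"
  shows "summable (\<lambda>n. \<bar>X (Suc n) * (t ^ Suc n / (1 - t ^ Suc n))\<bar>)"
proof (rule summable_comparison_test)
  show "summable (\<lambda>n. t ^ Suc n / (1 - t))" using assms by (intro summable_divide) (simp add: summable_geometric summable_Suc_iff del: power_Suc)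
  show "\<exists>N. \<forall>n\<ge>N. norm \<bar>X (Suc n) * (t ^ Suc n / (1 - t ^ Suc n))\<bar> \<le> t ^ Suc n / (1 - t)"
  proof (intro exI allI impI)
    fix n
    have lt: "t ^ Suc n < 1" using assms by (auto simp: power_less_one_iff simp del: power_Suc)
    have "t ^ Suc n \<le> t ^ 1" using assms by (intro power_decreasing) auto
    then have "t ^ Suc n / (1 - t ^ Suc n) \<le> t ^ Suc n / (1 - t)" "t ^ Suc n / (1 - t ^ Suc n) \<ge> 0"
      using assms lt by (auto intro!: divide_left_mono divide_nonneg_nonneg mult_pos_pos simp del: power_Suc)
    moreover have "\<bar>X (Suc n)\<bar> * (t ^ Suc n / (1 - t ^ Suc n)) \<le> 1 * (t ^ Suc n / (1 - t ^ Suc n))"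
      using assms(3) calculation(2) by (intro mult_right_mono) auto
    moreover have "\<bar>X (Suc n) * (t ^ Suc n / (1 - t ^ Suc n))\<bar> = \<bar>X (Suc n)\<bar> * (t ^ Suc n / (1 - t ^ Suc n))"
      unfolding abs_mult using calculation(2) by (simp only: abs_of_nonneg)
    ultimately show "norm \<bar>X (Suc n) * (t ^ Suc n / (1 - t ^ Suc n))\<bar> \<le> t ^ Suc n / (1 - t)"
      unfolding real_norm_def abs_abs by linarith
  qed
qed

text \<open>Expanding each \<open>t ^ d / (1 - t ^ d)\<close> geometrically and collecting powers of
  \<open>t\<close> gives a power series whose coefficients are the divisor sums of \<open>X\<close>.
  Dropping all but finitely many square exponents only decreases it.\<close>

lemma Lambert_ge:
  fixes X :: "nat \<Rightarrow> real"
  assumes t: "0 < t" "t < 1" and X: "\<And>n. \<bar>X n\<bar> \<le> 1"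
    and nonneg: "\<And>n. n > 0 \<Longrightarrow> (\<Sum>d | d dvd n. X d) \<ge> 0"
    and square: "\<And>k. k > 0 \<Longrightarrow> (\<Sum>d | d dvd k\<^sup>2. X d) \<ge> 1"
  shows "(\<Sum>k = 1..K. t ^ (k\<^sup>2)) \<le> (\<Sum>n. X (Suc n) * (t ^ Suc n / (1 - t ^ Suc n)))"
proof -
  define S where "S = (\<Sum>n. X (Suc n) * (t ^ Suc n / (1 - t ^ Suc n)))"
  have lt: "t ^ d < 1" "t ^ d > 0" if "d > 0" for d using t that by (auto simp: power_less_one_iff)
  have abs: "summable (\<lambda>n. norm (X (Suc n) * (t ^ Suc n / (1 - t ^ Suc n))))"
    unfolding real_norm_def by (rule summable_Lambert[OF t X])
  have geo: "((\<lambda>e. t ^ (d * e)) has_sum (t ^ d / (1 - t ^ d))) {0<..}" if "d > 0" for d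
  proof -
    have "(\<lambda>e. (t ^ d) ^ Suc e) sums (t ^ d * (1 / (1 - t ^ d)))"
      unfolding power_Suc by (intro sums_mult geometric_sums) (use lt[OF that] in auto)
    then have "((\<lambda>e. (t ^ d) ^ Suc e) has_sum (t ^ d / (1 - t ^ d))) UNIV"
      by (intro norm_summable_imp_has_sum) (use t lt[OF that] sums_summable in \<open>auto simp: power_abs\<close>)
    also have "?this \<longleftrightarrow> ((\<lambda>e. t ^ (d * e)) has_sum (t ^ d / (1 - t ^ d))) {0<..}"
      by (rule has_sum_reindex_bij_witness[where j = Suc and i = "\<lambda>n. n - 1"]) (auto simp: power_mult[symmetric] power_add)
    finally show ?thesis .
  qed
  have out: "((\<lambda>d. X d * (t ^ d / (1 - t ^ d))) has_sum S) {0<..}"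
  proof -
    have "((\<lambda>n. X (Suc n) * (t ^ Suc n / (1 - t ^ Suc n))) has_sum S) UNIV"
      unfolding S_def by (intro norm_summable_imp_has_sum abs summable_sums summable_norm_cancel[OF abs])
    also have "?this \<longleftrightarrow> ((\<lambda>d. X d * (t ^ d / (1 - t ^ d))) has_sum S) {0<..}"
      by (rule has_sum_reindex_bij_witness[where j = Suc and i = "\<lambda>n. n - 1"]) auto
    finally show ?thesis .
  qed
  have outabs: "(\<lambda>d. \<bar>X d\<bar> * (t ^ d / (1 - t ^ d))) summable_on {0<..}"
  proof -
    have "(\<lambda>n. norm (X (Suc n) * (t ^ Suc n / (1 - t ^ Suc n)))) summable_on UNIV"
      by (intro norm_summable_imp_summable_on) (use abs in simp)
    also have "?this \<longleftrightarrow> (\<lambda>d. norm (X d * (t ^ d / (1 - t ^ d)))) summable_on {0<..}"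
      by (rule summable_on_reindex_bij_witness[where j = Suc and i = "\<lambda>n. n - 1"]) auto
    also have "\<dots> \<longleftrightarrow> ?thesis"
      by (intro summable_on_cong) (use lt in \<open>auto simp: abs_mult less_imp_le\<close>)
    finally show ?thesis .
  qed
  have "(\<lambda>p. norm (case p of (d, e) \<Rightarrow> X d * t ^ (d * e))) summable_on ({0<..} \<times> {0<..})"
  proof (rule summable_on_SigmaI[OF _ outabs])
    fix d :: nat assume "d \<in> {0<..}"
    then have "((\<lambda>e. \<bar>X d\<bar> * t ^ (d * e)) has_sum (\<bar>X d\<bar> * (t ^ d / (1 - t ^ d)))) {0<..}"
      by (intro has_sum_cmult_right geo) simp
    moreover have "(\<lambda>e. norm (case (d, e) of (d, e) \<Rightarrow> X d * t ^ (d * e))) = (\<lambda>e. \<bar>X d\<bar> * t ^ (d * e))"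
      using t by (simp add: abs_mult)
    ultimately show "((\<lambda>e. norm (case (d, e) of (d, e) \<Rightarrow> X d * t ^ (d * e))) has_sum (\<bar>X d\<bar> * (t ^ d / (1 - t ^ d)))) {0<..}"
      by (simp only:)
  qed auto
  then have "(\<lambda>(d, e). X d * t ^ (d * e)) summable_on ({0<..} \<times> {0<..})" by (rule abs_summable_summable)
  then have "((\<lambda>(d, e). X d * t ^ (d * e)) has_sum S) ({0<..} \<times> {0<..})"
  proof (intro has_sum_SigmaI[OF _ out])
    fix d :: nat assume "d \<in> {0<..}"
    then show "((\<lambda>e. case (d, e) of (d, e) \<Rightarrow> X d * t ^ (d * e)) has_sum (X d * (t ^ d / (1 - t ^ d)))) {0<..}"
      unfolding prod.case by (intro has_sum_cmult_right geo) simp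
  qed
  also have "?this \<longleftrightarrow> ((\<lambda>(n, d). X d * t ^ n) has_sum S) (SIGMA n:{0<..}. {d. d dvd n})"
    by (rule has_sum_reindex_bij_witness[where j = "\<lambda>(d, e). (d * e, d)" and i = "\<lambda>(n, d). (d, n div d)"])
      (auto elim!: dvdE)
  finally have "((\<lambda>n. \<Sum>d | d dvd n. X d * t ^ n) has_sum S) {0<..}"
    by (rule has_sum_SigmaD) (auto intro!: has_sum_finite simp del: mem_Collect_eq simp: finite_divisors_nat)
  then have G: "((\<lambda>n. (\<Sum>d | d dvd n. X d) * t ^ n) has_sum S) {0<..}" by (simp add: sum_distrib_right)
  have "(\<Sum>k = 1..K. t ^ (k\<^sup>2)) = (\<Sum>n\<in>(\<lambda>k. k\<^sup>2) ` {1..K}. t ^ n)"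
    by (subst sum.reindex) (auto simp: inj_on_def)
  also have "\<dots> \<le> (\<Sum>n\<in>(\<lambda>k. k\<^sup>2) ` {1..K}. (\<Sum>d | d dvd n. X d) * t ^ n)"
  proof (rule sum_mono)
    fix n assume "n \<in> (\<lambda>k. k\<^sup>2) ` {1..K}"
    then have "1 * t ^ n \<le> (\<Sum>d | d dvd n. X d) * t ^ n" using square t by (intro mult_right_mono) auto
    then show "t ^ n \<le> (\<Sum>d | d dvd n. X d) * t ^ n" by simp
  qed
  also have "\<dots> \<le> S"
    by (rule has_sum_mono_neutral[OF has_sum_finite G]) (use nonneg t in auto)
  finally show ?thesis by (simp add: S_def)
qed

section \<open>Real characters at s = 1\<close>

locale real_dchar = dchar +
  fixes X :: "nat \<Rightarrow> real"
  assumes X: "chi n = of_real (X n)"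
begin

lemma X_cases: "X n = 1 \<or> X n = -1 \<or> X n = 0"
  using norm_cases[of n] by (auto simp: X)

lemma abs_X_le: "\<bar>X n\<bar> \<le> 1"
  using X_cases[of n] by auto

lemma X_mult: "X (m * n) = X m * X n"
  using mult[of m n] by (simp add: X flip: of_real_mult)

lemma X_power: "X (n ^ k) = X n ^ k"
  using power[of n k] by (simp add: X flip: of_real_power)

lemma X_one: "X (Suc 0) = 1"
  using one by (simp add: X)

text \<open>The divisor sum is multiplicative, and at \<open>p ^ k\<close> it is
  \<open>k + 1\<close>, the indicator of even \<open>k\<close>, or 1, according as
  \<open>X p\<close> is 1, -1 or 0. Each of these is nonnegative, and at least 1 for even
  \<open>k\<close>.\<close>

lemma divisor_sum_nonneg: "n > 0 \<Longrightarrow> (\<Sum>d | d dvd n. X d) \<ge> 0 \<and> (is_nth_power 2 n \<longrightarrow> (\<Sum>d | d dvd n. X d) \<ge> 1)"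
proof (induction n rule: less_induct)
  case (less n)
  show ?case
  proof (cases "n = 1")
    case False
    then obtain p k m where n: "prime p" "k > 0" "n = p ^ k * m" "coprime (p ^ k) m" "m > 0" "m < n"
      using less.prems prime_power_decompose[of n] by (metis One_nat_def Suc_lessI)
    have "p ^ k > 0" using n(1) prime_gt_0_nat by simp
    define A where "A = (\<Sum>j\<le>k. X p ^ j)"
    define B where "B = (\<Sum>d | d dvd m. X d)"
    have "(\<Sum>d | d dvd n. X d) = (\<Sum>x | x dvd p ^ k. \<Sum>y | y dvd m. X (x * y))"
      unfolding n(3) by (rule sum_divisors_coprime_mult) (use n \<open>p ^ k > 0\<close> in auto)
    also have "\<dots> = (\<Sum>x | x dvd p ^ k. X x) * B"
      by (simp add: sum_product X_mult B_def)
    also have "(\<Sum>x | x dvd p ^ k. X x) = A"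
      unfolding sum_divisors_prime_power[OF n(1)] A_def by (simp add: X_power)
    finally have eq: "(\<Sum>d | d dvd n. X d) = A * B" .
    have B: "B \<ge> 0" "is_nth_power 2 m \<Longrightarrow> B \<ge> 1" using less.IH[OF n(6,5)] by (auto simp: B_def)
    have m1: "(\<Sum>j\<le>k. (-1 :: real) ^ j) = (if even k then 1 else 0)" for k by (induction k) auto
    have A: "A \<ge> 0" "even k \<Longrightarrow> A \<ge> 1"
    proof -
      consider "X p = 1" | "X p = -1" | "X p = 0" using X_cases by blast
      then have "A \<ge> 0 \<and> (even k \<longrightarrow> A \<ge> 1)"
        by cases (auto simp: A_def m1 power_0_left if_distrib cong: if_cong)
      then show "A \<ge> 0" "even k \<Longrightarrow> A \<ge> 1" by auto
    qed
    have "A * B \<ge> 1" if "is_nth_power 2 n"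
    proof -
      have "is_nth_power 2 (p ^ k)" "is_nth_power 2 m"
        using is_nth_power_mult_coprime_natD[OF n(4)] that n \<open>p ^ k > 0\<close> by auto
      then have "even k" "B \<ge> 1" using is_nth_power_prime_power_nat_iff[OF n(1)] B by auto
      then have "1 * 1 \<le> A * B" using A B by (intro mult_mono) auto
      then show ?thesis by simp
    qed
    then show ?thesis using A B eq by simp
  qed (simp add: X_one)
qed

lemma cont_1_nonzero:
  assumes m0: "mean = 0"
  shows "cont 1 \<noteq> 0"
proof
  assume "cont 1 = 0"
  then have corr0: "corr 1 = 0" using m0 by (simp add: cont_def)
  define B where "B n = Re (discr n)" for n
  define C where "C = (\<Sum>r<q. norm (discr r))"
  have C: "\<bar>B n\<bar> \<le> C" "C \<ge> 0" for n
    using abs_Re_le_cmod[of "discr n"] discr_bounded[of n] by (auto simp: B_def C_def intro: sum_nonneg)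
  have B_Suc: "B (Suc n) = B n + X (Suc n)" and B0: "B 0 = 0" for n
    by (simp_all add: B_def discr_Suc m0 X)
  \<comment> \<open>The assumed zero at 1 says that \<open>X n / n\<close> sums to 0. Hence
    subtracting \<open>1 / (n * (1 - t))\<close> from the Lambert weights does not change the value
    of the series.\<close>
  have lim0: "(\<lambda>N. \<Sum>n<N. X (Suc n) / real (Suc n)) \<longlonglongrightarrow> 0"
  proof -
    have A: "(\<lambda>N. \<Sum>n<N. corr_term (Suc n) 1) \<longlonglongrightarrow> 0"
      using summable_LIMSEQ[OF summable_corr_term[of 1]] corr0 by (simp add: corr_def)
    have E: "(\<Sum>n<N. X (Suc n) / real (Suc n)) = Re (\<Sum>n<N. corr_term (Suc n) 1) + B N / real (Suc N)" for N
    proof (induction N)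
      case (Suc N)
      have "Re (corr_term (Suc N) 1) = B (Suc N) * (1 / real (Suc N) - 1 / real (Suc (Suc N)))"
        by (simp add: corr_term_def B_def powr_minus_divide Re_divide_of_nat del: of_nat_Suc)
      then show ?case using Suc by (simp add: B_Suc algebra_simps add_divide_distrib del: of_nat_Suc)
    qed (simp add: B0)
    have "(\<lambda>N. B N / real (Suc N)) \<longlonglongrightarrow> 0"
    proof (rule Lim_null_comparison)
      show "\<forall>\<^sub>F N in sequentially. norm (B N / real (Suc N)) \<le> C / real (Suc N)"
        by (intro always_eventually allI) (simp add: C divide_right_mono)
      show "(\<lambda>N. C / real (Suc N)) \<longlonglongrightarrow> 0" by real_asymp
    qed
    from tendsto_add[OF tendsto_Re[OF A] this] show ?thesis unfolding E by simp
  qed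
  have bound: "(\<Sum>n. X (Suc n) * (t ^ Suc n / (1 - t ^ Suc n))) \<le> C" if t: "0 < t" "t < 1" for t
  proof -
    \<comment> \<open>These weights are nonnegative and decrease from \<open>b 1 = 1\<close>, so
      Abel summation against the bounded partial sums \<open>B\<close> gives the bound
      \<open>C\<close>, uniformly in \<open>t\<close>.\<close>
    define b where "b n = 1 / (real n * (1 - t)) - t ^ n / (1 - t ^ n)" for n
    have dec: "b (Suc n) \<le> b n" if "n \<ge> 1" for n unfolding b_def by (rule Lambert_weight_decreasing[OF t that])
    have b1: "b 1 = 1" using t by (simp add: b_def diff_divide_distrib[symmetric])
    have b0: "b n \<ge> 0" if "n \<ge> 1" for n
    proof -
      have "t ^ n < 1" using t that by (simp add: power_less_one_iff)
      then show ?thesis unfolding b_def using geometric_diff_ge[OF t, of n] that t by (simp add: divide_simps mult_ac)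
    qed
    have abel: "(\<Sum>n<N. X (Suc n) * b (Suc n)) = B N * b (Suc N) + (\<Sum>n<N. B (Suc n) * (b (Suc n) - b (Suc (Suc n))))" for N
      by (induction N) (simp_all add: B0 B_Suc algebra_simps)
    have babs: "\<bar>\<Sum>n<N. X (Suc n) * b (Suc n)\<bar> \<le> C" for N
    proof -
      have "\<bar>\<Sum>n<N. X (Suc n) * b (Suc n)\<bar> \<le> \<bar>B N * b (Suc N)\<bar> + (\<Sum>n<N. \<bar>B (Suc n) * (b (Suc n) - b (Suc (Suc n)))\<bar>)"
        unfolding abel by (rule order_trans[OF abs_triangle_ineq add_left_mono[OF sum_abs]])
      also have "\<dots> \<le> C * b (Suc N) + (\<Sum>n<N. C * (b (Suc n) - b (Suc (Suc n))))"
        using b0[of "Suc N"] dec by (intro add_mono sum_mono) (auto simp: abs_mult intro!: mult_mono C)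
      also have "\<dots> = C * b 1" unfolding sum_distrib_left[symmetric]
        by (induction N) (simp_all add: algebra_simps)
      finally show ?thesis unfolding b1 by simp
    qed
    have sum_eq: "(\<Sum>n<N. X (Suc n) * (t ^ Suc n / (1 - t ^ Suc n))) =
        (\<Sum>n<N. X (Suc n) / real (Suc n)) / (1 - t) - (\<Sum>n<N. X (Suc n) * b (Suc n))" for N
      unfolding sum_divide_distrib sum_subtractf[symmetric] b_def by (intro sum.cong refl) (simp add: right_diff_distrib)
    have "summable (\<lambda>n. X (Suc n) * (t ^ Suc n / (1 - t ^ Suc n)))"
      by (rule summable_rabs_cancel[OF summable_Lambert[OF t abs_X_le]])
    then have L: "(\<lambda>N. \<Sum>n<N. X (Suc n) * (t ^ Suc n / (1 - t ^ Suc n))) \<longlonglongrightarrow> (\<Sum>n. X (Suc n) * (t ^ Suc n / (1 - t ^ Suc n)))"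
      by (rule summable_LIMSEQ)
    have R: "(\<lambda>N. (\<Sum>n<N. X (Suc n) / real (Suc n)) / (1 - t) + C) \<longlonglongrightarrow> 0 / (1 - t) + C"
      by (intro tendsto_intros lim0) (use t in auto)
    have "(\<Sum>n. X (Suc n) * (t ^ Suc n / (1 - t ^ Suc n))) \<le> 0 / (1 - t) + C"
    proof (rule LIMSEQ_le[OF L R], intro exI allI impI)
      fix N
      show "(\<Sum>n<N. X (Suc n) * (t ^ Suc n / (1 - t ^ Suc n))) \<le> (\<Sum>n<N. X (Suc n) / real (Suc n)) / (1 - t) + C"
        unfolding sum_eq using babs[of N] by linarith
    qed
    then show ?thesis by simp
  qed
  \<comment> \<open>As \<open>t\<close> tends to 1, each of the \<open>K\<close> powers tends to 1,
    so their sum eventually exceeds \<open>C\<close>.\<close>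
  obtain K :: nat where K: "real K > C" using reals_Archimedean2 by blast
  have "((\<lambda>t::real. \<Sum>k = 1..K. t ^ (k\<^sup>2)) \<longlongrightarrow> (\<Sum>k = 1..K. 1 ^ (k\<^sup>2))) (at_left 1)"
    by (intro tendsto_intros)
  then have "\<forall>\<^sub>F t in at_left (1::real). (\<Sum>k = 1..K. t ^ (k\<^sup>2)) > C"
    by (rule order_tendstoD) (use K in simp)
  moreover have "\<forall>\<^sub>F t in at_left (1::real). t \<in> {0<..<1}" by (rule eventually_at_leftI[of 0]) auto
  ultimately have "\<forall>\<^sub>F t in at_left (1::real). False"
  proof eventually_elim
    case (elim t)
    then have t: "0 < t" "t < 1" by auto
    have "(\<Sum>k = 1..K. t ^ (k\<^sup>2)) \<le> (\<Sum>n. X (Suc n) * (t ^ Suc n / (1 - t ^ Suc n)))"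
    proof (rule Lambert_ge[OF t])
      show "\<bar>X n\<bar> \<le> 1" for n by (rule abs_X_le)
      show "n > 0 \<Longrightarrow> (\<Sum>d | d dvd n. X d) \<ge> 0" for n using divisor_sum_nonneg[of n] by simp
      show "k > 0 \<Longrightarrow> (\<Sum>d | d dvd k\<^sup>2. X d) \<ge> 1" for k using divisor_sum_nonneg[of "k\<^sup>2"] by (simp add: is_nth_power_def)
    qed
    then show False using elim bound[OF t] by linarith
  qed
  then show False by simp
qed

end

section \<open>Nonvanishing for all characters, and the Moebius function twisted by a
  character\<close>

context dchar
begin

text \<open>What the 3-4-1 inequality leaves open is \<open>z = 1\<close> with principal square.
  Then all values of \<open>chi\<close> are real and the Lambert series argument applies.\<close>

lemma cont_nonzero:
  assumes z: "Re z = 1" "\<not> (z = 1 \<and> mean \<noteq> 0)"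
  shows "cont z \<noteq> 0"
proof (cases "z = 1 \<and> periodic_seq.mean q (\<lambda>n. chi n ^ 2) \<noteq> 0")
  case False
  then show ?thesis using cont_nonzero_aux[OF z] by simp
next
  case True
  interpret sq: dchar q "\<lambda>n. chi n ^ 2" by (rule dchar_square)
  have "chi n = of_real (Re (chi n))" for n
  proof (cases "coprime n q")
    case True
    then have "chi n ^ 2 = 1" using sq.mean_nonzero_imp_principal \<open>z = 1 \<and> _\<close> by simp
    then show ?thesis by (auto simp: power2_eq_1_iff)
  qed (simp add: noncoprime)
  then interpret real_dchar q chi "\<lambda>n. Re (chi n)" by unfold_locales
  show ?thesis using cont_1_nonzero True z by simp
qed

theorem mean_zero_moebius: "mean_zero (\<lambda>n. of_int (moebius n) * chi n)"
proof -
  let ?a = "\<lambda>n. of_int (moebius n) * chi n"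
  define H where "H s = mean * zeta_reg s + (s - 1) * corr s" for s
  \<comment> \<open>The continuation of \<open>1 / L\<close>. If \<open>mean \<noteq> 0\<close>,
    numerator and denominator carry an extra factor \<open>s - 1\<close>, so that \<open>F\<close>
    is holomorphic at 1, with value 0.\<close>
  define F where "F s = (if mean = 0 then 1 / corr s else (s - 1) / H s)" for s
  define D where "D = (if mean = 0 then corr else H)"
  have D: "D holomorphic_on right_halfplane"
    unfolding D_def H_def by (auto intro!: holomorphic_intros zeta_reg_holomorphic corr_holomorphic)
  define S where "S = {s\<in>right_halfplane. D s \<in> - {0}}"
  have S_eq: "S = right_halfplane \<inter> D -` (- {0})" by (auto simp: S_def)
  have "open S" unfolding S_eq
    by (rule continuous_open_preimage[OF holomorphic_on_imp_continuous_on[OF D] open_right_halfplane]) auto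
  have Hc: "H s = (s - 1) * cont s" if "s \<noteq> 1" for s using that by (simp add: H_def cont_def field_simps)
  have Dnz: "D s \<noteq> 0" if "Re s \<ge> 1" for s
  proof (cases "Re s > 1")
    case True
    then have "s \<noteq> 1" by auto
    then show ?thesis using logderiv_cont(2)[OF True] Hc[of s] by (auto simp: D_def cont_def)
  next
    case False
    then have s: "Re s = 1" using that by simp
    show ?thesis
    proof (cases "s = 1 \<and> mean \<noteq> 0")
      case True
      then show ?thesis by (simp add: D_def H_def)
    next
      case False
      then have "cont s \<noteq> 0" using cont_nonzero[OF s] by simp
      then show ?thesis using False Hc[of s] by (auto simp: D_def cont_def split: if_splits)
    qed
  qed
  have "(\<lambda>N. \<Sum>n = 1..N. ?a n / of_nat n) \<longlonglongrightarrow> F 1"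
  proof (rule Newman_tauberian)
    show "norm (?a n) \<le> 1" for n
      unfolding norm_mult using norm_moebius_le[of n] norm_le[of n] by (intro mult_le_one) auto
    show "open S" by fact
    show "{s. Re s \<ge> 1} \<subseteq> S" using Dnz by (auto simp: S_def)
    have F_eq: "F = (\<lambda>s. (if mean = 0 then 1 else s - 1) / D s)" by (auto simp: F_def D_def)
    show "F holomorphic_on S" unfolding F_eq
      by (intro holomorphic_on_divide holomorphic_on_subset[OF D], cases "mean = 0")
        (auto simp: S_def intro!: holomorphic_intros)
    fix s :: complex assume s: "Re s > 1"
    then have "s \<noteq> 1" by auto
    have sm: "summable (dterm ?a s)"
      by (rule summable_norm_cancel, rule summable_dterm[OF _ s, of _ 1], unfold norm_mult)
        (use norm_moebius_le norm_le in \<open>auto intro!: mult_le_one\<close>)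
    have "F s = 1 / cont s"
      using Hc[OF \<open>s \<noteq> 1\<close>] \<open>s \<noteq> 1\<close> by (auto simp: F_def cont_def)
    then have eq: "suminf (dterm ?a s) = F s"
      using moebius_sums[OF s] Lser_nonzero[OF s] cont_eq[OF s]
        mult_right_cancel[of "Lser s" "suminf (dterm ?a s)" "F s"] by simp
    have "dterm ?a s sums suminf (dterm ?a s)" by (rule summable_sums[OF sm])
    then have "dterm ?a s sums F s" by (simp only: eq)
    then have "(\<lambda>n. dterm ?a s (Suc n)) sums F s" using sums_Suc_iff[of "dterm ?a s" "F s"] by simp
    then show "(\<lambda>n. ?a (Suc n) / of_nat (Suc n) powr s) sums F s" by (simp only: dterm_def)
  qed
  then show ?thesis by (rule mean_zero_if_summable_divide)
qed

end

subsection \<open>Orthogonality to periodic sequences\<close>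

definition ex :: "real \<Rightarrow> complex" where "ex x = cis (2 * pi * x)"

lemma ex_add: "ex (x + y) = ex x * ex y"
  by (simp add: ex_def cis_mult distrib_left)

lemma ex_0 [simp]: "ex 0 = 1"
  by (simp add: ex_def)

lemma norm_ex [simp]: "norm (ex x) = 1"
  by (simp add: ex_def)

lemma cnj_ex: "cnj (ex x) = ex (- x)"
  by (simp add: ex_def cis_cnj)

lemma ex_mult_minus [simp]: "ex x * ex (- x) = 1"
  by (simp add: ex_add[symmetric])

lemma ex_power: "ex x ^ n = ex (real n * x)"
  unfolding ex_def Complex.DeMoivre by (simp add: mult_ac)

lemma ex_of_int [simp]: "ex (of_int n) = 1"
  unfolding ex_def by (rule cis_multiple_2pi) simp

lemma ex_eq_1_iff: "ex x = 1 \<longleftrightarrow> x \<in> \<int>"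
proof
  assume "ex x = 1"
  then have "cos (2 * pi * x) = 1" by (simp add: ex_def complex_eq_iff)
  then obtain n :: int where "2 * pi * x = of_int n * 2 * pi" by (auto simp: cos_one_2pi_int)
  then have "x = of_int n" by simp
  then show "x \<in> \<int>" by simp
qed (auto elim!: Ints_cases)

lemma ex_add_int: "y \<in> \<int> \<Longrightarrow> ex (x + y) = ex x"
  by (simp add: ex_add ex_eq_1_iff[THEN iffD2])

lemma ex_cong: "x - y \<in> \<int> \<Longrightarrow> ex x = ex y"
  using ex_add_int[of "x - y" y] by simp

lemma sum_ex_roots:
  assumes "k < m"
  shows "(\<Sum>j<m. ex (- real j * real k / real m)) = (if k = 0 then of_nat m else 0)"
proof (cases "k = 0")
  case False
  let ?x = "ex (- real k / real m)"
  have "- real k / real m \<notin> \<int>"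
  proof
    assume "- real k / real m \<in> \<int>"
    then obtain n :: int where "- real k / real m = of_int n" by (rule Ints_cases)
    then have "real k = - of_int n * real m" using assms by (simp add: field_simps)
    then have "of_int (int k) = (of_int (- n * int m) :: real)" by simp
    then have "int k = - n * int m" using of_int_eq_iff by blast
    then have "int m dvd int k" by simp
    then have "m dvd k" by simp
    then show False using assms False by (auto dest: dvd_imp_le)
  qed
  then have "?x \<noteq> 1" by (simp add: ex_eq_1_iff)
  have "?x ^ m = ex (of_int (- int k))" using assms by (simp add: ex_power)
  also have "\<dots> = 1" by (rule ex_of_int)
  finally have "?x ^ m = 1" .
  have "(\<Sum>j<m. ex (- real j * real k / real m)) = (\<Sum>j<m. ?x ^ j)"
    by (simp add: ex_power)
  also have "\<dots> = 0" using \<open>?x \<noteq> 1\<close> \<open>?x ^ m = 1\<close> by (simp add: sum_gp_strict)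
  finally show ?thesis using False by simp
qed simp

lemma mean_zero_dilate:
  assumes "mean_zero b" "d > 0"
  shows "mean_zero (\<lambda>n. if d dvd n then b (n div d) else 0)"
proof (rule mean_zeroI)
  fix e :: real assume "e > 0"
  have "filterlim (\<lambda>N. N div d) sequentially sequentially"
    by (rule filterlim_at_top_div_const_nat) (use assms in auto)
  from eventually_compose_filterlim[OF mean_zeroD[OF assms(1) \<open>e > 0\<close>] this]
  show "\<forall>\<^sub>F N in sequentially. norm (\<Sum>n = 1..N. if d dvd n then b (n div d) else 0) \<le> e * real N"
  proof eventually_elim
    case (elim N)
    have "(\<Sum>n = 1..N. if d dvd n then b (n div d) else 0) = (\<Sum>n\<in>{n\<in>{1..N}. d dvd n}. b (n div d))"
      by (subst sum.inter_filter) auto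
    also have "\<dots> = (\<Sum>m = 1..N div d. b m)"
    proof (rule sum.reindex_bij_witness[of _ "\<lambda>m. d * m" "\<lambda>n. n div d"])
      fix n assume "n \<in> {n\<in>{1..N}. d dvd n}"
      then obtain k where "n = d * k" "d * k \<le> N" "k > 0" by (auto elim!: dvdE)
      then show "d * (n div d) = n" "n div d \<in> {1..N div d}"
        using assms(2) by (auto simp: less_eq_div_iff_mult_less_eq mult.commute)
    qed (use assms(2) in \<open>auto simp: less_eq_div_iff_mult_less_eq mult.commute\<close>)
    also have "norm \<dots> \<le> e * real (N div d)" using elim by simp
    also have "\<dots> \<le> e * real N" using \<open>e > 0\<close> by (intro mult_left_mono) auto
    finally show ?case .
  qed
qed

definition orth :: "(nat \<Rightarrow> complex) \<Rightarrow> bool" where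
  "orth a \<longleftrightarrow> mean_zero (\<lambda>n. of_int (moebius n) * a n)"

lemma orth_cong: "(\<And>n. n > 0 \<Longrightarrow> a n = b n) \<Longrightarrow> orth a \<longleftrightarrow> orth b"
  unfolding orth_def by (intro mean_zero_cong) simp

lemma orth_0 [simp]: "orth (\<lambda>n. 0)"
  by (simp add: orth_def)

lemma orth_add: "orth a \<Longrightarrow> orth b \<Longrightarrow> orth (\<lambda>n. a n + b n)"
  unfolding orth_def using mean_zero_add[of "\<lambda>n. of_int (moebius n) * a n"] by (simp add: distrib_left)

lemma orth_cmult: "orth a \<Longrightarrow> orth (\<lambda>n. c * a n)"
  unfolding orth_def using mean_zero_cmult[of "\<lambda>n. of_int (moebius n) * a n" c] by (simp add: mult.left_commute)

lemma orth_sum: "(\<And>i. i \<in> I \<Longrightarrow> orth (a i)) \<Longrightarrow> orth (\<lambda>n. \<Sum>i\<in>I. a i n)"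
  by (induction I rule: infinite_finite_induct) (auto intro: orth_add)

lemma orth_uniform_limit:
  assumes "\<And>e. e > 0 \<Longrightarrow> \<exists>b. orth b \<and> (\<forall>n. norm (a n - b n) \<le> e)"
  shows "orth a"
  unfolding orth_def
proof (rule mean_zero_uniform_limit)
  fix e :: real assume "e > 0"
  then obtain b where b: "orth b" "\<And>n. norm (a n - b n) \<le> e" using assms by blast
  have "norm (of_int (moebius n) * a n - of_int (moebius n) * b n) \<le> e" for n
  proof -
    have "norm (of_int (moebius n) * a n - of_int (moebius n) * b n) = norm (of_int (moebius n) :: complex) * norm (a n - b n)"
      by (simp only: right_diff_distrib[symmetric] norm_mult)
    also have "\<dots> \<le> 1 * e" using norm_moebius_le[of n] b(2)[of n] by (intro mult_mono) auto
    finally show ?thesis by simp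
  qed
  then show "\<exists>b'. mean_zero b' \<and> (\<forall>n. norm (of_int (moebius n) * a n - b' n) \<le> e)"
    using b(1) unfolding orth_def by blast
qed

text \<open>The functions on the unit group modulo \<open>q\<close>, extended by 0; dilations by
  units act on this space.\<close>

definition unit_periodic :: "nat \<Rightarrow> (nat \<Rightarrow> complex) \<Rightarrow> bool" where
  "unit_periodic q f \<longleftrightarrow> (\<forall>n. f (n + q) = f n) \<and> (\<forall>n. \<not> coprime n q \<longrightarrow> f n = 0)"

lemma unit_periodic_cong:
  assumes "unit_periodic q f" "q > 0" "[m = n] (mod q)"
  shows "f m = f n"
proof -
  interpret periodic_seq q f using assms by unfold_locales (auto simp: unit_periodic_def)
  show ?thesis using assms(3) by (rule f_cong)
qed

text \<open>For commuting operators \<open>f \<mapsto> f (a * _)\<close> of finite order, the spectral projections of one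
  operator preserve the eigenfunctions of the others.\<close>

lemma orth_eigenfunctions_suffice:
  fixes A :: "nat set"
  assumes "finite A" "q > 0" "\<And>a. a \<in> A \<Longrightarrow> coprime a q"
    and eigen: "\<And>f. unit_periodic q f \<Longrightarrow> (\<And>a. a \<in> A \<Longrightarrow> \<exists>z. \<forall>n. f (a * n) = z * f n) \<Longrightarrow> orth f"
    and f: "unit_periodic q f"
  shows "orth f"
  using assms(1,3-5)
proof (induction A arbitrary: f rule: finite_induct)
  case empty
  then show ?case by simp
next
  case (insert a A)
  have cop: "coprime a q" using insert.prems(1) by simp
  have "orth g" if g: "unit_periodic q g" and gA: "\<And>b. b \<in> A \<Longrightarrow> \<exists>z. \<forall>n. g (b * n) = z * g n" for g
  proof -
    define m where "m = totient q"
    have m: "m > 0" using \<open>q > 0\<close> by (simp add: m_def)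
    \<comment> \<open>\<open>P j\<close> is the projection to the eigenvalue
      \<open>ex (j / m)\<close> of dilation by \<open>a\<close>. By Euler's theorem the
      \<open>m\<close>-th power of that dilation is the identity.\<close>
    define P where "P j n = (\<Sum>k<m. ex (- real j * real k / real m) * g (a ^ k * n)) / of_nat m" for j n
    have am: "g (a ^ m * n) = g n" for n
    proof (rule unit_periodic_cong[OF g \<open>q > 0\<close>])
      have "[a ^ m * n = 1 * n] (mod q)"
        unfolding m_def by (intro cong_mult euler_theorem cop) simp
      then show "[a ^ m * n = n] (mod q)" by simp
    qed
    have per: "unit_periodic q (P j)" for j
      unfolding unit_periodic_def
    proof (intro conjI allI impI)
      fix n
      have "g (a ^ k * (n + q)) = g (a ^ k * n)" for k
        by (rule unit_periodic_cong[OF g \<open>q > 0\<close>]) (simp add: cong_def distrib_left)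
      then show "P j (n + q) = P j n" by (simp add: P_def)
    next
      fix n assume "\<not> coprime n q"
      then have "\<not> coprime (a ^ k * n) q" for k by simp
      then show "P j n = 0" using g by (simp add: P_def unit_periodic_def)
    qed
    have eig_a: "P j (a * n) = ex (real j / real m) * P j n" for j n
    proof -
      define h where "h k = ex (- real j * real k / real m) * g (a ^ k * n)" for k
      have "ex (- real j * real m / real m) = ex (of_int (- int j))" using m by simp
      then have hm: "h m = h 0" using am[of n] by (simp add: h_def del: of_int_minus)
      have "(\<Sum>k<m. h (Suc k)) + h 0 = (\<Sum>k<m. h k) + h m"
        by (subst sum.lessThan_Suc[symmetric], subst sum.lessThan_Suc_shift) simp
      then have shift: "(\<Sum>k<m. h (Suc k)) = (\<Sum>k<m. h k)" using hm by simp
      have "ex (- real j * real k / real m) * g (a ^ k * (a * n)) = ex (real j / real m) * h (Suc k)" for k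
      proof -
        have "ex (- real j * real k / real m) = ex (real j / real m) * ex (- real j * real (Suc k) / real m)"
          unfolding ex_add[symmetric] using m by (simp add: field_simps)
        moreover have "a ^ k * (a * n) = a ^ Suc k * n" by simp
        ultimately show ?thesis by (simp only: h_def mult.assoc)
      qed
      then have "(\<Sum>k<m. ex (- real j * real k / real m) * g (a ^ k * (a * n))) = ex (real j / real m) * (\<Sum>k<m. h k)"
        by (simp add: sum_distrib_left[symmetric] shift)
      then show ?thesis by (simp add: P_def h_def)
    qed
    have eig_b: "\<exists>z. \<forall>n. P j (b * n) = z * P j n" if b: "b \<in> A" for j b
    proof -
      obtain z where z: "\<And>n. g (b * n) = z * g n" using gA[OF b] by blast
      have "g (a ^ k * (b * n)) = z * g (a ^ k * n)" for k n
        using z[of "a ^ k * n"] by (simp add: mult.left_commute)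
      then have "P j (b * n) = z * P j n" for n
        by (simp add: P_def sum_distrib_left mult.left_commute)
      then show ?thesis by blast
    qed
    have "orth (P j)" for j
    proof (rule insert.prems(2)[OF per])
      fix b assume "b \<in> insert a A"
      then show "\<exists>z. \<forall>n. P j (b * n) = z * P j n" using eig_a eig_b by blast
    qed
    then have "orth (\<lambda>n. \<Sum>j<m. P j n)" by (intro orth_sum)
    moreover have "(\<Sum>j<m. P j n) = g n" for n
    proof -
      have "(\<Sum>j<m. P j n) = (\<Sum>k<m. (\<Sum>j<m. ex (- real j * real k / real m)) * g (a ^ k * n)) / of_nat m"
        unfolding P_def sum_divide_distrib[symmetric] by (subst sum.swap) (simp add: sum_distrib_right)
      also have "(\<Sum>k<m. (\<Sum>j<m. ex (- real j * real k / real m)) * g (a ^ k * n)) = (\<Sum>k<m. if k = 0 then of_nat m * g n else 0)"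
        by (intro sum.cong refl) (subst sum_ex_roots, auto)
      also have "\<dots> = of_nat m * g n" using m by simp
      finally show ?thesis using m by simp
    qed
    ultimately show ?thesis by simp
  qed
  then show ?case using insert.IH[of f] insert.prems by blast
qed

text \<open>A common eigenfunction of all unit dilations satisfies
  \<open>f (m * n) * f 1 = f m * f n\<close>. So either \<open>f\<close> vanishes identically or
  \<open>f / f 1\<close> is a Dirichlet character.\<close>

lemma orth_unit_periodic:
  assumes "q > 0" "unit_periodic q f"
  shows "orth f"
proof (rule orth_eigenfunctions_suffice[of "{a\<in>{..<q}. coprime a q}" q, OF _ assms(1) _ _ assms(2)])
  fix f assume f: "unit_periodic q f" and e: "\<And>a. a \<in> {a\<in>{..<q}. coprime a q} \<Longrightarrow> \<exists>z. \<forall>n. f (a * n) = z * f n"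
  have cong: "[m = n] (mod q) \<Longrightarrow> f m = f n" for m n
    by (rule unit_periodic_cong[OF f assms(1)])
  have e': "f (m * n) * f 1 = f m * f n" for m n
  proof (cases "coprime m q")
    case True
    then have "m mod q \<in> {a\<in>{..<q}. coprime a q}" using assms(1) by simp
    then obtain z where z: "\<And>n. f (m mod q * n) = z * f n" using e by blast
    have "f (m * n) = z * f n" for n
      using cong[of "m * n" "m mod q * n"] z[of n] by (simp add: cong_def mod_mult_left_eq)
    from this[of n] this[of 1] show ?thesis by simp
  next
    case False
    then have "\<not> coprime (m * n) q" by simp
    then show ?thesis using False f by (simp add: unit_periodic_def)
  qed
  show "orth f"
  proof (cases "f 1 = 0")
    case True
    have "f n = 0" for n using e'[of n n] True by simp
    then have "f = (\<lambda>n. 0)" by auto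
    then show ?thesis by simp
  next
    case False
    interpret dchar q "\<lambda>n. f n / f 1"
    proof unfold_locales
      show "f (m * n) / f 1 = f m / f 1 * (f n / f 1)" for m n
        using e'[of m n] False by (simp add: field_simps)
      show "f (n + q) / f 1 = f n / f 1" for n using f by (simp add: unit_periodic_def)
      show "f (Suc 0) / f 1 = 1" using False by simp
      show "f n / f 1 = 0" if "\<not> coprime n q" for n using f that by (simp add: unit_periodic_def)
    qed (fact assms(1))
    have "orth (\<lambda>n. f 1 * (f n / f 1))"
      by (rule orth_cmult) (use mean_zero_moebius in \<open>simp add: orth_def\<close>)
    then show ?thesis using False by simp
  qed
qed auto

lemma gcd_mult_coprime: "coprime k q \<Longrightarrow> gcd (d * k) q = gcd d (q::nat)"
proof (rule dvd_antisym)
  assume "coprime k q"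
  then have "coprime (gcd (d * k) q) k" by (meson coprime_commute coprime_divisors dvd_refl gcd_dvd2)
  then have "gcd (d * k) q dvd d" using gcd_dvd1[of "d * k" q] by (simp only: coprime_dvd_mult_left_iff)
  then show "gcd (d * k) q dvd gcd d q" by simp
qed (simp add: dvd_mult2)

text \<open>Sort \<open>n\<close> by \<open>g = gcd n q\<close> and write \<open>n = g * m\<close>.
  If \<open>m\<close> is coprime to \<open>q\<close>, then
  \<open>moebius n = moebius g * moebius m\<close>, and \<open>f (g * m)\<close> is a periodic
  function of the unit \<open>m\<close>; otherwise a prime divides both \<open>g\<close> and
  \<open>m\<close>, and \<open>moebius n = 0\<close>.\<close>

theorem orth_periodic:
  assumes "q > 0" "\<And>n. f (n + q) = f n"
  shows "orth f"
proof -
  interpret periodic_seq q f by unfold_locales (use assms in auto)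
  define h where "h d m = (if coprime m q then f (d * m) else 0)" for d m
  have h: "orth (h d)" for d
  proof (rule orth_unit_periodic[OF assms(1)])
    have "f (d * (n + q)) = f (d * n)" for n by (rule f_cong) (simp add: cong_def distrib_left)
    moreover have "coprime (n + q) q \<longleftrightarrow> coprime n q" for n by (simp only: coprime_iff_gcd_eq_1 gcd_add1)
    ultimately show "unit_periodic q (h d)" unfolding unit_periodic_def h_def by auto
  qed
  have "mean_zero (\<lambda>n. \<Sum>d | d dvd q. of_int (moebius d) *
      (if d dvd n then of_int (moebius (n div d)) * h d (n div d) else 0))"
    by (intro mean_zero_sum mean_zero_cmult mean_zero_dilate h[unfolded orth_def])
      (use assms(1) in \<open>auto intro!: Nat.gr0I\<close>)
  also have "?this \<longleftrightarrow> mean_zero (\<lambda>n. of_int (moebius n) * f n)"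
  proof (rule mean_zero_cong)
    fix n :: nat assume n: "n > 0"
    define g where "g = gcd n q"
    have g: "g dvd q" "g dvd n" "g > 0" using n by (auto simp: g_def)
    obtain m where m: "n = g * m" using g(2) by blast
    let ?t = "\<lambda>d. of_int (moebius d) * (if d dvd n then of_int (moebius (n div d)) * h d (n div d) else 0)"
    \<comment> \<open>If \<open>d\<close> divides \<open>q\<close> and \<open>n\<close>, coprimality
      of \<open>n div d\<close> and \<open>q\<close> forces \<open>d = gcd n q\<close>, so a single
      divisor survives.\<close>
    have "?t d = 0" if "d dvd q" "d \<noteq> g" for d
    proof (cases "d dvd n \<and> coprime (n div d) q")
      case True
      then have "gcd (d * (n div d)) q = gcd d q" by (intro gcd_mult_coprime) simp
      then have "d = g" using True that(1) by (simp add: g_def gcd_proj1_iff)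
      then show ?thesis using that by simp
    qed (auto simp: h_def)
    then have "(\<Sum>d | d dvd q. ?t d) = (\<Sum>d\<in>{g}. ?t d)"
      by (intro sum.mono_neutral_right) (use g assms(1) in auto)
    also have "\<dots> = of_int (moebius g * moebius m) * h g m"
      using m g(3) by simp
    also have "\<dots> = of_int (moebius n) * f n"
    proof (cases "coprime m q")
      case True
      then have "coprime g m" using g(1) by (metis coprime_commute coprime_divisors dvd_refl)
      then show ?thesis using True m by (simp add: h_def moebius_mult_coprime)
    next
      case False
      then have "gcd m q \<noteq> 1" unfolding coprime_iff_gcd_eq_1 .
      then obtain p where p1: "prime p" and p2: "p dvd gcd m q" using prime_factor_nat by blast
      note p = p1 dvd_trans[OF p2 gcd_dvd1] dvd_trans[OF p2 gcd_dvd2]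
      then have "p dvd n" unfolding m by simp
      then have "p dvd g" using p by (simp add: g_def)
      then have "\<not> coprime g m" using p by (metis coprime_common_divisor not_prime_unit)
      then have "moebius n = 0" unfolding m by (rule moebius_mult_not_coprime)
      then show ?thesis using False by (simp add: h_def)
    qed
    finally show "(\<Sum>d | d dvd q. ?t d) = of_int (moebius n) * f n" .
  qed
  finally show ?thesis by (simp add: orth_def)
qed

subsection \<open>Linear and quadratic phases\<close>

lemma mean_zero_ex:
  assumes "x \<notin> \<int>"
  shows "mean_zero (\<lambda>n. ex (x * real n))"
proof (rule mean_zeroI)
  fix e :: real assume "e > 0"
  have ne: "ex x \<noteq> 1" using assms by (simp add: ex_eq_1_iff)
  define C where "C = 2 / norm (1 - ex x)"
  have bd: "norm (\<Sum>n = 1..N. ex (x * real n)) \<le> C" for N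
  proof -
    have p: "ex (x * real n) = ex x ^ n" for n by (simp add: ex_power mult.commute)
    have "(\<Sum>n = 1..N. ex (x * real n)) * (1 - ex x) = ex x - ex x ^ Suc N"
      unfolding p
    proof (induction N)
      case (Suc N)
      have "(\<Sum>n = 1..Suc N. ex x ^ n) * (1 - ex x) = (\<Sum>n = 1..N. ex x ^ n) * (1 - ex x) + ex x ^ Suc N * (1 - ex x)"
        by (simp add: distrib_right)
      also note Suc
      also have "ex x - ex x ^ Suc N + ex x ^ Suc N * (1 - ex x) = ex x - ex x ^ Suc (Suc N)" by (simp add: algebra_simps)
      finally show ?case .
    qed simp
    then have "norm (\<Sum>n = 1..N. ex (x * real n)) * norm (1 - ex x) = norm (ex x - ex x ^ Suc N)"
      by (metis norm_mult)
    also have "\<dots> \<le> 2" using norm_triangle_ineq4[of "ex x" "ex x ^ Suc N"] by (simp add: norm_power norm_mult)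
    finally show ?thesis using ne by (simp add: C_def field_simps)
  qed
  have "\<forall>\<^sub>F N in sequentially. C \<le> e * real N" using \<open>e > 0\<close> by real_asymp
  then show "\<forall>\<^sub>F N in sequentially. norm (\<Sum>n = 1..N. ex (x * real n)) \<le> e * real N"
    by eventually_elim (use bd order_trans in blast)
qed

lemma irrational_mult_int: "x \<notin> \<rat> \<Longrightarrow> k \<noteq> 0 \<Longrightarrow> of_int k * (x::real) \<notin> \<int>"
proof
  assume x: "x \<notin> \<rat>" "k \<noteq> 0" and "of_int k * x \<in> \<int>"
  then have "of_int k * x / of_int k \<in> \<rat>" by (intro Rats_divide Rats_of_int) (use Ints_subset_Rats in auto)
  then show False using x by simp
qed

lemma mean_zero_ex_quadratic:
  assumes "g \<notin> \<rat>"
  shows "mean_zero (\<lambda>n. ex (g * (real n)\<^sup>2 + b * real n))"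
proof (rule van_der_Corput[of _ 1])
  fix l :: nat assume "l \<ge> 1"
  have eq: "ex (g * (real (n + l))\<^sup>2 + b * real (n + l)) * cnj (ex (g * (real n)\<^sup>2 + b * real n)) =
      ex (g * (real l)\<^sup>2 + b * real l) * ex (of_int (2 * int l) * g * real n)" for n
    unfolding cnj_ex ex_add[symmetric] by (rule arg_cong[of _ _ ex]) (simp add: power2_eq_square algebra_simps)
  have "of_int (2 * int l) * g \<notin> \<int>" by (rule irrational_mult_int[OF assms]) (use \<open>l \<ge> 1\<close> in auto)
  then show "mean_zero (\<lambda>n. ex (g * (real (n + l))\<^sup>2 + b * real (n + l)) * cnj (ex (g * (real n)\<^sup>2 + b * real n)))"
    unfolding eq by (intro mean_zero_cmult mean_zero_ex)
qed auto

lemma orth_Katai: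
  assumes "\<And>n. norm (a n) \<le> 1"
    and "\<And>p q. prime p \<Longrightarrow> prime q \<Longrightarrow> p \<noteq> q \<Longrightarrow> mean_zero (\<lambda>n. a (p * n) * cnj (a (q * n)))"
  shows "orth a"
  unfolding orth_def by (rule Katai_orthogonality[OF assms])

lemma orth_ex: "orth (\<lambda>n. ex (b * real n))"
proof (cases "b \<in> \<rat>")
  case False
  show ?thesis
  proof (rule orth_Katai)
    fix p q :: nat assume "p \<noteq> q"
    have eq: "ex (b * real (p * n)) * cnj (ex (b * real (q * n))) = ex (of_int (int p - int q) * b * real n)" for n
      unfolding cnj_ex ex_add[symmetric] by (rule arg_cong[of _ _ ex]) (simp add: algebra_simps)
    show "mean_zero (\<lambda>n. ex (b * real (p * n)) * cnj (ex (b * real (q * n))))"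
      unfolding eq by (intro mean_zero_ex irrational_mult_int[OF False]) (use \<open>p \<noteq> q\<close> in simp)
  qed simp
next
  case True
  then obtain A :: int and B :: nat where B: "B > 0" "b = of_int A / real B"
    by (auto simp: Rats_eq_int_div_nat)
  show ?thesis
  proof (rule orth_periodic[OF B(1)])
    fix n
    have "b * real (n + B) - b * real n = of_int A" using B by (simp add: field_simps)
    then show "ex (b * real (n + B)) = ex (b * real n)" by (intro ex_cong) simp
  qed
qed

text \<open>Allowing all linear twists makes the class stable under restriction to residue classes
  and under multiplication by continuous periodic functions of \<open>u * n + v\<close>: both expand
  into linear phases, the latter in the uniform limit.\<close>

definition Orth :: "(nat \<Rightarrow> complex) \<Rightarrow> bool" where
  "Orth a \<longleftrightarrow> (\<forall>b. orth (\<lambda>n. ex (b * real n) * a n))"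

lemma Orth_imp_orth: "Orth a \<Longrightarrow> orth a"
  unfolding Orth_def by (drule spec[of _ 0]) simp

lemma Orth_cong: "(\<And>n. n > 0 \<Longrightarrow> a n = b n) \<Longrightarrow> Orth a \<longleftrightarrow> Orth b"
  unfolding Orth_def by (intro all_cong1 orth_cong) simp

lemma Orth_add: "Orth a \<Longrightarrow> Orth b \<Longrightarrow> Orth (\<lambda>n. a n + b n)"
  unfolding Orth_def by (simp add: distrib_left orth_add)

lemma Orth_cmult: "Orth a \<Longrightarrow> Orth (\<lambda>n. c * a n)"
  unfolding Orth_def by (simp add: mult.left_commute[of _ c] orth_cmult)

lemma Orth_0 [simp]: "Orth (\<lambda>n. 0)"
  by (simp add: Orth_def)

lemma Orth_sum: "(\<And>i. i \<in> I \<Longrightarrow> Orth (a i)) \<Longrightarrow> Orth (\<lambda>n. \<Sum>i\<in>I. a i n)"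
  by (induction I rule: infinite_finite_induct) (auto intro: Orth_add)

lemma Orth_ex_mult: "Orth a \<Longrightarrow> Orth (\<lambda>n. ex (t * real n) * a n)"
  unfolding Orth_def
proof
  fix b assume "\<forall>b. orth (\<lambda>n. ex (b * real n) * a n)"
  then have "orth (\<lambda>n. ex ((b + t) * real n) * a n)" by blast
  then show "orth (\<lambda>n. ex (b * real n) * (ex (t * real n) * a n))" by (simp add: distrib_right ex_add mult.assoc)
qed

lemma Orth_uniform_limit:
  assumes "\<And>e. e > 0 \<Longrightarrow> \<exists>b. Orth b \<and> (\<forall>n. norm (a n - b n) \<le> e)"
  shows "Orth a"
  unfolding Orth_def
proof (intro allI orth_uniform_limit)
  fix t e :: real assume "e > 0"
  then obtain b where b: "Orth b" "\<And>n. norm (a n - b n) \<le> e" using assms by blast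
  have "norm (ex (t * real n) * a n - ex (t * real n) * b n) \<le> e" for n
    unfolding right_diff_distrib[symmetric] norm_mult using b(2) by simp
  then show "\<exists>b. orth b \<and> (\<forall>n. norm (ex (t * real n) * a n - b n) \<le> e)"
    using b(1) unfolding Orth_def by blast
qed

lemma Orth_residue_class:
  assumes "Orth a" "B > 0"
  shows "Orth (\<lambda>n. if [n = s] (mod B) then a n else 0)"
proof -
  \<comment> \<open>The indicator of a residue class as an average of additive characters.\<close>
  have ind: "(if [n = s] (mod B) then 1 else 0) = (\<Sum>j<B. ex (real j / real B * real n) * ex (- real j * real s / real B)) / of_nat B" for n
  proof -
    define x where "x = (real n - real s) / real B"
    have "(\<Sum>j<B. ex (real j / real B * real n) * ex (- real j * real s / real B)) = (\<Sum>j<B. ex x ^ j)"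
      unfolding ex_add[symmetric] ex_power x_def using assms(2)
      by (intro sum.cong refl arg_cong[of _ _ ex]) (simp add: field_simps)
    moreover have "ex x ^ B = ex (of_int (int n - int s))" unfolding ex_power x_def using assms(2) by simp
    then have "ex x ^ B = 1" by (simp only: ex_of_int)
    moreover have "ex x = 1 \<longleftrightarrow> [n = s] (mod B)"
    proof -
      have "x \<in> \<int> \<longleftrightarrow> int B dvd int n - int s"
      proof
        assume "x \<in> \<int>"
        then obtain k :: int where "x = of_int k" by (rule Ints_cases)
        then have "of_int (int n - int s) = (of_int (int B * k) :: real)" using assms(2) by (simp add: x_def field_simps)
        then have "int n - int s = int B * k" using of_int_eq_iff by blast
        then show "int B dvd int n - int s" by simp
      next
        assume "int B dvd int n - int s"
        then obtain k where "int n - int s = int B * k" by blast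
        then have "real_of_int (int n - int s) = real_of_int (int B * k)" by (simp only:)
        then have "x = of_int k" using assms(2) by (simp add: x_def field_simps)
        then show "x \<in> \<int>" by simp
      qed
      also have "\<dots> \<longleftrightarrow> [n = s] (mod B)" by (simp add: cong_int_iff[symmetric] cong_iff_dvd_diff)
      finally show ?thesis by (simp add: ex_eq_1_iff)
    qed
    ultimately show ?thesis using assms(2) by (simp add: sum_gp_strict)
  qed
  have "Orth (\<lambda>n. \<Sum>j<B. (ex (- real j * real s / real B) / of_nat B) * (ex (real j / real B * real n) * a n))"
    by (intro Orth_sum Orth_cmult Orth_ex_mult assms)
  also have "(\<lambda>n. \<Sum>j<B. (ex (- real j * real s / real B) / of_nat B) * (ex (real j / real B * real n) * a n)) =
      (\<lambda>n. (if [n = s] (mod B) then 1 else 0) * a n)"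
    unfolding ind by (simp add: sum_distrib_right sum_distrib_left sum_divide_distrib mult_ac)
  also have "\<dots> = (\<lambda>n. if [n = s] (mod B) then a n else 0)" by auto
  finally show ?thesis .
qed

lemma Orth_residues:
  assumes "B > 0" "\<And>s. Orth (b s)" "\<And>n s. [n = s] (mod B) \<Longrightarrow> a n = b s n"
  shows "Orth a"
proof -
  have "Orth (\<lambda>n. \<Sum>s<B. if [n = s] (mod B) then b s n else 0)"
    by (intro Orth_sum Orth_residue_class assms)
  also have "(\<lambda>n. \<Sum>s<B. if [n = s] (mod B) then b s n else 0) = a"
  proof
    fix n
    have "(\<Sum>s<B. if [n = s] (mod B) then b s n else 0) = (\<Sum>s<B. if s = n mod B then a n else 0)"
    proof (intro sum.cong refl)
      fix s assume "s \<in> {..<B}"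
      then show "(if [n = s] (mod B) then b s n else 0) = (if s = n mod B then a n else 0)"
        using assms(3)[of n s] by (auto simp: cong_def)
    qed
    also have "\<dots> = a n" using assms(1) by (subst sum.delta) auto
    finally show "(\<Sum>s<B. if [n = s] (mod B) then b s n else 0) = a n" .
  qed
  finally show ?thesis .
qed

lemma Orth_1: "Orth (\<lambda>n. 1)"
  by (simp add: Orth_def orth_ex)

text \<open>Katai's correlations have leading coefficient \<open>(p^2 - q^2) * g\<close>, irrational
  together with \<open>g\<close>. For rational \<open>g\<close> the phase depends only on
  \<open>n\<close> modulo the denominator.\<close>

lemma Orth_ex_quadratic: "Orth (\<lambda>n. ex (g * (real n)\<^sup>2))"
proof (cases "g \<in> \<rat>")
  case False
  have "orth (\<lambda>n. ex (g * (real n)\<^sup>2 + b * real n))" for b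
  proof (rule orth_Katai)
    fix p q :: nat assume "p \<noteq> q"
    have eq: "ex (g * (real (p * n))\<^sup>2 + b * real (p * n)) * cnj (ex (g * (real (q * n))\<^sup>2 + b * real (q * n))) =
        ex (of_int (int p ^ 2 - int q ^ 2) * g * (real n)\<^sup>2 + b * (real p - real q) * real n)" for n
      unfolding cnj_ex ex_add[symmetric] by (rule arg_cong[of _ _ ex]) (simp add: power2_eq_square algebra_simps)
    have "int p ^ 2 - int q ^ 2 \<noteq> 0" using \<open>p \<noteq> q\<close> by (simp add: power2_eq_iff)
    then have "of_int (int p ^ 2 - int q ^ 2) * g \<notin> \<rat>"
      using False by (metis Rats_divide Rats_of_int nonzero_mult_div_cancel_left of_int_eq_0_iff)
    then show "mean_zero (\<lambda>n. ex (g * (real (p * n))\<^sup>2 + b * real (p * n)) * cnj (ex (g * (real (q * n))\<^sup>2 + b * real (q * n))))"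
      unfolding eq by (rule mean_zero_ex_quadratic)
  qed simp
  then show ?thesis unfolding Orth_def by (simp add: ex_add mult.commute)
next
  case True
  then obtain A :: int and B :: nat where B: "B > 0" "g = of_int A / real B"
    by (auto simp: Rats_eq_int_div_nat)
  show ?thesis
  proof (rule Orth_residues[OF B(1)])
    show "Orth (\<lambda>n. ex (g * (real s)\<^sup>2) * 1)" for s by (rule Orth_cmult[OF Orth_1])
    fix n s assume "[n = s] (mod B)"
    then have "int B dvd int n - int s" by (simp add: cong_int_iff[symmetric] cong_iff_dvd_diff)
    then obtain k where "int n - int s = int B * k" by blast
    then have "real_of_int (int n - int s) = real_of_int (int B * k)" by (simp only:)
    then have n: "real n = real s + real B * of_int k" by simp
    have gB: "g * real B = of_int A" using B by simp
    have "g * (real n)\<^sup>2 - g * (real s)\<^sup>2 = (g * real B) * (2 * real s * of_int k + real B * (of_int k)\<^sup>2)"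
      unfolding n by (simp add: power2_eq_square algebra_simps)
    also have "\<dots> = of_int (A * (2 * int s * k + int B * k\<^sup>2))" unfolding gB by simp
    finally have "g * (real n)\<^sup>2 - g * (real s)\<^sup>2 = of_int (A * (2 * int s * k + int B * k\<^sup>2))" .
    then have "g * (real n)\<^sup>2 - g * (real s)\<^sup>2 \<in> \<int>" by (simp only: Ints_of_int)
    then show "ex (g * (real n)\<^sup>2) = ex (g * (real s)\<^sup>2) * 1" by (simp add: ex_cong)
  qed
qed

section \<open>Trigonometric approximation on the three-torus\<close>

inductive trig3 :: "(real \<Rightarrow> real \<Rightarrow> real \<Rightarrow> complex) \<Rightarrow> bool" where
  monomial: "trig3 (\<lambda>x y z. c * ex (of_int i * x + of_int j * y + of_int k * z))"
| add: "trig3 f \<Longrightarrow> trig3 g \<Longrightarrow> trig3 (\<lambda>x y z. f x y z + g x y z)"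

lemma trig3_mult_monomial: "trig3 g \<Longrightarrow> trig3 (\<lambda>x y z. c * ex (of_int i * x + of_int j * y + of_int k * z) * g x y z)"
proof (induction rule: trig3.induct)
  case (monomial c' i' j' k')
  have "(\<lambda>x y z. c * ex (of_int i * x + of_int j * y + of_int k * z) * (c' * ex (of_int i' * x + of_int j' * y + of_int k' * z)))
      = (\<lambda>x y z. (c * c') * ex (of_int (i + i') * x + of_int (j + j') * y + of_int (k + k') * z))"
  proof (intro ext)
    fix x y z
    have "ex (of_int i * x + of_int j * y + of_int k * z) * ex (of_int i' * x + of_int j' * y + of_int k' * z)
        = ex (of_int (i + i') * x + of_int (j + j') * y + of_int (k + k') * z)"
      unfolding ex_add[symmetric] by (rule arg_cong[of _ _ ex]) (simp add: algebra_simps)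
    then show "c * ex (of_int i * x + of_int j * y + of_int k * z) * (c' * ex (of_int i' * x + of_int j' * y + of_int k' * z))
        = (c * c') * ex (of_int (i + i') * x + of_int (j + j') * y + of_int (k + k') * z)"
      by (metis mult.assoc mult.left_commute)
  qed
  then show ?case by (simp only: trig3.monomial)
qed (simp add: distrib_left trig3.add)

lemma trig3_mult: "trig3 f \<Longrightarrow> trig3 g \<Longrightarrow> trig3 (\<lambda>x y z. f x y z * g x y z)"
  by (induction rule: trig3.induct) (auto simp: distrib_right intro: trig3_mult_monomial trig3.add)

lemma trig3_const: "trig3 (\<lambda>x y z. c)"
  using trig3.monomial[of c 0 0 0] by simp

lemma trig3_cmult: "trig3 f \<Longrightarrow> trig3 (\<lambda>x y z. c * f x y z)"
  using trig3_mult[OF trig3_const[of c]] .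

lemma trig3_Re_Im_ex:
  "trig3 (\<lambda>x y z. of_real (Re (ex x)))" "trig3 (\<lambda>x y z. of_real (Im (ex x)))"
  "trig3 (\<lambda>x y z. of_real (Re (ex y)))" "trig3 (\<lambda>x y z. of_real (Im (ex y)))"
  "trig3 (\<lambda>x y z. of_real (Re (ex z)))" "trig3 (\<lambda>x y z. of_real (Im (ex z)))"
proof -
  have Re: "of_real (Re (ex t)) = 1/2 * ex t + 1/2 * ex (- t)" for t
    by (simp add: ex_def complex_eq_iff)
  have Im: "of_real (Im (ex t)) = - \<i>/2 * ex t + \<i>/2 * ex (- t)" for t
    by (simp add: ex_def complex_eq_iff)
  show "trig3 (\<lambda>x y z. of_real (Re (ex x)))" "trig3 (\<lambda>x y z. of_real (Im (ex x)))"
    unfolding Re Im using trig3.add[OF trig3.monomial[of "1/2" 1 0 0] trig3.monomial[of "1/2" "-1" 0 0]]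
      trig3.add[OF trig3.monomial[of "- \<i>/2" 1 0 0] trig3.monomial[of "\<i>/2" "-1" 0 0]] by simp_all
  show "trig3 (\<lambda>x y z. of_real (Re (ex y)))" "trig3 (\<lambda>x y z. of_real (Im (ex y)))"
    unfolding Re Im using trig3.add[OF trig3.monomial[of "1/2" 0 1 0] trig3.monomial[of "1/2" 0 "-1" 0]]
      trig3.add[OF trig3.monomial[of "- \<i>/2" 0 1 0] trig3.monomial[of "\<i>/2" 0 "-1" 0]] by simp_all
  show "trig3 (\<lambda>x y z. of_real (Re (ex z)))" "trig3 (\<lambda>x y z. of_real (Im (ex z)))"
    unfolding Re Im using trig3.add[OF trig3.monomial[of "1/2" 0 0 1] trig3.monomial[of "1/2" 0 0 "-1"]]
      trig3.add[OF trig3.monomial[of "- \<i>/2" 0 0 1] trig3.monomial[of "\<i>/2" 0 0 "-1"]] by simp_all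
qed

lemma trig3_real_polynomial:
  fixes p :: "complex \<times> complex \<times> complex \<Rightarrow> real"
  assumes "real_polynomial_function p"
  shows "trig3 (\<lambda>x y z. of_real (p (ex x, ex y, ex z)))"
  using assms
proof (induction rule: real_polynomial_function.induct)
  case (linear f)
  interpret bounded_linear f by (rule linear)
  \<comment> \<open>A real-linear functional of three complex numbers is a combination of their real
    and imaginary parts, which are trigonometric on the torus.\<close>
  have dec: "f (u, v, w) = Re u * f (1, 0, 0) + Im u * f (\<i>, 0, 0) + Re v * f (0, 1, 0) + Im v * f (0, \<i>, 0)
      + Re w * f (0, 0, 1) + Im w * f (0, 0, \<i>)" for u v w
  proof -
    have "(u, v, w) = Re u *\<^sub>R (1, 0, 0) + Im u *\<^sub>R (\<i>, 0, 0) + Re v *\<^sub>R (0, 1, 0) + Im v *\<^sub>R (0, \<i>, 0)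
      + Re w *\<^sub>R (0, 0, 1) + Im w *\<^sub>R (0, 0, \<i>)"
      by (simp add: complex_eq_iff)
    then have "f (u, v, w) = f (Re u *\<^sub>R (1, 0, 0) + Im u *\<^sub>R (\<i>, 0, 0) + Re v *\<^sub>R (0, 1, 0) + Im v *\<^sub>R (0, \<i>, 0)
      + Re w *\<^sub>R (0, 0, 1) + Im w *\<^sub>R (0, 0, \<i>))" by (rule arg_cong)
    then show ?thesis by (simp only: add scaleR real_scaleR_def)
  qed
  obtain a1 a2 a3 a4 a5 a6 where dec': "\<And>u v w. f (u, v, w) = Re u * a1 + Im u * a2 + Re v * a3 + Im v * a4
      + Re w * a5 + Im w * a6"
    by (rule that, rule dec)
  show ?case unfolding dec' of_real_add of_real_mult
    by (intro trig3.add trig3_mult trig3_Re_Im_ex trig3_const)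
next
  case (const c)
  show ?case by (rule trig3_const)
next
  case (add f g)
  then show ?case by (simp add: trig3.add)
next
  case (mult f g)
  then show ?case by (simp add: trig3_mult)
qed

lemma ex_surj: "norm w = 1 \<Longrightarrow> ex (Arg2pi w / (2 * pi)) = w"
  using Arg2pi_eq[of w] by (simp add: ex_def cis_conv_exp)

lemma continuous_on_ex [continuous_intros]: "continuous_on S f \<Longrightarrow> continuous_on S (\<lambda>x. ex (f x))"
  unfolding ex_def by (intro continuous_intros)

text \<open>Stone-Weierstrass on a product of three unit circles, to which \<open>K\<close> descends
  as \<open>k\<close>. Continuity of \<open>k\<close> comes from \<open>E\<close> being a quotient
  map on the compact cube, so the jump of \<open>Arg2pi\<close> does no harm. Polynomials in the
  coordinates of the circles are trigonometric polynomials in \<open>x\<close>, \<open>y\<close>,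
  \<open>z\<close>.\<close>

theorem trig3_approx:
  fixes K :: "real \<Rightarrow> real \<Rightarrow> real \<Rightarrow> complex"
  assumes cont: "continuous_on UNIV (\<lambda>(x, y, z). K x y z)"
    and per: "\<And>x y z. K (x + 1) y z = K x y z" "\<And>x y z. K x (y + 1) z = K x y z" "\<And>x y z. K x y (z + 1) = K x y z"
    and "e > 0"
  obtains P where "trig3 P" "\<And>x y z. norm (K x y z - P x y z) < e"
proof -
  let ?T = "sphere 0 1 \<times> sphere 0 1 \<times> sphere 0 1 :: (complex \<times> complex \<times> complex) set"
  let ?C = "{0..1} \<times> {0..1} \<times> {0..1} :: (real \<times> real \<times> real) set"
  define E where "E = (\<lambda>(x, y, z). (ex x, ex y, ex z))"
  define t where "t w = Arg2pi w / (2 * pi)" for w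
  define k where "k = (\<lambda>(u, v, w). K (t u) (t v) (t w))"
  have perZ: "K (x + of_int i) (y + of_int j) (z + of_int l) = K x y z" for x y z i j l
  proof -
    interpret p1: periodic_fun_simple' "\<lambda>x. K x (y + of_int j) (z + of_int l)" by unfold_locales (rule per)
    interpret p2: periodic_fun_simple' "\<lambda>y. K x y (z + of_int l)" by unfold_locales (rule per)
    interpret p3: periodic_fun_simple' "\<lambda>z. K x y z" by unfold_locales (rule per)
    show ?thesis by (simp add: p1.plus_of_int p2.plus_of_int p3.plus_of_int)
  qed
  have tex: "\<exists>i::int. t (ex x) = x + of_int i" for x
  proof -
    have "ex (t (ex x)) = ex x" using ex_surj[of "ex x"] by (simp add: t_def)
    moreover have "ex (t (ex x) - x) = ex (t (ex x)) * ex (- x)" by (simp add: ex_add[symmetric])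
    ultimately have "ex (t (ex x) - x) = 1" by simp
    then obtain i :: int where "t (ex x) - x = of_int i" unfolding ex_eq_1_iff by (rule Ints_cases)
    then show ?thesis by (intro exI[of _ i]) simp
  qed
  have kE: "k (ex x, ex y, ex z) = K x y z" for x y z
  proof -
    obtain i j l :: int where "t (ex x) = x + of_int i" "t (ex y) = y + of_int j" "t (ex z) = z + of_int l"
      using tex by meson
    then show ?thesis by (simp add: k_def perZ)
  qed
  have Econt: "continuous_on ?C E" unfolding E_def case_prod_unfold by (intro continuous_intros)
  have Eimg: "E ` ?C = ?T"
  proof (intro equalityI subsetI)
    fix w assume "w \<in> ?T"
    then obtain u v w' where w: "w = (u, v, w')" "norm u = 1" "norm v = 1" "norm w' = 1" by (auto simp: dist_norm)
    have "t u \<in> {0..1}" for u using Arg2pi[of u] by (auto simp: t_def)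
    then have "(t u, t v, t w') \<in> ?C" by simp
    moreover have "E (t u, t v, t w') = w" using w by (simp add: E_def t_def ex_surj)
    ultimately show "w \<in> E ` ?C" by (metis imageI)
  qed (auto simp: E_def)
  have "compact ?C" by (intro compact_Times compact_Icc)
  then have "quotient_map (top_of_set ?C) (top_of_set ?T) E"
    by (intro T1_Spaces.continuous_imp_quotient_map)
      (use Econt Eimg in \<open>auto simp: compact_space_subtopology Hausdorff_space_subtopology\<close>)
  moreover have "continuous_map (top_of_set ?C) euclidean (k \<circ> E)"
  proof -
    have eq: "k \<circ> E = (\<lambda>(x, y, z). K x y z)" by (auto simp: fun_eq_iff E_def kE)
    show ?thesis unfolding eq continuous_map_iff_continuous by (rule continuous_on_subset[OF cont]) simp
  qed
  ultimately have "continuous_map (top_of_set ?T) euclidean k" by (rule continuous_compose_quotient_map)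
  then have kcont: "continuous_on ?T k" by simp
  have Tc: "compact ?T" by (intro compact_Times) auto
  obtain g where g: "polynomial_function g" "\<And>w. w \<in> ?T \<Longrightarrow> norm (k w - g w) < e"
    using Stone_Weierstrass_polynomial_function[OF Tc kcont \<open>e > 0\<close>] by blast
  define P where "P x y z = of_real (Re (g (ex x, ex y, ex z))) + \<i> * of_real (Im (g (ex x, ex y, ex z)))" for x y z
  have "real_polynomial_function (Re \<circ> g)" "real_polynomial_function (Im \<circ> g)"
    using g(1) bounded_linear_Re bounded_linear_Im by (auto simp: polynomial_function_def)
  from trig3_real_polynomial[OF this(1)] trig3_real_polynomial[OF this(2)]
  have "trig3 P" unfolding P_def o_def by (intro trig3.add trig3_cmult)
  moreover have "norm (K x y z - P x y z) < e" for x y z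
  proof -
    have "P x y z = g (ex x, ex y, ex z)" unfolding P_def by (simp add: complex_eq[symmetric])
    then show ?thesis using g(2)[of "(ex x, ex y, ex z)"] by (simp add: kE)
  qed
  ultimately show ?thesis using that by blast
qed

lemma trig3_approx_1:
  fixes g :: "real \<Rightarrow> complex"
  assumes "continuous_on UNIV g" "\<And>x. g (x + 1) = g x" "e > 0"
  obtains P where "trig3 P" "\<And>x. norm (g x - P x 0 0) < e"
proof -
  have "continuous_on UNIV (\<lambda>(x, y :: real, z :: real). g x)"
    unfolding case_prod_unfold using continuous_on_compose2[OF assms(1), of UNIV fst] by (simp add: continuous_on_fst)
  from trig3_approx[OF this assms(2) refl refl assms(3)] that show ?thesis by metis
qed

lemma Orth_mult_continuous:
  fixes g :: "real \<Rightarrow> complex"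
  assumes "Orth a" "\<And>n. norm (a n) \<le> 1" "continuous_on UNIV g" "\<And>x. g (x + 1) = g x"
  shows "Orth (\<lambda>n. g (u * real n + v) * a n)"
proof (rule Orth_uniform_limit)
  fix e :: real assume "e > 0"
  obtain P where P: "trig3 P" "\<And>x. norm (g x - P x 0 0) < e"
    using trig3_approx_1[OF assms(3,4) \<open>e > 0\<close>] by metis
  have "Orth (\<lambda>n. P (u * real n + v) 0 0 * a n)" using P(1)
  proof (induction rule: trig3.induct)
    case (monomial c i j k)
    have "Orth (\<lambda>n. (c * ex (of_int i * v)) * (ex ((of_int i * u) * real n) * a n))"
      by (intro Orth_cmult Orth_ex_mult assms)
    then show ?case by (simp add: distrib_left ex_add mult_ac)
  qed (simp add: distrib_right Orth_add)
  moreover have "norm (g (u * real n + v) * a n - P (u * real n + v) 0 0 * a n) \<le> e" for n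
  proof -
    have "norm (g (u * real n + v) * a n - P (u * real n + v) 0 0 * a n) = norm (g (u * real n + v) - P (u * real n + v) 0 0) * norm (a n)"
      by (simp only: left_diff_distrib[symmetric] norm_mult)
    also have "\<dots> \<le> e * 1" using P(2)[of "u * real n + v"] assms(2)[of n] \<open>e > 0\<close> by (intro mult_mono) auto
    finally show ?thesis by simp
  qed
  ultimately show "\<exists>b. Orth b \<and> (\<forall>n. norm (g (u * real n + v) * a n - b n) \<le> e)" by blast
qed

lemma mean_zero_ex_mult_continuous:
  fixes g :: "real \<Rightarrow> complex"
  assumes "continuous_on UNIV g" "\<And>x. g (x + 1) = g x" "\<And>j :: int. t + of_int j * u \<notin> \<int>"
  shows "mean_zero (\<lambda>n. ex (t * real n) * g (u * real n))"
proof (rule mean_zero_uniform_limit)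
  fix e :: real assume "e > 0"
  obtain P where P: "trig3 P" "\<And>x. norm (g x - P x 0 0) < e"
    using trig3_approx_1[OF assms(1,2) \<open>e > 0\<close>] by metis
  have "mean_zero (\<lambda>n. ex (t * real n) * P (u * real n) 0 0)" using P(1)
  proof (induction rule: trig3.induct)
    case (monomial c i j k)
    have "mean_zero (\<lambda>n. c * ex ((t + of_int i * u) * real n))"
      by (intro mean_zero_cmult mean_zero_ex assms)
    moreover have "ex (t * real n) * (c * ex (of_int i * (u * real n) + of_int j * 0 + of_int k * 0)) = c * ex ((t + of_int i * u) * real n)" for n
    proof -
      have "ex (t * real n) * ex (of_int i * (u * real n) + of_int j * 0 + of_int k * 0) = ex ((t + of_int i * u) * real n)"
        unfolding ex_add[symmetric] by (rule arg_cong[of _ _ ex]) (simp add: algebra_simps)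
      then show ?thesis by (simp only: mult.left_commute)
    qed
    ultimately show ?case by (simp only:)
  qed (simp add: distrib_left mean_zero_add)
  moreover have "norm (ex (t * real n) * g (u * real n) - ex (t * real n) * P (u * real n) 0 0) \<le> e" for n
    unfolding right_diff_distrib[symmetric] norm_mult using P(2)[of "u * real n"] by simp
  ultimately show "\<exists>b. mean_zero b \<and> (\<forall>n. norm (ex (t * real n) * g (u * real n) - b n) \<le> e)" by blast
qed

subsection \<open>Bracket quadratic phases\<close>

text \<open>Continuity across the jumps of the floor function: where \<open>F\<close> vanishes it
  squeezes \<open>H\<close>, and away from its zeros the floors are locally constant in every use.
  The factors vanishing at integers are inserted for this purpose.\<close>

lemma continuous_if_dominated:
  fixes F H :: "'a :: t2_space \<Rightarrow> complex"
  assumes F: "continuous_on UNIV F" and dom: "\<And>x. norm (H x) \<le> norm (F x)"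
    and loc: "\<And>x. F x \<noteq> 0 \<Longrightarrow> isCont H x"
  shows "continuous_on UNIV H"
proof (rule continuous_at_imp_continuous_on, rule ballI)
  fix x
  show "isCont H x"
  proof (cases "F x = 0")
    case True
    then have H0: "H x = 0" using dom[of x] by simp
    have "isCont F x" using F by (simp add: continuous_on_eq_continuous_at)
    then have "(F \<longlongrightarrow> 0) (at x)" using True by (simp add: isCont_def)
    then have "((\<lambda>x. norm (F x)) \<longlongrightarrow> 0) (at x)" by (rule tendsto_norm_zero)
    then have "(H \<longlongrightarrow> 0) (at x)"
      by (rule Lim_null_comparison[rotated]) (use dom in \<open>auto intro: always_eventually\<close>)
    then show ?thesis using H0 by (simp add: isCont_def)
  qed (rule loc)
qed

lemma eventually_floor_const:
  fixes \<phi> :: "'a :: t2_space \<Rightarrow> real"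
  assumes "isCont \<phi> t" "\<phi> t \<notin> \<int>"
  shows "\<forall>\<^sub>F x in nhds t. \<lfloor>\<phi> x\<rfloor> = \<lfloor>\<phi> t\<rfloor>"
  using assms by (intro eventually_floor_eq) (simp_all add: isCont_def tendsto_at_iff_tendsto_nhds)

lemma vanish_Ints:
  fixes f :: "real \<Rightarrow> complex"
  assumes "f 0 = 0" "\<And>x. f (x + 1) = f x" "x \<in> \<int>"
  shows "f x = 0"
proof -
  interpret periodic_fun_simple' f by unfold_locales (rule assms)
  show ?thesis using assms(1,3) plus_of_int[of 0] by (auto elim!: Ints_cases)
qed

text \<open>Put \<open>m = \<lfloor>u * n + x0\<rfloor>\<close>. Completing the square in the
  \<open>d2\<close> part leaves \<open>d2 / 2 * (u * n - m)^2\<close>, a function of the fractional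
  part, and \<open>- d2 / 2 * m^2\<close>. Modulo 1 the term \<open>d1 * n * m\<close> depends only
  on \<open>n\<close> and \<open>m\<close> modulo \<open>B\<close>. The only part still quadratic in
  \<open>n\<close> is \<open>u * d1 / 2 * n^2\<close>.\<close>

lemma Orth_degenerate:
  fixes f :: "real \<Rightarrow> complex"
  assumes f: "continuous_on UNIV f" "f 0 = 0" "\<And>x. f (x + 1) = f x"
    and d: "d1 \<in> \<rat>" "d2 \<in> \<rat>" "V = d1 + d2 * u"
  shows "Orth (\<lambda>n. ex (u * V / 2 * (real n)\<^sup>2 - V * real n * of_int \<lfloor>u * real n + x0\<rfloor>) * f (u * real n + x0))"
proof -
  obtain A1 :: int and B1 :: nat where B1: "B1 > 0" "d1 = of_int A1 / real B1" using d(1) by (auto simp: Rats_eq_int_div_nat)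
  obtain A2 :: int and B2 :: nat where B2: "B2 > 0" "d2 = of_int A2 / real B2" using d(2) by (auto simp: Rats_eq_int_div_nat)
  define B where "B = B1 * B2"
  have B: "B > 0" using B1 B2 by (simp add: B_def)
  have Bd1: "d1 * real B = of_int (A1 * int B2)" and Bd2: "d2 * real B = of_int (A2 * int B1)"
    using B1 B2 by (simp_all add: B_def)
  define h where "h s m = - d1 * real s * of_int m - d2 / 2 * (of_int m)\<^sup>2" for s :: nat and m :: int
  \<comment> \<open>Scaling the variable by \<open>2 * B\<close> gives period 1. The 2 is there
    because \<open>d2 / 2 * m^2\<close> is determined modulo 1 by \<open>m\<close> modulo
    \<open>2 * B\<close>, but not in general by \<open>m\<close> modulo \<open>B\<close>.\<close>
  define g where "g s t = ex (h s \<lfloor>2 * real B * t\<rfloor> + d2 / 2 * (2 * real B * t - of_int \<lfloor>2 * real B * t\<rfloor> - x0)\<^sup>2) * f (2 * real B * t)" for s :: nat and t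
  have gper: "g s (t + 1) = g s t" for s t
  proof -
    define x where "x = 2 * real B * t"
    define m where "m = \<lfloor>x\<rfloor>"
    have x1: "2 * real B * (t + 1) = x + of_int (2 * int B)" by (simp add: x_def distrib_left)
    have fl: "\<lfloor>x + of_int (2 * int B)\<rfloor> = m + 2 * int B" unfolding m_def by (rule floor_add_int[symmetric])
    interpret periodic_fun_simple' f by unfold_locales (rule f)
    have fx: "f (x + of_int (2 * int B)) = f x" by (rule plus_of_int)
    have "h s (m + 2 * int B) - h s m = of_int (- (2 * int s * (A1 * int B2)) - 2 * (A2 * int B1) * m - 2 * (A2 * int B1) * int B)"
    proof -
      have "h s (m + 2 * int B) - h s m = - 2 * real s * (d1 * real B) - 2 * (d2 * real B) * of_int m - 2 * (d2 * real B) * real B"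
        by (simp add: h_def power2_eq_square algebra_simps)
      then show ?thesis unfolding Bd1 Bd2 by simp
    qed
    then have "h s (m + 2 * int B) - h s m \<in> \<int>" by (simp only: Ints_of_int)
    then have "ex (h s (m + 2 * int B) + d2 / 2 * (x - of_int m - x0)\<^sup>2) = ex (h s m + d2 / 2 * (x - of_int m - x0)\<^sup>2)"
      by (intro ex_cong) simp
    moreover have "x + of_int (2 * int B) - of_int (m + 2 * int B) - x0 = x - of_int m - x0" by simp
    ultimately show ?thesis unfolding g_def x1 fl fx x_def[symmetric] m_def[symmetric] by (simp only:)
  qed
  have gcont: "continuous_on UNIV (g s)" for s
  proof (rule continuous_if_dominated)
    show "continuous_on UNIV (\<lambda>t. f (2 * real B * t))"
      by (intro continuous_on_compose2[OF f(1)] continuous_intros) auto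
    show "norm (g s t) \<le> norm (f (2 * real B * t))" for t by (simp add: g_def norm_mult)
    fix t assume "f (2 * real B * t) \<noteq> 0"
    then have "2 * real B * t \<notin> \<int>" using vanish_Ints[of f, OF f(2,3)] by blast
    then have ev: "\<forall>\<^sub>F x in nhds t. \<lfloor>2 * real B * x\<rfloor> = \<lfloor>2 * real B * t\<rfloor>"
      by (intro eventually_floor_const) (auto intro!: continuous_intros)
    have "continuous_on UNIV (\<lambda>x. ex (h s \<lfloor>2 * real B * t\<rfloor> + d2 / 2 * (2 * real B * x - of_int \<lfloor>2 * real B * t\<rfloor> - x0)\<^sup>2) * f (2 * real B * x))"
      by (intro continuous_intros continuous_on_compose2[OF f(1)]) auto
    then have "isCont (\<lambda>x. ex (h s \<lfloor>2 * real B * t\<rfloor> + d2 / 2 * (2 * real B * x - of_int \<lfloor>2 * real B * t\<rfloor> - x0)\<^sup>2) * f (2 * real B * x)) t"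
      by (rule continuous_on_interior) simp
    moreover have "\<forall>\<^sub>F x in nhds t. g s x = ex (h s \<lfloor>2 * real B * t\<rfloor> + d2 / 2 * (2 * real B * x - of_int \<lfloor>2 * real B * t\<rfloor> - x0)\<^sup>2) * f (2 * real B * x)"
      using ev by eventually_elim (simp add: g_def)
    ultimately show "isCont (g s) t" by (subst isCont_cong) 
  qed
  show ?thesis
  proof (rule Orth_residues[OF B])
    show "Orth (\<lambda>n. g s (u / (2 * real B) * real n + x0 / (2 * real B)) * ex (u * d1 / 2 * (real n)\<^sup>2))" for s
      by (rule Orth_mult_continuous[OF Orth_ex_quadratic _ gcont gper]) simp
    fix n s assume "[n = s] (mod B)"
    then have "int B dvd int n - int s" by (simp add: cong_int_iff[symmetric] cong_iff_dvd_diff)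
    then obtain k where "int n - int s = int B * k" by blast
    then have "real_of_int (int n - int s) = real_of_int (int B * k)" by (simp only:)
    then have n: "real n = real s + real B * of_int k" by simp
    define x where "x = u * real n + x0"
    define m where "m = \<lfloor>x\<rfloor>"
    have arg: "2 * real B * (u / (2 * real B) * real n + x0 / (2 * real B)) = x"
      using B by (simp add: x_def field_simps)
    have "u * V / 2 * (real n)\<^sup>2 - V * real n * of_int m
        - (h s m + d2 / 2 * (x - of_int m - x0)\<^sup>2 + u * d1 / 2 * (real n)\<^sup>2)
        = - d1 * (real n - real s) * of_int m"
      unfolding d(3) h_def x_def by (simp add: power2_eq_square algebra_simps)
    also have "\<dots> = - (d1 * real B) * of_int (k * m)" unfolding n by (simp add: algebra_simps)
    also have "\<dots> = of_int (- (A1 * int B2) * (k * m))" unfolding Bd1 by simp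
    finally have "ex (u * V / 2 * (real n)\<^sup>2 - V * real n * of_int m) =
        ex (h s m + d2 / 2 * (x - of_int m - x0)\<^sup>2 + u * d1 / 2 * (real n)\<^sup>2)"
      by (intro ex_cong) (simp only: Ints_of_int)
    then show "ex (u * V / 2 * (real n)\<^sup>2 - V * real n * of_int \<lfloor>u * real n + x0\<rfloor>) * f (u * real n + x0) =
        g s (u / (2 * real B) * real n + x0 / (2 * real B)) * ex (u * d1 / 2 * (real n)\<^sup>2)"
      unfolding g_def arg x_def[symmetric] m_def[symmetric] by (simp add: ex_add)
  qed
qed

text \<open>The correlation of \<open>A\<close> with its shift by \<open>L\<close>: the quadratic part of the phase cancels up to
  \<open>m\<close> times an integer.\<close>

lemma bracket_correlation:
  fixes f :: "real \<Rightarrow> complex" and A :: "real \<Rightarrow> complex" and u V x0 b :: real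
  assumes A: "\<And>m. A m = ex (b * m) * (ex (u * V / 2 * m\<^sup>2 - V * m * of_int \<lfloor>u * m + x0\<rfloor>) * f (u * m + x0))"
  shows "A (m + L) * cnj (A m) = ex (b * L + u * V / 2 * L\<^sup>2 - V * L * (x0 + u * L)) *
    ex (- V * m * of_int (\<lfloor>u * m + x0 + u * L\<rfloor> - \<lfloor>u * m + x0\<rfloor>)) *
    (ex (V * L * (u * m + x0 + u * L - of_int \<lfloor>u * m + x0 + u * L\<rfloor>)) * f (u * m + x0 + u * L) * cnj (f (u * m + x0)))"
proof -
  define x where "x = u * m + x0"
  define k where "k = \<lfloor>x + u * L\<rfloor>"
  define j where "j = \<lfloor>x\<rfloor>"
  have xL: "u * (m + L) + x0 = x + u * L" by (simp add: x_def algebra_simps)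
  have "ex (b * (m + L)) * ex (u * V / 2 * (m + L)\<^sup>2 - V * (m + L) * of_int k) * (ex (- (b * m)) * ex (- (u * V / 2 * m\<^sup>2 - V * m * of_int j)))
     = ex (b * L + u * V / 2 * L\<^sup>2 - V * L * (x0 + u * L)) * ex (- V * m * of_int (k - j)) * ex (V * L * (x + u * L - of_int k))"
    unfolding ex_add[symmetric] by (rule arg_cong[of _ _ ex]) (simp add: x_def power2_eq_square algebra_simps)
  then show ?thesis
    unfolding A complex_cnj_mult cnj_ex xL x_def[symmetric] k_def[symmetric] j_def[symmetric]
    by (simp add: mult_ac)
qed

text \<open>In the product along \<open>p * n\<close> and \<open>q * n\<close>, differenced by
  \<open>l\<close>, the factor of \<open>- V * n\<close> is the integer \<open>W\<close>, which is
  within \<open>p + q\<close> of \<open>u * (p^2 - q^2) * l\<close>. For large \<open>l\<close> it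
  is nonzero and confined to finitely many values. For each of them the remaining factor is a
  continuous periodic function of \<open>u * n\<close>, and \<open>indep\<close> excludes a
  resonance with its frequencies.\<close>

lemma Orth_generic:
  fixes f :: "real \<Rightarrow> complex"
  assumes f: "continuous_on UNIV f" "f 0 = 0" "\<And>x. f (x + 1) = f x" "\<And>x. norm (f x) \<le> 1"
    and u: "u \<noteq> 0" and indep: "\<And>d1 d2. d1 \<in> \<rat> \<Longrightarrow> d2 \<in> \<rat> \<Longrightarrow> V \<noteq> d1 + d2 * u"
  shows "Orth (\<lambda>n. ex (u * V / 2 * (real n)\<^sup>2 - V * real n * of_int \<lfloor>u * real n + x0\<rfloor>) * f (u * real n + x0))"
  unfolding Orth_def
proof (intro allI orth_Katai)
  fix b :: real
  define A where "A m = ex (b * m) * (ex (u * V / 2 * m\<^sup>2 - V * m * of_int \<lfloor>u * m + x0\<rfloor>) * f (u * m + x0))" for m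
  show "norm (ex (b * real n) * (ex (u * V / 2 * (real n)\<^sup>2 - V * real n * of_int \<lfloor>u * real n + x0\<rfloor>) * f (u * real n + x0))) \<le> 1" for n
    using f(4) by (simp add: norm_mult)
  have An: "norm (A m) \<le> 1" for m using f(4) by (simp add: A_def norm_mult)
  fix p q :: nat assume pq: "prime p" "prime q" "p \<noteq> q"
  have pos: "p > 0" "q > 0" using pq prime_gt_0_nat by auto
  have "mean_zero (\<lambda>n. A (real (p * n)) * cnj (A (real (q * n))))"
  proof -
    define D where "D = (real p)\<^sup>2 - (real q)\<^sup>2"
    have D0: "D \<noteq> 0" using pq(3) pos by (simp add: D_def power2_eq_iff)
    \<comment> \<open>Beyond this threshold \<open>\<bar>u * D * l\<bar> > p + q\<close>, so
      \<open>W\<close> cannot vanish.\<close>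
    obtain l0 :: nat where l0: "real l0 > (real p + real q) / \<bar>u * D\<bar>" using reals_Archimedean2 by blast
    show ?thesis
    proof (rule van_der_Corput[of _ "Suc l0"])
      show "norm (A (real (p * n)) * cnj (A (real (q * n)))) \<le> 1" for n
        using mult_le_one[OF An norm_ge_zero An] by (simp add: norm_mult)
      fix l assume "l \<ge> Suc l0"
      then have "real l > (real p + real q) / \<bar>u * D\<bar>" using l0 by linarith
      then have big: "\<bar>u * D * real l\<bar> > real p + real q" using u D0 by (simp add: abs_mult field_simps)
      define fl where "fl r t = \<lfloor>real r * t + x0 + u * real (r * l)\<rfloor> - \<lfloor>real r * t + x0\<rfloor>" for r :: nat and t :: real
      define W where "W t = int p * fl p t - int q * fl q t" for t
      define G where "G r t = ex (V * real (r * l) * (real r * t + x0 + u * real (r * l) - of_int \<lfloor>real r * t + x0 + u * real (r * l)\<rfloor>))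
        * f (real r * t + x0 + u * real (r * l)) * cnj (f (real r * t + x0))" for r :: nat and t :: real
      define c where "c r = ex (b * real (r * l) + u * V / 2 * (real (r * l))\<^sup>2 - V * real (r * l) * (x0 + u * real (r * l)))" for r :: nat
      have cor: "A (real (r * (n + l))) * cnj (A (real (r * n))) = c r * ex (- V * real (r * n) * of_int (fl r (u * real n))) * G r (u * real n)" for r n
      proof -
        have e: "real (r * (n + l)) = real (r * n) + real (r * l)" "u * real (r * n) = real r * (u * real n)"
          by (simp_all add: algebra_simps)
        show ?thesis unfolding e(1) c_def G_def fl_def e(2)[symmetric] by (rule bracket_correlation[OF A_def])
      qed
      have corr: "A (real (p * (n + l))) * cnj (A (real (q * (n + l)))) * cnj (A (real (p * n)) * cnj (A (real (q * n))))
         = (c p * cnj (c q)) * (ex (- V * of_int (W (u * real n)) * real n) * (G p (u * real n) * cnj (G q (u * real n))))" for n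
      proof -
        have "A (real (p * (n + l))) * cnj (A (real (q * (n + l)))) * cnj (A (real (p * n)) * cnj (A (real (q * n))))
          = (A (real (p * (n + l))) * cnj (A (real (p * n)))) * cnj (A (real (q * (n + l))) * cnj (A (real (q * n))))"
          by (simp add: mult_ac)
        also have "\<dots> = (c p * cnj (c q)) * ((ex (- V * real (p * n) * of_int (fl p (u * real n))) * ex (- (- V * real (q * n) * of_int (fl q (u * real n))))) * (G p (u * real n) * cnj (G q (u * real n))))"
          unfolding cor complex_cnj_mult cnj_ex by (simp only: mult_ac)
        also have "ex (- V * real (p * n) * of_int (fl p (u * real n))) * ex (- (- V * real (q * n) * of_int (fl q (u * real n)))) = ex (- V * of_int (W (u * real n)) * real n)"
          unfolding ex_add[symmetric] by (rule arg_cong[of _ _ ex]) (simp add: W_def algebra_simps)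
        finally show ?thesis .
      qed
      have flb: "\<bar>of_int (fl r t) - u * real (r * l)\<bar> < 1" for r t
      proof -
        define y where "y = real r * t + x0"
        define w where "w = u * real (r * l)"
        show ?thesis unfolding fl_def y_def[symmetric] w_def[symmetric]
          using floor_correct[of "y + w"] floor_correct[of y] by (simp add: abs_less_iff) linarith
      qed
      have Wb: "\<bar>of_int (W t) - u * D * real l\<bar> < real p + real q" for t
      proof -
        have "of_int (W t) - u * D * real l = real p * (of_int (fl p t) - u * real (p * l)) - real q * (of_int (fl q t) - u * real (q * l))"
          by (simp add: W_def D_def power2_eq_square algebra_simps)
        moreover have "\<bar>real p * (of_int (fl p t) - u * real (p * l))\<bar> < real p * 1"
          using mult_strict_left_mono[OF flb[of p t], of "real p"] pos by (simp add: abs_mult)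
        moreover have "\<bar>real q * (of_int (fl q t) - u * real (q * l))\<bar> < real q * 1"
          using mult_strict_left_mono[OF flb[of q t], of "real q"] pos by (simp add: abs_mult)
        ultimately show ?thesis by linarith
      qed
      have W0: "W t \<noteq> 0" for t using Wb[of t] big by auto
      obtain K :: int where K: "real_of_int K > \<bar>u * D * real l\<bar> + real p + real q"
        using ex_less_of_int by blast
      have WK: "W t \<in> {-K..K}" for t
      proof -
        have "\<bar>real_of_int (W t)\<bar> < real_of_int K" using Wb[of t] K by linarith
        then show ?thesis by simp linarith
      qed
      define Hw where "Hw w t = (if W t = w then G p t * cnj (G q t) else 0)" for w t
      \<comment> \<open>Every floor entering \<open>G\<close> and \<open>W\<close> jumps only where
        one of these four factors vanishes.\<close>
      define F where "F t = f (real p * t + x0 + u * real (p * l)) * cnj (f (real p * t + x0)) * (f (real q * t + x0 + u * real (q * l)) * cnj (f (real q * t + x0)))" for t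
      have Fcont: "continuous_on UNIV F" unfolding F_def
        by (intro continuous_intros continuous_on_compose2[OF f(1)]) auto
      have Hcont: "continuous_on UNIV (Hw w)" for w
      proof (rule continuous_if_dominated[OF Fcont])
        show "norm (Hw w t) \<le> norm (F t)" for t by (simp add: Hw_def G_def F_def norm_mult)
        fix t assume "F t \<noteq> 0"
        then have "f (real p * t + x0 + u * real (p * l)) \<noteq> 0" "f (real p * t + x0) \<noteq> 0"
          "f (real q * t + x0 + u * real (q * l)) \<noteq> 0" "f (real q * t + x0) \<noteq> 0" by (auto simp: F_def)
        then have nI: "real p * t + x0 + u * real (p * l) \<notin> \<int>" "real p * t + x0 \<notin> \<int>"
          "real q * t + x0 + u * real (q * l) \<notin> \<int>" "real q * t + x0 \<notin> \<int>"
          using vanish_Ints[of f, OF f(2,3)] by blast+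
        have c1: "isCont (\<lambda>t. real r * t + x0 + u * real (r * l)) t" "isCont (\<lambda>t. real r * t + x0) t" for r
          by (intro continuous_intros)+
        note ev = eventually_floor_const[OF c1(1) nI(1)] eventually_floor_const[OF c1(2) nI(2)]
          eventually_floor_const[OF c1(1) nI(3)] eventually_floor_const[OF c1(2) nI(4)]
        define G' where "G' r s = ex (V * real (r * l) * (real r * s + x0 + u * real (r * l) - of_int \<lfloor>real r * t + x0 + u * real (r * l)\<rfloor>))
          * f (real r * s + x0 + u * real (r * l)) * cnj (f (real r * s + x0))" for r :: nat and s :: real
        have "continuous_on UNIV (G' r)" for r unfolding G'_def
          by (intro continuous_intros continuous_on_compose2[OF f(1)]) auto
        then have "isCont (G' r) t" for r by (rule continuous_on_interior) simp
        then have "isCont (\<lambda>s. if W t = w then G' p s * cnj (G' q s) else 0) t"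
          by (cases "W t = w") (auto intro!: continuous_intros)
        moreover have "\<forall>\<^sub>F s in nhds t. Hw w s = (if W t = w then G' p s * cnj (G' q s) else 0)"
          using ev by eventually_elim (simp add: Hw_def G_def G'_def W_def fl_def)
        ultimately show "isCont (Hw w) t" by (subst isCont_cong)
      qed
      have Hper: "Hw w (t + 1) = Hw w t" for w t
      proof -
        interpret periodic_fun_simple' f by unfold_locales (rule f)
        have s: "real r * (t + 1) + x0 + u * real (r * l) = (real r * t + x0 + u * real (r * l)) + of_int (int r)"
          "real r * (t + 1) + x0 = (real r * t + x0) + of_int (int r)" for r
          by (simp_all add: algebra_simps)
        have fl1: "\<lfloor>real r * (t + 1) + x0 + u * real (r * l)\<rfloor> = \<lfloor>real r * t + x0 + u * real (r * l)\<rfloor> + int r"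
          "\<lfloor>real r * (t + 1) + x0\<rfloor> = \<lfloor>real r * t + x0\<rfloor> + int r" for r
          by (subst s(1), rule floor_add_int[symmetric]) (subst s(2), rule floor_add_int[symmetric])
        have f1: "f (real r * (t + 1) + x0 + u * real (r * l)) = f (real r * t + x0 + u * real (r * l))" for r
          unfolding s(1)[of r] by (rule plus_of_int)
        have f2: "f (real r * (t + 1) + x0) = f (real r * t + x0)" for r
          unfolding s(2)[of r] by (rule plus_of_int)
        have fr: "real r * (t + 1) + x0 + u * real (r * l) - of_int (\<lfloor>real r * t + x0 + u * real (r * l)\<rfloor> + int r)
          = real r * t + x0 + u * real (r * l) - of_int \<lfloor>real r * t + x0 + u * real (r * l)\<rfloor>" for r
          by (simp add: algebra_simps)
        have "fl r (t + 1) = fl r t" for r unfolding fl_def fl1 by simp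
        moreover have "G r (t + 1) = G r t" for r by (simp only: G_def fl1 f1 f2 fr)
        ultimately have "fl r (t + 1) = fl r t" "G r (t + 1) = G r t" for r by blast+
        then show ?thesis by (simp add: Hw_def W_def)
      qed
      have mz: "mean_zero (\<lambda>n. ex (- V * of_int w * real n) * Hw w (u * real n))" if "w \<noteq> 0" for w
      proof (rule mean_zero_ex_mult_continuous[OF Hcont Hper])
        fix j :: int
        show "- V * of_int w + of_int j * u \<notin> \<int>"
        proof
          assume "- V * of_int w + of_int j * u \<in> \<int>"
          then obtain k :: int where k: "- V * of_int w + of_int j * u = of_int k" by (rule Ints_cases)
          then have "V = of_int (- k) / of_int w + of_int j / of_int w * u" using that by (simp add: field_simps)
          moreover have "of_int (- k) / of_int w \<in> (\<rat> :: real set)" "of_int j / of_int w \<in> (\<rat> :: real set)"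
            by (intro Rats_divide Rats_of_int)+
          ultimately show False using indep by blast
        qed
      qed
      have "mean_zero (\<lambda>n. (c p * cnj (c q)) * (\<Sum>w\<in>{-K..K} - {0}. ex (- V * of_int w * real n) * Hw w (u * real n)))"
        by (intro mean_zero_cmult mean_zero_sum mz) auto
      also have "(\<lambda>n. (c p * cnj (c q)) * (\<Sum>w\<in>{-K..K} - {0}. ex (- V * of_int w * real n) * Hw w (u * real n)))
        = (\<lambda>n. A (real (p * (n + l))) * cnj (A (real (q * (n + l)))) * cnj (A (real (p * n)) * cnj (A (real (q * n)))))"
      proof
        fix n
        have "(\<Sum>w\<in>{-K..K} - {0}. ex (- V * of_int w * real n) * Hw w (u * real n)) =
          (\<Sum>w\<in>{-K..K} - {0}. if w = W (u * real n) then ex (- V * of_int w * real n) * (G p (u * real n) * cnj (G q (u * real n))) else 0)"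
          by (intro sum.cong refl) (auto simp: Hw_def)
        also have "\<dots> = ex (- V * of_int (W (u * real n)) * real n) * (G p (u * real n) * cnj (G q (u * real n)))"
          using WK[of "u * real n"] W0[of "u * real n"] by (subst sum.delta) auto
        finally show "(c p * cnj (c q)) * (\<Sum>w\<in>{-K..K} - {0}. ex (- V * of_int w * real n) * Hw w (u * real n)) =
          A (real (p * (n + l))) * cnj (A (real (q * (n + l)))) * cnj (A (real (p * n)) * cnj (A (real (q * n))))"
          unfolding corr by (simp only:)
      qed
      finally show "mean_zero (\<lambda>n. A (real (p * (n + l))) * cnj (A (real (q * (n + l)))) * cnj (A (real (p * n)) * cnj (A (real (q * n)))))" .
    qed
  qed
  then show "mean_zero (\<lambda>n. ex (b * real (p * n)) * (ex (u * V / 2 * (real (p * n))\<^sup>2 - V * real (p * n) * of_int \<lfloor>u * real (p * n) + x0\<rfloor>) * f (u * real (p * n) + x0)) *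
      cnj (ex (b * real (q * n)) * (ex (u * V / 2 * (real (q * n))\<^sup>2 - V * real (q * n) * of_int \<lfloor>u * real (q * n) + x0\<rfloor>) * f (u * real (q * n) + x0))))"
    unfolding A_def .
qed

theorem Orth_bracket:
  fixes f :: "real \<Rightarrow> complex"
  assumes f: "continuous_on UNIV f" "f 0 = 0" "\<And>x. f (x + 1) = f x" "\<And>x. norm (f x) \<le> 1"
  shows "Orth (\<lambda>n. ex (u * V / 2 * (real n)\<^sup>2 - V * real n * of_int \<lfloor>u * real n + x0\<rfloor>) * f (u * real n + x0))"
proof (cases "u = 0")
  case True
  have "Orth (\<lambda>n. f x0 * (ex ((- V * of_int \<lfloor>x0\<rfloor>) * real n) * 1))"
    by (intro Orth_cmult Orth_ex_mult Orth_1)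
  then show ?thesis using True by (simp add: mult_ac)
next
  case False
  show ?thesis
  proof (cases "\<exists>d1\<in>\<rat>. \<exists>d2\<in>\<rat>. V = d1 + d2 * u")
    case True
    then show ?thesis using Orth_degenerate[OF f(1-3)] by blast
  next
    case False
    then show ?thesis using Orth_generic[OF f \<open>u \<noteq> 0\<close>] by blast
  qed
qed

subsection \<open>Quadratic orbits on the Heisenberg nilmanifold\<close>

text \<open>In coordinates, \<open>inv\<close> is left invariance under the lattice, whose
  translates of the compact unit cube cover the group.\<close>

lemma heisenberg_invariant_bounded:
  fixes G :: "real \<Rightarrow> real \<Rightarrow> real \<Rightarrow> complex"
  assumes cont: "continuous_on UNIV (\<lambda>(x, z, y). G x z y)"
    and inv: "\<And>x z y a b c. G (x + of_int a) (z + of_int c + of_int a * y) (y + of_int b) = G x z y"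
  obtains C where "C > 0" "\<And>x z y. norm (G x z y) \<le> C"
proof -
  define I where "I = {0..1::real} \<times> {0..1::real} \<times> {0..1::real}"
  have "compact I" unfolding I_def by (intro compact_Times compact_Icc)
  then have "bounded ((\<lambda>(x, z, y). G x z y) ` I)"
    using cont by (intro compact_imp_bounded compact_continuous_image continuous_on_subset[OF cont]) auto
  then obtain C where C: "C > 0" "\<And>w. w \<in> I \<Longrightarrow> norm ((\<lambda>(x, z, y). G x z y) w) \<le> C"
    unfolding bounded_pos by blast
  have "norm (G x z y) \<le> C" for x z y
  proof -
    have "G x z y = G (x + of_int (- \<lfloor>x\<rfloor>)) (z + of_int (- \<lfloor>z + of_int (- \<lfloor>x\<rfloor>) * y\<rfloor>) + of_int (- \<lfloor>x\<rfloor>) * y) (y + of_int (- \<lfloor>y\<rfloor>))"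
      by (rule inv[symmetric])
    also have "\<dots> = G (frac x) (frac (z + of_int (- \<lfloor>x\<rfloor>) * y)) (frac y)"
      by (simp add: frac_def algebra_simps)
    finally have e: "G x z y = G (frac x) (frac (z + of_int (- \<lfloor>x\<rfloor>) * y)) (frac y)" .
    have "(frac x, frac (z + of_int (- \<lfloor>x\<rfloor>) * y), frac y) \<in> I"
      by (auto simp: I_def frac_lt_1 less_imp_le)
    from C(2)[OF this] show ?thesis unfolding e by simp
  qed
  with C(1) that show thesis by blast
qed

lemma sin_pi_Ints: "t \<in> \<int> \<Longrightarrow> sin (pi * t) = 0"
  by (metis sin_integer_2pi Ints_cases mult.commute sin_zero_iff_int2)

lemma abs_sin_pi_add_1: "\<bar>sin (pi * (t + 1))\<bar> = \<bar>sin (pi * t)\<bar>"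
  by (simp add: distrib_left)

text \<open>The square provides two factors vanishing at integers. One makes \<open>K\<close>
  continuous although \<open>frac\<close> jumps; the other stays beside each monomial and produces a
  bracket phase to which \<open>Orth_bracket\<close> applies.\<close>

lemma Orth_nil_vanishing:
  fixes G :: "real \<Rightarrow> real \<Rightarrow> real \<Rightarrow> complex"
  assumes cont: "continuous_on UNIV (\<lambda>(x, z, y). G x z y)"
    and inv: "\<And>x z y a b c. G (x + of_int a) (z + of_int c + of_int a * y) (y + of_int b) = G x z y"
  shows "Orth (\<lambda>n. of_real ((sin (pi * (x0 + u * real n)))\<^sup>2) *
    G (x0 + u * real n) (z0 + w * real n + u * v / 2 * (real n)\<^sup>2) (y0 + v * real n))"
proof -
  obtain C where C: "C > 0" "\<And>x z y. norm (G x z y) \<le> C"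
    using heisenberg_invariant_bounded[of G, OF cont inv] by metis
  define s where "s t = \<bar>sin (pi * t)\<bar>" for t
  have s1: "s (t + 1) = s t" for t unfolding s_def by (rule abs_sin_pi_add_1)
  have sle: "0 \<le> s t" "s t \<le> 1" for t by (simp_all add: s_def)
  have sI: "t \<notin> \<int>" if "s t \<noteq> 0" for t using that sin_pi_Ints by (auto simp: s_def)
  have scont: "continuous_on A s" for A unfolding s_def by (intro continuous_intros)
  \<comment> \<open>Left translation by the lattice sends \<open>(x, z, y)\<close> to
    \<open>(frac x, z - \<lfloor>x\<rfloor> * y, y)\<close>. With the second coordinate treated as
    an independent variable \<open>q\<close>, the function has period 1 in each argument.\<close>
  define K where "K x q y = of_real (s x) * G (frac x) q y" for x q y
  have Kcont: "continuous_on UNIV (\<lambda>(x, q, y). K x q y)"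
  proof (rule continuous_if_dominated)
    show "continuous_on UNIV (\<lambda>t :: real \<times> real \<times> real. complex_of_real (C * s (fst t)))"
      by (intro continuous_intros continuous_on_compose2[OF scont[of UNIV]]) auto
    show "norm ((\<lambda>(x, q, y). K x q y) t) \<le> norm (complex_of_real (C * s (fst t)))" for t
      using mult_left_mono[OF C(2) sle(1)] C(1) sle(1)
      by (simp add: K_def norm_mult case_prod_unfold abs_mult mult.commute[of C])
    fix t :: "real \<times> real \<times> real"
    assume "complex_of_real (C * s (fst t)) \<noteq> 0"
    then have "fst t \<notin> \<int>" using sI by auto
    then have ev: "\<forall>\<^sub>F r in nhds t. \<lfloor>fst r\<rfloor> = \<lfloor>fst t\<rfloor>"
      by (intro eventually_floor_const) (auto intro!: continuous_intros)
    have "continuous_on UNIV (\<lambda>r. of_real (s (fst r)) * (\<lambda>(x, z, y). G x z y) (fst r - of_int \<lfloor>fst t\<rfloor>, fst (snd r), snd (snd r)))"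
      by (intro continuous_intros continuous_on_compose2[OF scont[of UNIV]] continuous_on_compose2[OF cont]) auto
    then have "isCont (\<lambda>r. of_real (s (fst r)) * (\<lambda>(x, z, y). G x z y) (fst r - of_int \<lfloor>fst t\<rfloor>, fst (snd r), snd (snd r))) t"
      by (rule continuous_on_interior) simp
    moreover have "\<forall>\<^sub>F r in nhds t. (\<lambda>(x, q, y). K x q y) r = of_real (s (fst r)) * (\<lambda>(x, z, y). G x z y) (fst r - of_int \<lfloor>fst t\<rfloor>, fst (snd r), snd (snd r))"
      using ev by eventually_elim (simp add: K_def frac_def case_prod_unfold)
    ultimately show "isCont (\<lambda>(x, q, y). K x q y) t" by (subst isCont_cong)
  qed
  have Kper: "K (x + 1) q y = K x q y" "K x (q + 1) y = K x q y" "K x q (y + 1) = K x q y" for x q y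
    using inv[of "frac x" 0 q 1 y 0] inv[of "frac x" 0 q 0 y 1] by (simp_all add: K_def s1 frac_def)
  have K: "K x (z - of_int \<lfloor>x\<rfloor> * y) y = of_real (s x) * G x z y" for x z y
    using inv[of x "- \<lfloor>x\<rfloor>" z 0 y 0] by (simp add: K_def frac_def)
  define X where "X n = x0 + u * real n" for n
  define Y where "Y n = y0 + v * real n" for n
  define Z where "Z n = z0 + w * real n + u * v / 2 * (real n)\<^sup>2" for n
  have mono: "Orth (\<lambda>n. of_real (s (X n)) * P (X n) (Z n - of_int \<lfloor>X n\<rfloor> * Y n) (Y n))" if "trig3 P" for P
    using that
  proof (induction rule: trig3.induct)
    case (monomial c i j k)
    \<comment> \<open>The constant \<open>y0\<close> in \<open>Y n\<close> contributes \<open>- j *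
      y0 * \<lfloor>X n\<rfloor> = j * y0 * frac (X n) - j * y0 * X n\<close>. The first part is
      absorbed here; the second is a linear phase.\<close>
    define f where "f x = of_real (s x) * ex (of_int i * x + of_int j * y0 * frac x)" for x
    have "Orth (\<lambda>n. ex (u * (of_int j * v) / 2 * (real n)\<^sup>2 - of_int j * v * real n * of_int \<lfloor>u * real n + x0\<rfloor>) * f (u * real n + x0))"
    proof (rule Orth_bracket)
      show "continuous_on UNIV f"
      proof (rule continuous_if_dominated)
        show "continuous_on UNIV (\<lambda>t. complex_of_real (s t))"
          by (intro continuous_intros scont)
        show "norm (f t) \<le> norm (complex_of_real (s t))" for t by (simp add: f_def norm_mult)
        fix t :: real assume "complex_of_real (s t) \<noteq> 0"
        then have "t \<notin> \<int>" using sI by auto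
        then have ev: "\<forall>\<^sub>F r in nhds t. \<lfloor>r\<rfloor> = \<lfloor>t\<rfloor>"
          by (intro eventually_floor_const) (auto intro!: continuous_intros)
        have "continuous_on UNIV (\<lambda>r. of_real (s r) * ex (of_int i * r + of_int j * y0 * (r - of_int \<lfloor>t\<rfloor>)))"
          by (intro continuous_intros scont)
        then have "isCont (\<lambda>r. of_real (s r) * ex (of_int i * r + of_int j * y0 * (r - of_int \<lfloor>t\<rfloor>))) t"
          by (rule continuous_on_interior) simp
        moreover have "\<forall>\<^sub>F r in nhds t. f r = of_real (s r) * ex (of_int i * r + of_int j * y0 * (r - of_int \<lfloor>t\<rfloor>))"
          using ev by eventually_elim (simp add: f_def frac_def)
        ultimately show "isCont f t" by (subst isCont_cong)
      qed
      show "f 0 = 0" by (simp add: f_def s_def)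
      show "f (x + 1) = f x" for x
      proof -
        have "ex (of_int i * (x + 1) + of_int j * y0 * frac (x + 1)) = ex (of_int i * x + of_int j * y0 * frac x)"
          by (rule ex_cong) (simp add: frac_def algebra_simps)
        then show ?thesis unfolding f_def s1 by simp
      qed
      show "norm (f x) \<le> 1" for x using sle[of x] by (simp add: f_def norm_mult)
    qed
    then have "Orth (\<lambda>n. c * ex (of_int j * z0 + of_int k * y0 - of_int j * y0 * x0) *
      (ex ((of_int j * w + of_int k * v - of_int j * y0 * u) * real n) *
      (ex (u * (of_int j * v) / 2 * (real n)\<^sup>2 - of_int j * v * real n * of_int \<lfloor>u * real n + x0\<rfloor>) * f (u * real n + x0))))"
      by (intro Orth_cmult Orth_ex_mult)
    also have "?this \<longleftrightarrow> ?case"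
    proof (rule Orth_cong)
      fix n :: nat
      have xc: "u * real n + x0 = X n" by (simp add: X_def)
      have e: "of_int j * z0 + of_int k * y0 - of_int j * y0 * x0 + ((of_int j * w + of_int k * v - of_int j * y0 * u) * real n
          + (u * (of_int j * v) / 2 * (real n)\<^sup>2 - of_int j * v * real n * of_int \<lfloor>X n\<rfloor> + (of_int i * X n + of_int j * y0 * frac (X n))))
        = of_int i * X n + of_int j * (Z n - of_int \<lfloor>X n\<rfloor> * Y n) + of_int k * Y n"
        unfolding frac_def Z_def Y_def by (simp add: X_def algebra_simps)
      show "c * ex (of_int j * z0 + of_int k * y0 - of_int j * y0 * x0) *
      (ex ((of_int j * w + of_int k * v - of_int j * y0 * u) * real n) *
      (ex (u * (of_int j * v) / 2 * (real n)\<^sup>2 - of_int j * v * real n * of_int \<lfloor>u * real n + x0\<rfloor>) * f (u * real n + x0)))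
       = of_real (s (X n)) * (c * ex (of_int i * X n + of_int j * (Z n - of_int \<lfloor>X n\<rfloor> * Y n) + of_int k * Y n))"
        unfolding e[symmetric] xc f_def ex_add by (simp add: mult_ac)
    qed
    finally show ?case .
  next
    case (add P Q)
    then show ?case using Orth_add by (simp add: distrib_left)
  qed
  have "Orth (\<lambda>n. of_real (s (X n)) * (of_real (s (X n)) * G (X n) (Z n) (Y n)))"
  proof (rule Orth_uniform_limit)
    fix e :: real assume "e > 0"
    obtain P where P: "trig3 P" "\<And>x q y. norm (K x q y - P x q y) < e"
      using trig3_approx[OF Kcont Kper \<open>e > 0\<close>] by metis
    have "norm (of_real (s (X n)) * (of_real (s (X n)) * G (X n) (Z n) (Y n))
        - of_real (s (X n)) * P (X n) (Z n - of_int \<lfloor>X n\<rfloor> * Y n) (Y n)) \<le> e" for n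
    proof -
      have "norm (of_real (s (X n)) * (of_real (s (X n)) * G (X n) (Z n) (Y n))
        - of_real (s (X n)) * P (X n) (Z n - of_int \<lfloor>X n\<rfloor> * Y n) (Y n))
        = s (X n) * norm (K (X n) (Z n - of_int \<lfloor>X n\<rfloor> * Y n) (Y n) - P (X n) (Z n - of_int \<lfloor>X n\<rfloor> * Y n) (Y n))"
        unfolding K right_diff_distrib[symmetric] norm_mult using sle by simp
      also have "\<dots> \<le> 1 * e" using sle P(2) \<open>e > 0\<close> by (intro mult_mono less_imp_le[OF P(2)]) auto
      finally show ?thesis by simp
    qed
    with mono[OF P(1)] show "\<exists>b. Orth b \<and> (\<forall>n. norm (of_real (s (X n)) * (of_real (s (X n)) * G (X n) (Z n) (Y n)) - b n) \<le> e)"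
      by blast
  qed
  then show ?thesis
    by (simp add: s_def X_def Y_def Z_def mult.assoc[symmetric] power2_eq_square flip: of_real_mult)
qed

text \<open>By \<open>sin^2 + cos^2 = 1\<close> it suffices to treat the cosine half, which is the
  sine half for \<open>G\<close> translated by 1/2 in \<open>x\<close>. That is a right translation,
  by \<open>heis (-1/2) 0 0\<close>, so left invariance under the lattice is preserved.\<close>

theorem Orth_nil:
  fixes G :: "real \<Rightarrow> real \<Rightarrow> real \<Rightarrow> complex"
  assumes cont: "continuous_on UNIV (\<lambda>(x, z, y). G x z y)"
    and inv: "\<And>x z y a b c. G (x + of_int a) (z + of_int c + of_int a * y) (y + of_int b) = G x z y"
  shows "Orth (\<lambda>n. G (x0 + u * real n) (z0 + w * real n + u * v / 2 * (real n)\<^sup>2) (y0 + v * real n))"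
proof -
  define G' where "G' x z y = G (x - 1/2) z y" for x z y
  have "continuous_on UNIV (\<lambda>t. (\<lambda>(x, z, y). G x z y) (fst t - 1/2, snd t))"
    by (intro continuous_on_compose2[OF cont] continuous_intros) auto
  then have cont': "continuous_on UNIV (\<lambda>(x, z, y). G' x z y)"
    by (simp add: G'_def case_prod_unfold)
  have inv': "G' (x + of_int a) (z + of_int c + of_int a * y) (y + of_int b) = G' x z y" for x z y a b c
    using inv[of "x - 1/2" a z c y b] by (simp add: G'_def algebra_simps)
  have sc: "sin (pi * (x0 + 1/2 + u * real n)) = cos (pi * (x0 + u * real n))" for n
  proof -
    have "pi * (x0 + 1/2 + u * real n) = pi * (x0 + u * real n) + pi / 2" by (simp add: algebra_simps)
    then show ?thesis by (simp add: sin_add)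
  qed
  have e: "x0 + 1/2 + u * real n - 1/2 = x0 + u * real n" for n by simp
  from Orth_nil_vanishing[of G' "x0 + 1/2" u z0 w v y0, OF cont' inv']
  have 2: "Orth (\<lambda>n. of_real ((cos (pi * (x0 + u * real n)))\<^sup>2) *
     G (x0 + u * real n) (z0 + w * real n + u * v / 2 * (real n)\<^sup>2) (y0 + v * real n))"
    unfolding sc by (simp only: G'_def e)
  have "of_real ((sin t)\<^sup>2) + of_real ((cos t)\<^sup>2) = (1 :: complex)" for t :: real
    by (simp flip: of_real_add del: of_real_power)
  then have "of_real ((sin t)\<^sup>2) * r + of_real ((cos t)\<^sup>2) * r = r" for t :: real and r :: complex
    by (simp only: mult_1_left flip: distrib_right)
  with Orth_add[OF Orth_nil_vanishing[of G x0 u z0 w v y0, OF cont inv] 2] show ?thesis by (simp only:)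
qed

section \<open>Orbits of the skew product in coordinates\<close>

lemma continuous_on_heis: "continuous_on S (\<lambda>(x, z, y). heis x z y)"
proof -
  have eq: "(\<lambda>(x, z, y). heis x z y) = (\<lambda>t. mat 1 + fst t *\<^sub>R (heis 1 0 0 - mat 1)
      + fst (snd t) *\<^sub>R (heis 0 1 0 - mat 1) + snd (snd t) *\<^sub>R (heis 0 0 1 - mat 1))"
    by (simp add: fun_eq_iff vec_eq_iff forall_3 flip: heis_0)
  show ?thesis unfolding eq by (intro continuous_intros)
qed

lemma lattice_coset_cong:
  "heisenberg_lattice #>\<^bsub>heisenberg_group\<^esub> heis (x + of_int a) (z + of_int c + of_int a * y) (y + of_int b)
    = heisenberg_lattice #>\<^bsub>heisenberg_group\<^esub> heis x z y"
proof -
  interpret group heisenberg_group by (rule group_heisenberg)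
  have l: "heis (of_int a) (of_int c) (of_int b) \<in> heisenberg_lattice" by (simp add: heis_in_lattice_iff)
  have sub: "heisenberg_lattice \<subseteq> carrier heisenberg_group"
    using subgroup_heisenberg_lattice by (rule subgroup.subset)
  have "heis (x + of_int a) (z + of_int c + of_int a * y) (y + of_int b)
      = heis (of_int a) (of_int c) (of_int b) \<otimes>\<^bsub>heisenberg_group\<^esub> heis x z y"
    by (simp add: heisenberg_group_def heis_mult add_ac)
  then have "heisenberg_lattice #>\<^bsub>heisenberg_group\<^esub> heis (x + of_int a) (z + of_int c + of_int a * y) (y + of_int b)
      = (heisenberg_lattice #>\<^bsub>heisenberg_group\<^esub> heis (of_int a) (of_int c) (of_int b)) #>\<^bsub>heisenberg_group\<^esub> heis x z y"
    using coset_mult_assoc[OF sub heis_in_carrier heis_in_carrier] by simp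
  then show ?thesis
    using coset_join2[OF heis_in_carrier subgroup_heisenberg_lattice l] by simp
qed

lemma circle_coset_cong:
  assumes "t - t' \<in> \<int>"
  shows "\<int> #>\<^bsub>real_add_group\<^esub> t = \<int> #>\<^bsub>real_add_group\<^esub> t'"
proof -
  have "t - t' + k \<in> \<int>" "t' - t + k \<in> \<int>" if "k \<in> \<int>" for k :: real
    using assms that Ints_minus[OF assms] by auto
  then have "\<exists>h\<in>\<int>. k + t = h + t'" "\<exists>h\<in>\<int>. k + t' = h + t" if "k \<in> \<int>" for k :: real
    using that by (metis add.commute diff_add_cancel add.assoc)+
  then show ?thesis unfolding r_coset_def real_add_group_def by auto
qed

text \<open>The circle coordinate is held fixed, as it is along a residue class of the orbit modulo
  the denominator of the rotation.\<close>

lemma continuous_on_nilmanifold_fibre: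
  assumes "continuous_map (prod_topology circle heisenberg_nilmanifold) euclidean f"
  shows "continuous_on UNIV (\<lambda>(x, z, y). f (\<int> #>\<^bsub>real_add_group\<^esub> t, heisenberg_lattice #>\<^bsub>heisenberg_group\<^esub> heis x z y))"
proof -
  have "continuous_map euclidean (top_of_set (carrier heisenberg_group)) (\<lambda>(x, z, y). heis x z y)"
    using continuous_on_heis heis_in_carrier by (auto simp: continuous_map_in_subtopology)
  from continuous_map_compose[OF this, of heisenberg_nilmanifold "\<lambda>g. heisenberg_lattice #>\<^bsub>heisenberg_group\<^esub> g"]
  have 1: "continuous_map euclidean heisenberg_nilmanifold
      (\<lambda>r. heisenberg_lattice #>\<^bsub>heisenberg_group\<^esub> (\<lambda>(x, z, y). heis x z y) r)"
    unfolding heisenberg_nilmanifold_def comp_def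
    by (simp add: quotient_imp_continuous_map quotient_map_quotient_topology)
  have "\<int> #>\<^bsub>real_add_group\<^esub> t \<in> topspace circle" by (simp add: circle_def)
  then have "continuous_map euclidean circle (\<lambda>r :: real \<times> real \<times> real. \<int> #>\<^bsub>real_add_group\<^esub> t)" by simp
  from continuous_map_compose[OF continuous_map_pairedI[OF this 1] assms] show ?thesis
    by (simp add: comp_def case_prod_unfold)
qed

theorem theorem1p1:
  fixes \<alpha> :: real and \<phi>\<^sub>1 \<phi>\<^sub>2 \<psi> :: "real \<Rightarrow> real"
  assumes "\<alpha> \<in> \<rat> \<inter> {0..<1}"
    and "smooth \<phi>\<^sub>1" "smooth \<phi>\<^sub>2" "smooth \<psi>"
    and "\<And>t. \<phi>\<^sub>1 (t + 1) = \<phi>\<^sub>1 t" "\<And>t. \<phi>\<^sub>2 (t + 1) = \<phi>\<^sub>2 t" "\<And>t. \<psi> (t + 1) = \<psi> t"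
  shows "linearly_disjoint (\<lambda>n. of_int (moebius n))
           (prod_topology circle heisenberg_nilmanifold)
           (skew_product \<alpha> \<phi>\<^sub>1 \<phi>\<^sub>2 \<psi>)"
  unfolding linearly_disjoint_def
proof (intro allI impI ballI)
  fix f :: "real set \<times> (real^3^3) set \<Rightarrow> complex" and P
  assume f: "continuous_map (prod_topology circle heisenberg_nilmanifold) euclidean f"
    and P: "P \<in> topspace (prod_topology circle heisenberg_nilmanifold)"
  let ?S = "skew_product \<alpha> \<phi>\<^sub>1 \<phi>\<^sub>2 \<psi>"
  define R where "R t = \<int> #>\<^bsub>real_add_group\<^esub> t" for t
  define Q where "Q g = heisenberg_lattice #>\<^bsub>heisenberg_group\<^esub> g" for g
  from P obtain t0 x0 z0 y0 where P: "P = (R t0, Q (heis x0 z0 y0))"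
    by (auto simp: topspace_circle topspace_heisenberg_nilmanifold RCOSETS_def R_def Q_def heisenberg_group_def)
  obtain k :: int and q :: nat where q: "q > 0" "\<alpha> * real q = of_int k"
  proof -
    from assms(1) have "\<alpha> \<in> \<rat>" by blast
    then obtain a b :: int where "b > 0" "\<alpha> = of_int a / of_int b" by (rule Rats_cases')
    then show thesis by (intro that[of "nat b" a]) auto
  qed
  \<comment> \<open>Birkhoff sums of the matrix entries. The product with \<open>X i\<close> in
    \<open>Z\<close> is the contribution of the corner entry of the matrix product.\<close>
  define X where "X n = x0 + (\<Sum>i<n. \<phi>\<^sub>2 (t0 + real i * \<alpha>))" for n
  define Y where "Y n = y0 + (\<Sum>i<n. \<phi>\<^sub>1 (t0 + real i * \<alpha>))" for n
  define Z where "Z n = z0 + (\<Sum>i<n. \<psi> (t0 + real i * \<alpha>) + X i * \<phi>\<^sub>1 (t0 + real i * \<alpha>))" for n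
  have orbit: "(?S ^^ n) P = (R (t0 + real n * \<alpha>), Q (heis (X n) (Z n) (Y n)))" for n
  proof (induction n)
    case 0
    show ?case by (simp add: P X_def Y_def Z_def)
  next
    case (Suc n)
    have "?S (R (t0 + real n * \<alpha>), Q (heis (X n) (Z n) (Y n))) =
        (R (t0 + real n * \<alpha> + \<alpha>), Q (heis (X n) (Z n) (Y n) \<otimes>\<^bsub>heisenberg_group\<^esub>
          heis (\<phi>\<^sub>2 (t0 + real n * \<alpha>)) (\<psi> (t0 + real n * \<alpha>)) (\<phi>\<^sub>1 (t0 + real n * \<alpha>))))"
      unfolding R_def Q_def by (intro skew_product_coset assms heis_in_carrier)
    then show ?case
      by (simp add: Suc.IH heisenberg_group_def heis_mult X_def Y_def Z_def algebra_simps)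
  qed
  have per: "\<phi> (t0 + real (n + q) * \<alpha>) = \<phi> (t0 + real n * \<alpha>)" if "\<And>t. \<phi> (t + 1) = \<phi> t" for \<phi> :: "real \<Rightarrow> real" and n
  proof -
    interpret periodic_fun_simple' \<phi> by standard (rule that)
    have "t0 + real (n + q) * \<alpha> = t0 + real n * \<alpha> + of_int k" using q(2) by (simp add: algebra_simps)
    then show ?thesis by (simp only: plus_of_int)
  qed
  note per1 = per[where \<phi> = \<phi>\<^sub>1, OF assms(5)] and per2 = per[where \<phi> = \<phi>\<^sub>2, OF assms(6)]
    and per3 = per[where \<phi> = \<psi>, OF assms(7)]
  \<comment> \<open>Increments over one period \<open>q\<close> of the rotation. Besides its own
    increment \<open>Z\<close> gains \<open>u * (Y n - y0)\<close>, because its summands contain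
    \<open>X\<close>, which has grown by \<open>u\<close>.\<close>
  define u v where "u = X q - x0" and "v = Y q - y0"
  have Xq: "X (n + q) = X n + u" for n
    by (induction n) (simp_all add: u_def X_def per2[unfolded of_nat_add])
  have Yq: "Y (n + q) = Y n + v" for n
    by (induction n) (simp_all add: v_def Y_def per1[unfolded of_nat_add])
  have Zq: "Z (n + q) = Z n + (Z q - z0) + u * (Y n - y0)" for n
  proof (induction n)
    case 0
    show ?case by (simp add: Z_def Y_def)
  next
    case (Suc n)
    have "Z (Suc n + q) = Z (n + q) + (\<psi> (t0 + real (n + q) * \<alpha>) + X (n + q) * \<phi>\<^sub>1 (t0 + real (n + q) * \<alpha>))"
      "Z (Suc n) = Z n + (\<psi> (t0 + real n * \<alpha>) + X n * \<phi>\<^sub>1 (t0 + real n * \<alpha>))"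
      "Y (Suc n) = Y n + \<phi>\<^sub>1 (t0 + real n * \<alpha>)"
      by (simp_all add: Z_def Y_def)
    then show ?case unfolding per1 per3 Xq Suc.IH by (simp add: algebra_simps)
  qed
  have Xm: "X (s + m * q) = X s + real m * u" and Ym: "Y (s + m * q) = Y s + real m * v" for s m
  proof (induction m)
    case (Suc m)
    have e: "s + Suc m * q = s + m * q + q" by simp
    { case 1
      show ?case unfolding e Xq Suc.IH by (simp add: distrib_right)
    next
      case 2
      show ?case unfolding e Yq Suc.IH by (simp add: distrib_right)
    }
  qed simp_all
  \<comment> \<open>Summing the gains \<open>u * (Y s + i * v - y0)\<close> over
    \<open>i < m\<close> produces \<open>u * v * m * (m - 1) / 2\<close>, hence the leading
    coefficient \<open>u * v / 2\<close> and the correction \<open>- u * v / 2\<close> in the linear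
    term.\<close>
  have Zm: "Z (s + m * q) = Z s + real m * (Z q - z0 + u * (Y s - y0) - u * v / 2) + u * v / 2 * (real m)\<^sup>2" for s m
  proof (induction m)
    case (Suc m)
    have "Z (s + Suc m * q) = Z (s + m * q + q)" by (simp add: add_ac)
    then show ?case unfolding Zq Suc.IH Ym by (simp add: power2_eq_square field_simps)
  qed simp
  \<comment> \<open>The formulas with \<open>m = (n - r) / q\<close> inserted: the slopes become
    \<open>u / q\<close> and \<open>v / q\<close>, and the quadratic coefficient is again half their
    product, as \<open>Orth_nil\<close> requires.\<close>
  define b where "b r n = f (R (t0 + real r * \<alpha>), Q (heis
      (X r - u / q * real r + u / q * real n)
      (Z r - (Z q - z0 + u * (Y r - y0) - u * v / 2) / q * real r + (u / q) * (v / q) / 2 * (real r)\<^sup>2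
        + ((Z q - z0 + u * (Y r - y0) - u * v / 2) / q - (u / q) * (v / q) * real r) * real n + (u / q) * (v / q) / 2 * (real n)\<^sup>2)
      (Y r - v / q * real r + v / q * real n)))" for r n
  have b: "Orth (b r)" for r
    unfolding b_def R_def Q_def
    by (rule Orth_nil[where G = "\<lambda>x z y. f (_, _ #>\<^bsub>_\<^esub> heis x z y)"])
      (simp_all only: continuous_on_nilmanifold_fibre[OF f] lattice_coset_cong)
  have "Orth (\<lambda>n. f ((?S ^^ n) P))"
  proof (rule Orth_residues[OF q(1), of "\<lambda>s. b (s mod q)"])
    show "Orth (b (s mod q))" for s by (rule b)
    fix n s assume "[n = s] (mod q)"
    define r m where "r = s mod q" and "m = n div q"
    have n: "n = r + m * q"
      using \<open>[n = s] (mod q)\<close> unfolding r_def m_def cong_def by (metis mod_div_mult_eq)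
    have rn: "real n = real r + real m * real q" unfolding n by simp
    have "t0 + real n * \<alpha> - (t0 + real r * \<alpha>) = of_int (int m * k)"
      unfolding rn using q(2) by (simp add: algebra_simps)
    then have "R (t0 + real n * \<alpha>) = R (t0 + real r * \<alpha>)"
      unfolding R_def by (intro circle_coset_cong) (simp only: Ints_of_int)
    moreover have "X n = X r - u / q * real r + u / q * real n" "Y n = Y r - v / q * real r + v / q * real n"
      unfolding rn using Xm[of r m] Ym[of r m] q(1) by (simp_all add: n field_simps)
    moreover have "Z n = Z r - (Z q - z0 + u * (Y r - y0) - u * v / 2) / q * real r + (u / q) * (v / q) / 2 * (real r)\<^sup>2
        + ((Z q - z0 + u * (Y r - y0) - u * v / 2) / q - (u / q) * (v / q) * real r) * real n + (u / q) * (v / q) / 2 * (real n)\<^sup>2"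
    proof -
      define E where "E = Z q - z0 + u * (Y r - y0) - u * v / 2"
      have m: "real m = (real n - real r) / q" using q(1) by (simp add: rn)
      have "Z n = Z r + (real n - real r) / q * E + u * v / 2 * ((real n - real r) / q)\<^sup>2"
        unfolding m[symmetric] E_def using Zm[of r m] by (simp add: n)
      also have "\<dots> = Z r - E / q * real r + (u / q) * (v / q) / 2 * (real r)\<^sup>2
        + (E / q - (u / q) * (v / q) * real r) * real n + (u / q) * (v / q) / 2 * (real n)\<^sup>2"
        using q(1) by (simp add: power2_eq_square field_simps)
      finally show ?thesis unfolding E_def .
    qed
    ultimately show "f ((?S ^^ n) P) = b (s mod q) n"
      unfolding orbit b_def r_def[symmetric] by simp
  qed
  from Orth_imp_orth[OF this]
  show "(\<lambda>N. 1 / of_nat N * (\<Sum>n = 1..N. of_int (moebius n) * f ((?S ^^ n) P))) \<longlonglongrightarrow> 0"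
    unfolding orth_def mean_zero_def .
qed

end
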